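(* The promise problem $\textsc{N-Free}(\mathrm{Succinct},\mathrm{PO})$ is $\mathbf{PP}$-hard under polynomial-time many-one reductions.
   Context: Poset game on a finite poset $P$: players alternate; a move chooses a point $x$ of the current poset $Q$ and replaces $Q$ by $\{y\in Q: x\not\le y\}$; the first player unable to move loses; $P$ is an $\exists$-game if the first player has a winning strategy. An "N" in a poset is a set of four elements $a,b,c,d$ with $a<b$, $c<d$, $c<b$, and the pairs $\{a,c\},\{a,d\},\{b,d\}$ incomparable; a poset is N-free if it contains no N as an induced subposet. $\textsc{N-Free}(\mathrm{Succinct},\mathrm{PO})$ is the promise problem: Input: a Boolean circuit $C$ with one output bit and two $n$-bit inputs (possibly with an auxiliary membership circuit specifying the point set as a subset of $\{0,1\}^n$). Promise: the relation $\{(y,z): C(y,z)=1\}$ is a partial order on the point set, and this poset $P$ is N-free. Question: is $P$ an $\exists$-game? $\mathbf{PP}$ is probabilistic polynomial time (majority acceptance). *)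

theory Defs
  imports Main
begin

text \<open>Game positions are sets Q; a move picks x in Q and goes to {y in Q. not x <= y}.
  The player to move with no move loses.  win le Q: the player to move from Q has a
  winning strategy (least fixed point; on finite positions this is the usual game value).\<close>

inductive win :: "('a \<Rightarrow> 'a \<Rightarrow> bool) \<Rightarrow> 'a set \<Rightarrow> bool"
  and lose :: "('a \<Rightarrow> 'a \<Rightarrow> bool) \<Rightarrow> 'a set \<Rightarrow> bool"
  for le :: "'a \<Rightarrow> 'a \<Rightarrow> bool" where
  winI: "x \<in> Q \<Longrightarrow> lose le {y \<in> Q. \<not> le x y} \<Longrightarrow> win le Q"
| loseI: "(\<forall>x\<in>Q. win le {y \<in> Q. \<not> le x y}) \<Longrightarrow> lose le Q"

definition exists_game :: "('a \<Rightarrow> 'a \<Rightarrow> bool) \<Rightarrow> 'a set \<Rightarrow> bool" where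
  "exists_game le P \<longleftrightarrow> win le P"

definition partial_order_on_set :: "'a set \<Rightarrow> ('a \<Rightarrow> 'a \<Rightarrow> bool) \<Rightarrow> bool" where
  "partial_order_on_set P le \<longleftrightarrow>
     (\<forall>x\<in>P. le x x) \<and>
     (\<forall>x\<in>P. \<forall>y\<in>P. le x y \<and> le y x \<longrightarrow> x = y) \<and>
     (\<forall>x\<in>P. \<forall>y\<in>P. \<forall>z\<in>P. le x y \<and> le y z \<longrightarrow> le x z)"

definition strict :: "('a \<Rightarrow> 'a \<Rightarrow> bool) \<Rightarrow> 'a \<Rightarrow> 'a \<Rightarrow> bool" where
  "strict le x y \<longleftrightarrow> le x y \<and> x \<noteq> y"

definition incomparable :: "('a \<Rightarrow> 'a \<Rightarrow> bool) \<Rightarrow> 'a \<Rightarrow> 'a \<Rightarrow> bool" where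
  "incomparable le x y \<longleftrightarrow> \<not> le x y \<and> \<not> le y x"

definition N_free :: "'a set \<Rightarrow> ('a \<Rightarrow> 'a \<Rightarrow> bool) \<Rightarrow> bool" where
  "N_free P le \<longleftrightarrow> \<not> (\<exists>a\<in>P. \<exists>b\<in>P. \<exists>c\<in>P. \<exists>d\<in>P.
      strict le a b \<and> strict le c d \<and> strict le c b \<and>
      incomparable le a c \<and> incomparable le a d \<and> incomparable le b d)"

text \<open>Gate arguments refer to earlier gates by index; Inp i reads input bit i.
  Out-of-range references evaluate to False.  The output is the last gate.\<close>

datatype gate = Inp nat | Const bool | NotG nat | AndG nat nat | OrG nat nat

type_synonym circuit = "gate list"

definition ref :: "bool list \<Rightarrow> nat \<Rightarrow> bool" where
  "ref vs j = (if j < length vs then vs ! j else False)"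

fun gval :: "bool list \<Rightarrow> bool list \<Rightarrow> gate \<Rightarrow> bool" where
  "gval inp vs (Inp i) = ref inp i"
| "gval inp vs (Const b) = b"
| "gval inp vs (NotG i) = (\<not> ref vs i)"
| "gval inp vs (AndG i j) = (ref vs i \<and> ref vs j)"
| "gval inp vs (OrG i j) = (ref vs i \<or> ref vs j)"

definition eval_gates :: "bool list \<Rightarrow> circuit \<Rightarrow> bool list" where
  "eval_gates inp C = foldl (\<lambda>vs g. vs @ [gval inp vs g]) [] C"

definition circ_out :: "circuit \<Rightarrow> bool list \<Rightarrow> bool" where
  "circ_out C inp = (if C = [] then False else last (eval_gates inp C))"

text \<open>An sp_instance (n, C, M): C is the order circuit on two n-bit inputs,
  M an optional membership circuit on n-bit inputs.\<close>

type_synonym sp_instance = "nat \<times> circuit \<times> circuit option"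

definition points :: "sp_instance \<Rightarrow> bool list set" where
  "points I = (case I of (n, C, M) \<Rightarrow>
     {y. length y = n \<and> (case M of None \<Rightarrow> True | Some m \<Rightarrow> circ_out m y)})"

definition inst_le :: "sp_instance \<Rightarrow> bool list \<Rightarrow> bool list \<Rightarrow> bool" where
  "inst_le I y z = (case I of (n, C, M) \<Rightarrow> circ_out C (y @ z))"

definition promise :: "sp_instance \<Rightarrow> bool" where
  "promise I \<longleftrightarrow> partial_order_on_set (points I) (inst_le I) \<and> N_free (points I) (inst_le I)"

definition enc_nat :: "nat \<Rightarrow> bool list" where
  "enc_nat k = replicate k True @ [False]"

fun enc_gate :: "gate \<Rightarrow> bool list" where
  "enc_gate (Inp i) = enc_nat 0 @ enc_nat i"
| "enc_gate (Const b) = enc_nat 1 @ [b]"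
| "enc_gate (NotG i) = enc_nat 2 @ enc_nat i"
| "enc_gate (AndG i j) = enc_nat 3 @ enc_nat i @ enc_nat j"
| "enc_gate (OrG i j) = enc_nat 4 @ enc_nat i @ enc_nat j"

definition enc_circ :: "circuit \<Rightarrow> bool list" where
  "enc_circ C = enc_nat (length C) @ concat (map enc_gate C)"

definition enc_inst :: "sp_instance \<Rightarrow> bool list" where
  "enc_inst I = (case I of (n, C, M) \<Rightarrow>
     enc_nat n @ enc_circ C @ (case M of None \<Rightarrow> [False] | Some m \<Rightarrow> True # enc_circ m))"

definition NFree_yes :: "bool list set" where
  "NFree_yes = {enc_inst I | I. promise I \<and> exists_game (inst_le I) (points I)}"

definition NFree_no :: "bool list set" where
  "NFree_no = {enc_inst I | I. promise I \<and> \<not> exists_game (inst_le I) (points I)}"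

text \<open>A machine is (Q, S, delta): states < Q, tape symbols < S (0 = blank,
  1 = bit False, 2 = bit True), start state 0, halting state 1.
  delta q s = (q', s', m) with m = 0 left, 1 stay, 2 right.\<close>

type_synonym tm = "nat \<times> nat \<times> (nat \<Rightarrow> nat \<Rightarrow> nat \<times> nat \<times> nat)"

type_synonym config = "nat \<times> nat list \<times> nat list"  \<comment> \<open>state, reversed left part, head and right part\<close>

definition wf_tm :: "tm \<Rightarrow> bool" where
  "wf_tm M = (case M of (Q, S, \<delta>) \<Rightarrow> 2 \<le> Q \<and> 3 \<le> S \<and>
     (\<forall>q<Q. \<forall>s<S. fst (\<delta> q s) < Q \<and> fst (snd (\<delta> q s)) < S \<and> snd (snd (\<delta> q s)) \<le> 2))"

definition sym_of_bit :: "bool \<Rightarrow> nat" where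
  "sym_of_bit b = (if b then 2 else 1)"

definition init_config :: "bool list \<Rightarrow> config" where
  "init_config x = (0, [], map sym_of_bit x)"

definition tm_step :: "tm \<Rightarrow> config \<Rightarrow> config" where
  "tm_step M c = (case M of (Q, S, \<delta>) \<Rightarrow> (case c of (q, l, r) \<Rightarrow>
     if q = 1 then c else
     (let s = (case r of [] \<Rightarrow> 0 | a # _ \<Rightarrow> a);
          (q', s', m) = \<delta> q s;
          r' = s' # tl r
      in if m = 0 then (case l of [] \<Rightarrow> (q', [], r') | a # l' \<Rightarrow> (q', l', a # r'))
         else if m = 1 then (q', l, r')
         else (q', s' # l, tl r))))"

definition tm_run :: "tm \<Rightarrow> nat \<Rightarrow> config \<Rightarrow> config" where
  "tm_run M t c = (tm_step M ^^ t) c"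

definition tm_output :: "config \<Rightarrow> bool list" where
  "tm_output c = (case c of (q, l, r) \<Rightarrow> map (\<lambda>s. s = 2) (takeWhile (\<lambda>s. s = 1 \<or> s = 2) r))"

definition poly_time_computable :: "(bool list \<Rightarrow> bool list) \<Rightarrow> bool" where
  "poly_time_computable f \<longleftrightarrow> (\<exists>M c k. wf_tm M \<and> (\<forall>x.
      let cfg = tm_run M (c * length x ^ k + c) (init_config x)
      in fst cfg = 1 \<and> tm_output cfg = f x))"

definition pair_enc :: "bool list \<Rightarrow> bool list \<Rightarrow> bool list" where
  "pair_enc x y = concat (map (\<lambda>b. [b, b]) x) @ [False, True] @ y"

definition in_PP :: "bool list set \<Rightarrow> bool" where
  "in_PP L \<longleftrightarrow> (\<exists>R c k. poly_time_computable R \<and> (\<forall>x.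
      let m = c * length x ^ k + c in
      x \<in> L \<longleftrightarrow> 2 * card {y. length y = m \<and> R (pair_enc x y) = [True]} > 2 ^ m))"

definition PP_hard_promise :: "bool list set \<Rightarrow> bool list set \<Rightarrow> bool" where
  "PP_hard_promise YES NO \<longleftrightarrow> (\<forall>L. in_PP L \<longrightarrow>
     (\<exists>f. poly_time_computable f \<and>
        (\<forall>x. (x \<in> L \<longrightarrow> f x \<in> YES) \<and> (x \<notin> L \<longrightarrow> f x \<in> NO))))"

end

theory Submission
  imports Defs
begin

text \<open>
  Let \<open>x\<close> be an input of a probabilistic machine with \<open>m\<close> random bits, and let \<open>K = 2 ^ (m + 1)\<close>.
  The rejecting random strings, each taken twice, together with \<open>2 ^ m\<close> further points give chains of
  length \<open>a\<close>, where \<open>a < K\<close> iff \<open>x\<close> is accepted by a strict majority. A chain has its length as Nim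
  value, so a few chains of lengths \<open>a\<close>, \<open>K\<close> and \<open>3 * K\<close>, one series composition and a disjoint
  union give an N-free poset that is won by the first player iff \<open>a < K\<close>.

  The membership circuit simulates the verifier on a tableau. The tableau is wound up as a helix: the
  cell with number \<open>i\<close> is a fixed function of the cells \<open>i - W - 1\<close>, \<open>i - W\<close> and \<open>i - W + 1\<close>, so
  one loop that repeats a single gadget with three shifted base pointers prints the whole circuit.
  Such loops are run by a Turing machine that keeps every register as a marker on its tape and executes
  an instruction by one sweep over the tape.
\<close>

section \<open>Nim values of poset games\<close>

text \<open>With \<open>rej\<close> rejecting strings, \<open>a = 2 * rej + 2 ^ m\<close>, so
  \<open>a < K\<close> says \<open>2 * rej < 2 ^ m\<close>. The summand \<open>2 ^ m\<close> moves
  the threshold to a power of two, which Nim addition respects, and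
  \<open>a <= 3 * 2 ^ m < 2 * K\<close> leaves a single doubtful bit. Disjoint unions of chains only
  yield Nim sums of lengths. A series composition takes a mex over a whole set of option values
  instead, and here this set has a gap exactly if \<open>a >= K\<close>. On the circuit side the
  obstacle is uniformity. The printing program can only increment its registers, so every gate
  address has to be affine in the number of the block that contains it. Therefore all blocks get one
  length \<open>n\<close>, which depends on the verifier only, and the row ends of the tableau get
  no special treatment, because walls are ordinary cells of the helix. A block realises a function
  of boundedly many bits, so a mere existence theorem for circuits supplies it. Monotone registers
  also make the final contents a bound for time and space of the whole run.\<close>

lemma win_lose_exclusive:
  "win le Q \<Longrightarrow> \<not> lose le Q" "lose le Q \<Longrightarrow> \<not> win le Q"
proof (induction rule: win_lose.inducts)
  case (winI x Q)
  then show ?case by (auto elim: lose.cases)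
next
  case (loseI Q)
  then show ?case by (auto elim: win.cases)
qed

definition opt :: "('a \<Rightarrow> 'a \<Rightarrow> bool) \<Rightarrow> 'a set \<Rightarrow> 'a \<Rightarrow> 'a set" where
  "opt le Q x = {y \<in> Q. \<not> le x y}"

text \<open>The mex rule as a relation. That no option has the value \<open>n\<close> is expressed
  by some other value for every option, because a negated \<open>grundy\<close> would not be
  monotone.\<close>

inductive grundy :: "('a \<Rightarrow> 'a \<Rightarrow> bool) \<Rightarrow> 'a set \<Rightarrow> nat \<Rightarrow> bool" for le where
  grundyI: "(\<forall>x\<in>Q. \<exists>k. grundy le (opt le Q x) k \<and> k \<noteq> n) \<Longrightarrow>
    (\<forall>k<n. \<exists>x\<in>Q. grundy le (opt le Q x) k) \<Longrightarrow> grundy le Q n"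

lemma grundy_win_lose:
  "grundy le Q n \<Longrightarrow> if n = 0 then lose le Q else win le Q"
proof (induction rule: grundy.induct)
  case (grundyI Q n)
  show ?case
  proof (cases "n = 0")
    case True
    have "win le (opt le Q x)" if "x \<in> Q" for x
      using grundyI.IH(1) that True by (metis not_gr_zero)
    then show ?thesis using True by (simp add: opt_def loseI)
  next
    case False
    then obtain x where "x \<in> Q" "lose le (opt le Q x)"
      using grundyI.IH(2) by (metis not_gr_zero)
    then show ?thesis using False by (auto simp: opt_def intro: winI)
  qed
qed

lemma win_iff_grundy: "grundy le Q n \<Longrightarrow> win le Q \<longleftrightarrow> n \<noteq> 0"
  using grundy_win_lose[of le Q n] win_lose_exclusive by (metis)

text \<open>A move in a chain leaves the initial segment below the chosen point. The lengths of
  these segments are all the numbers below the length of the chain, so their mex is that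
  length.\<close>

lemma grundy_chain:
  fixes r :: "'a \<Rightarrow> nat"
  assumes "finite Q" "inj_on r Q" "\<forall>x\<in>Q. \<forall>y\<in>Q. le x y \<longleftrightarrow> r x \<le> r y"
  shows "grundy le Q (card Q)"
  using assms
proof (induction "card Q" arbitrary: Q rule: less_induct)
  case less
  have opt: "opt le Q x = {y \<in> Q. r y < r x}" if "x \<in> Q" for x
    using less.prems(3) that by (auto simp: opt_def)
  have card_less: "card (opt le Q x) < card Q" if "x \<in> Q" for x
    using that less.prems(1) by (auto simp: opt intro!: psubset_card_mono)
  have gr: "grundy le (opt le Q x) (card (opt le Q x))" if "x \<in> Q" for x
    using that less.prems
    by (intro less.hyps card_less) (auto simp: opt_def intro: inj_on_subset)
  have mono: "card (opt le Q x) < card (opt le Q y)" if "x \<in> Q" "y \<in> Q" "r x < r y" for x y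
    using that less.prems(1) by (auto simp: opt intro!: psubset_card_mono)
  have inj: "inj_on (\<lambda>x. card (opt le Q x)) Q"
  proof (rule inj_onI)
    fix x y assume *: "x \<in> Q" "y \<in> Q" "card (opt le Q x) = card (opt le Q y)"
    then have "r x = r y" using mono by (metis linorder_neqE_nat nat_neq_iff)
    then show "x = y" using * less.prems(2) by (auto dest: inj_onD)
  qed
  have "(\<lambda>x. card (opt le Q x)) ` Q = {..<card Q}"
    using card_less inj by (intro card_subset_eq) (auto simp: card_image)
  then have "\<forall>k<card Q. \<exists>x\<in>Q. k = card (opt le Q x)"
    by (metis (no_types, lifting) imageE lessThan_iff)
  then show ?case using gr card_less by (intro grundyI) (metis nat_neq_iff)+
qed

section \<open>Nim addition and compositions of posets\<close>

lemma xor_nat_cancel [simp]: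
  fixes a b :: nat
  shows "xor a (xor a b) = b"
  by (metis xor.assoc xor_self_eq xor.left_neutral)

text \<open>The good move in Nim: every number below the Nim sum is reached by lowering one heap.
  The induction strips the lowest binary digit. If half of \<open>t\<close> is already below the Nim
  sum of the halves, the induction hypothesis applies; otherwise the two agree, \<open>t\<close> is
  even and exactly one of \<open>x\<close>, \<open>y\<close> is odd, and that one can be
  lowered.\<close>

lemma xor_nat_option:
  fixes x y t :: nat
  assumes "t < xor x y"
  shows "xor t y < x \<or> xor t x < y"
  using assms
proof (induction x arbitrary: y t rule: less_induct)
  case (less x)
  note rec = xor_nat_rec[of x y] xor_nat_rec[of t y] xor_nat_rec[of t x]
  show ?case
  proof (cases "x = 0")
    case True
    then show ?thesis using less.prems by simp
  next
    case False
    have b: "of_bool P \<le> (1::nat)" for P by simp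
    show ?thesis
    proof (cases "t div 2 < xor (x div 2) (y div 2)")
      case True
      have "xor (t div 2) (y div 2) < x div 2 \<or> xor (t div 2) (x div 2) < y div 2"
        using less.IH[OF _ True] False by auto
      then show ?thesis
        using rec(2,3) b[of "odd t \<noteq> odd y"] b[of "odd t \<noteq> odd x"]
        by presburger
    next
      case F: False
      have eq: "t div 2 = xor (x div 2) (y div 2)" and "even t" "odd x \<noteq> odd y"
        using F less.prems rec(1) by (cases "odd x = odd y"; simp; presburger)+
      have "xor (xor (x div 2) (y div 2)) (y div 2) = x div 2"
        "xor (xor (x div 2) (y div 2)) (x div 2) = y div 2"
        by (metis xor_nat_cancel xor.commute)+
      then have "xor t y = of_bool (odd y) + 2 * (x div 2)" "xor t x = of_bool (odd x) + 2 * (y div 2)"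
        using rec(2,3) eq \<open>even t\<close> by simp_all
      then show ?thesis using \<open>odd x \<noteq> odd y\<close> by (cases "odd x") (simp_all, presburger+)
    qed
  qed
qed

lemma xor_nat_eq_iff [simp]:
  fixes a b c :: nat
  shows "xor a b = xor a c \<longleftrightarrow> b = c" "xor b a = xor c a \<longleftrightarrow> b = c"
  by (metis xor_nat_cancel, metis xor_nat_cancel xor.commute)

text \<open>The Sprague-Grundy theorem: a move touches only one of two incomparable parts. Options
  differ from \<open>xor m n\<close> because Nim addition is cancellative, and all smaller values
  occur by \<open>xor_nat_option\<close>.\<close>

lemma grundy_sum:
  assumes "grundy le A m" "grundy le B n"
    and "\<forall>x\<in>A. \<forall>y\<in>B. \<not> le x y \<and> \<not> le y x"
  shows "grundy le (A \<union> B) (xor m n)"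
  using assms
proof (induction arbitrary: B n rule: grundy.induct)
  case (grundyI A m)
  \<comment> \<open>The hypothesis for \<open>A\<close> stays general in \<open>B\<close> and
    \<open>n\<close>, because the inner induction replaces \<open>B\<close> by its options.\<close>
  let ?sum = "\<lambda>x k. \<forall>B n. grundy le B n \<longrightarrow> (\<forall>u\<in>opt le A x. \<forall>v\<in>B. \<not> le u v \<and> \<not> le v u)
      \<longrightarrow> grundy le (opt le A x \<union> B) (xor k n)"
  have out1: "\<exists>k. k \<noteq> m \<and> ?sum x k" if "x \<in> A" for x
    using grundyI.IH(1) that by blast
  have out2: "\<exists>x\<in>A. ?sum x k" if "k < m" for k
    using grundyI.IH(2) that by blast
  from grundyI.prems show ?case
  proof (induction rule: grundy.induct)
    case inner: (grundyI B n)
    have grB: "grundy le B n" using inner.IH by (intro grundy.grundyI) blast+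
    have optA: "opt le (A \<union> B) x = opt le A x \<union> B" if "x \<in> A" for x
      using that inner.prems(1) by (auto simp: opt_def)
    have optB: "opt le (A \<union> B) x = A \<union> opt le B x" if "x \<in> B" for x
      using that inner.prems(1) by (auto simp: opt_def)
    have disA: "\<forall>u\<in>opt le A x. \<forall>v\<in>B. \<not> le u v \<and> \<not> le v u" for x
      using inner.prems(1) by (auto simp: opt_def)
    have disB: "\<forall>u\<in>A. \<forall>v\<in>opt le B x. \<not> le u v \<and> \<not> le v u" for x
      using inner.prems(1) by (auto simp: opt_def)
    have A1: "\<exists>k'. grundy le (opt le (A \<union> B) x) k' \<and> k' \<noteq> xor m n" if x: "x \<in> A" for x
    proof -
      obtain k where k: "k \<noteq> m" "?sum x k"
        using out1[OF x] by blast
      then show ?thesis using optA[OF x] disA grB by (metis xor_nat_eq_iff(2))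
    qed
    have A2: "\<exists>x\<in>A. grundy le (opt le (A \<union> B) x) (xor k n)" if "k < m" for k
      using out2[OF that] optA disA grB by metis
    have B1: "\<exists>k'. grundy le (opt le (A \<union> B) x) k' \<and> k' \<noteq> xor m n" if x: "x \<in> B" for x
    proof -
      from inner.IH(1) disB x
      obtain k where "k \<noteq> n" "grundy le (A \<union> opt le B x) (xor m k)" by blast
      then show ?thesis using optB[OF x] by (metis xor_nat_eq_iff(1))
    qed
    have B2: "\<exists>x\<in>B. grundy le (opt le (A \<union> B) x) (xor m k)" if k: "k < n" for k
    proof -
      from inner.IH(2) disB k
      obtain x where "x \<in> B" "grundy le (A \<union> opt le B x) (xor m k)" by blast
      then show ?thesis using optB by auto
    qed
    show ?case
    proof (rule grundy.grundyI)
      show "\<forall>x\<in>A \<union> B. \<exists>k. grundy le (opt le (A \<union> B) x) k \<and> k \<noteq> xor m n"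
        using A1 B1 by blast
      show "\<forall>k<xor m n. \<exists>x\<in>A \<union> B. grundy le (opt le (A \<union> B) x) k"
      proof (intro allI impI)
        fix t assume "t < xor m n"
        then consider "xor t n < m" | "xor t m < n" using xor_nat_option by blast
        then show "\<exists>x\<in>A \<union> B. grundy le (opt le (A \<union> B) x) t"
        proof cases
          case 1
          from A2[OF 1] show ?thesis
            by (metis UnI1 xor_nat_cancel xor.commute)
        next
          case 2
          from B2[OF 2] show ?thesis
            by (metis UnI2 xor_nat_cancel xor.commute)
        qed
      qed
    qed
  qed
qed

text \<open>A move in the lower part \<open>A\<close> deletes all of \<open>B\<close>, and a move in
  \<open>B\<close> leaves \<open>A\<close> intact. So the option values of \<open>A\<close>, the set
  \<open>S\<close>, are always available, and \<open>B\<close> counts through the numbers outside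
  \<open>S\<close>: the assumptions on \<open>f\<close> say that it enumerates the complement of
  \<open>S\<close> in increasing order.\<close>

lemma grundy_series:
  assumes "grundy le B n"
    and "\<forall>x\<in>A. \<forall>y\<in>B. le x y \<and> \<not> le y x"
    and "\<forall>x\<in>A. \<exists>k\<in>S. grundy le (opt le A x) k"
    and "\<forall>k\<in>S. \<exists>x\<in>A. grundy le (opt le A x) k"
    and f: "\<And>i. f i \<notin> S" "inj f" "\<And>i k. k < f i \<Longrightarrow> k \<in> S \<or> (\<exists>j<i. k = f j)"
  shows "grundy le (A \<union> B) (f n)"
  using assms(1,2)
proof (induction rule: grundy.induct)
  case (grundyI B n)
  have optA: "opt le (A \<union> B) x = opt le A x" if "x \<in> A" for x
    using that grundyI.prems by (auto simp: opt_def)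
  have optB: "opt le (A \<union> B) x = A \<union> opt le B x" if "x \<in> B" for x
    using that grundyI.prems by (auto simp: opt_def)
  have ser: "\<forall>u\<in>A. \<forall>v\<in>opt le B x. le u v \<and> \<not> le v u" for x
    using grundyI.prems by (auto simp: opt_def)
  show ?case
  proof (rule grundy.grundyI)
    show "\<forall>x\<in>A \<union> B. \<exists>k. grundy le (opt le (A \<union> B) x) k \<and> k \<noteq> f n"
    proof
      fix x assume "x \<in> A \<union> B"
      then consider "x \<in> A" | "x \<in> B" by blast
      then show "\<exists>k. grundy le (opt le (A \<union> B) x) k \<and> k \<noteq> f n"
      proof cases
        case 1
        then show ?thesis using optA assms(3) f(1) by (metis)
      next
        case 2
        then obtain k where "k \<noteq> n" "grundy le (A \<union> opt le B x) (f k)"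
          using grundyI.IH(1) ser by blast
        then show ?thesis using optB[OF 2] f(2) by (metis injD)
      qed
    qed
    show "\<forall>k<f n. \<exists>x\<in>A \<union> B. grundy le (opt le (A \<union> B) x) k"
    proof (intro allI impI)
      fix k assume "k < f n"
      then consider "k \<in> S" | j where "j < n" "k = f j" using f(3) by blast
      then show "\<exists>x\<in>A \<union> B. grundy le (opt le (A \<union> B) x) k"
      proof cases
        case 1
        then show ?thesis using optA assms(4) by (metis UnI1)
      next
        case 2
        then obtain x where "x \<in> B" "grundy le (A \<union> opt le B x) (f j)"
          using grundyI.IH(2) ser by blast
        then show ?thesis using 2 optB by (metis UnI2)
      qed
    qed
  qed
qed

text \<open>The value of a series composition depends on the set of all option values of its lower
  part, of which the Nim value keeps only the mex.\<close>

definition option_values :: "('a \<Rightarrow> 'a \<Rightarrow> bool) \<Rightarrow> 'a set \<Rightarrow> nat set \<Rightarrow> bool" where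
  "option_values le A V \<longleftrightarrow> (\<forall>x\<in>A. \<exists>k\<in>V. grundy le (opt le A x) k) \<and>
     (\<forall>k\<in>V. \<exists>x\<in>A. grundy le (opt le A x) k)"

lemma option_values_chain:
  fixes r :: "'a \<Rightarrow> nat"
  assumes "finite Q" "inj_on r Q" "\<forall>x\<in>Q. \<forall>y\<in>Q. le x y \<longleftrightarrow> r x \<le> r y"
  shows "option_values le Q {..<card Q}"
  unfolding option_values_def
proof (intro conjI ballI)
  fix x assume x: "x \<in> Q"
  have "grundy le (opt le Q x) (card (opt le Q x))"
    using assms by (intro grundy_chain[of _ r]) (auto simp: opt_def intro: inj_on_subset)
  moreover have "card (opt le Q x) < card Q"
    using x assms(1,3) by (intro psubset_card_mono) (auto simp: opt_def)
  ultimately show "\<exists>k\<in>{..<card Q}. grundy le (opt le Q x) k" by blast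
next
  fix k assume "k \<in> {..<card Q}"
  then show "\<exists>x\<in>Q. grundy le (opt le Q x) k"
    using grundy_chain[OF assms] by (auto elim: grundy.cases)
qed

lemma option_values_sum:
  assumes "option_values le A V" "option_values le B W" "grundy le A m" "grundy le B n"
    and dis: "\<forall>x\<in>A. \<forall>y\<in>B. \<not> le x y \<and> \<not> le y x"
  shows "option_values le (A \<union> B) ((\<lambda>i. xor i n) ` V \<union> (\<lambda>j. xor m j) ` W)"
proof -
  have optA: "opt le (A \<union> B) x = opt le A x \<union> B" if "x \<in> A" for x
    using that dis by (auto simp: opt_def)
  have optB: "opt le (A \<union> B) x = A \<union> opt le B x" if "x \<in> B" for x
    using that dis by (auto simp: opt_def)
  have A: "grundy le (opt le (A \<union> B) x) (xor k n)" if "x \<in> A" "grundy le (opt le A x) k" for x k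
    unfolding optA[OF that(1)] using that assms(4) dis by (intro grundy_sum) (auto simp: opt_def)
  have B: "grundy le (opt le (A \<union> B) x) (xor m k)" if "x \<in> B" "grundy le (opt le B x) k" for x k
    unfolding optB[OF that(1)] using that assms(3) dis by (intro grundy_sum) (auto simp: opt_def)
  from assms(1,2) A B show ?thesis unfolding option_values_def
    by (simp add: ball_Un bex_Un image_iff) (intro conjI; blast)
qed

text \<open>Nim addition has no carries, so the lowest \<open>e\<close> digits and the remaining
  ones are added separately.\<close>

lemma xor_nat_blocks:
  fixes p q i j :: nat
  assumes "i < 2 ^ e" "j < 2 ^ e"
  shows "xor (p * 2 ^ e + i) (q * 2 ^ e + j) = xor p q * 2 ^ e + xor i j"
proof -
  have bit: "bit (p * 2 ^ e + i) n \<longleftrightarrow> (if n < e then bit i n else bit p (n - e))"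
    if "i < 2 ^ e" for p i n :: nat
  proof (cases "n < e")
    case True
    then have h: "p * 2 ^ e = (2 * (p * 2 ^ (e - Suc n))) * 2 ^ n"
      by (simp flip: power_add power_Suc)
    have "(p * 2 ^ e + i) div 2 ^ n = 2 * (p * 2 ^ (e - Suc n)) + i div 2 ^ n"
      unfolding h by (rule div_mult_self3) simp
    then show ?thesis using True by (simp add: bit_iff_odd)
  next
    case False
    then have "(2::nat) ^ n = 2 ^ e * 2 ^ (n - e)" by (simp flip: power_add)
    then show ?thesis using False that by (simp add: bit_iff_odd div_mult2_eq)
  qed
  have "take_bit e (xor i j) = xor i j"
    using assms by (simp add: take_bit_nat_eq_self)
  then have "xor i j < 2 ^ e" by (metis take_bit_nat_less_exp)
  then show ?thesis using assms by (intro bit_eqI) (auto simp: bit bit_xor_iff)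
qed

text \<open>Four chains and one series composition compare the chain length \<open>a\<close> with \<open>K\<close>: the
  options of \<open>A2 \<union> K2\<close> cover exactly \<open>{..<a + K}\<close> if \<open>a < K\<close>, but \<open>{..<a - K} \<union> {K..<2 * K}\<close>
  otherwise, so \<open>K\<close> elements on top give the value \<open>2 * K + a mod K\<close>; adding \<open>a\<close> and \<open>3 * K\<close>
  leaves \<open>K\<close> in the first case and \<open>0\<close> in the second.\<close>

lemma threshold_game:
  fixes r :: "'a \<Rightarrow> nat"
  assumes K: "K = 2 ^ e" and a: "a < 2 * K"
    and chain: "\<And>Q. Q \<in> {A1, A2, K2, B, C} \<Longrightarrow> finite Q \<and> inj_on r Q \<and>
       (\<forall>x\<in>Q. \<forall>y\<in>Q. le x y \<longleftrightarrow> r x \<le> r y)"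
    and card: "card A1 = a" "card A2 = a" "card K2 = K" "card B = K" "card C = 3 * K"
    and par: "\<forall>x\<in>A2. \<forall>y\<in>K2. \<not> le x y \<and> \<not> le y x"
    and ser: "\<forall>x\<in>A2 \<union> K2. \<forall>y\<in>B. le x y \<and> \<not> le y x"
    and sum: "\<forall>x\<in>A1. \<forall>y\<in>A2 \<union> K2 \<union> B \<union> C. \<not> le x y \<and> \<not> le y x"
      "\<forall>x\<in>A2 \<union> K2 \<union> B. \<forall>y\<in>C. \<not> le x y \<and> \<not> le y x"
  shows "win le (A1 \<union> (A2 \<union> K2 \<union> B \<union> C)) \<longleftrightarrow> a < K"
proof -
  have gr: "grundy le A1 a" "grundy le A2 a" "grundy le K2 K" "grundy le B K" "grundy le C (3 * K)"
    using grundy_chain[of _ r le] chain card by (metis insertCI)+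
  have ov: "option_values le A2 {..<a}" "option_values le K2 {..<K}"
    using option_values_chain[of _ r le] chain card by (metis insertCI)+
  define S where "S = (\<lambda>i. xor i K) ` {..<a} \<union> (\<lambda>j. xor a j) ` {..<K}"
  have S: "option_values le (A2 \<union> K2) S"
    unfolding S_def using option_values_sum[OF ov gr(2,3) par] .
  have kpos: "K > 0" using K by simp
  have hl: "xor (p * K + i) (q * K + j) = xor p q * K + xor i j" if "i < K" "j < K" for p q i j
    using xor_nat_blocks that K by blast
  \<comment> \<open>The increasing enumeration of the complement of \<open>S\<close>. For
    \<open>a >= K\<close> it runs through the gap from \<open>a - K\<close> to \<open>K - 1\<close>
    and then continues at \<open>2 * K\<close>.\<close>
  define f where "f n = (if a < K then a + K + n else if a - K + n < K then a - K + n else a + n)" for n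
  have lo: "xor i K = i + K" if "i < K" for i
    using hl[of i 0 0 1] that kpos by simp
  have hi: "xor (K + i) K = i" if "i < K" for i
    using hl[of i 0 1 1] that kpos by simp
  have xlt: "xor i j < K" if "i < K" "j < K" for i j
  proof -
    have "take_bit e (xor i j) = xor i j"
      using that K by (simp add: take_bit_nat_eq_self)
    then show ?thesis using K by (metis take_bit_nat_less_exp)
  qed
  have S': "k \<in> S \<longleftrightarrow> (if a < K then k < a + K else k < a - K \<or> K \<le> k \<and> k < 2 * K)" for k
  proof (cases "a < K")
    case True
    have "(\<lambda>j. xor a j) ` {..<K} = {..<K}"
      using True xlt by (intro card_subset_eq) (auto simp: card_image inj_on_def)
    moreover have "(\<lambda>i. xor i K) ` {..<a} = (\<lambda>i. i + K) ` {..<a}"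
      using True lo by (intro image_cong) auto
    ultimately have "S = (\<lambda>i. i + K) ` {..<a} \<union> {..<K}" by (simp add: S_def)
    moreover have "k \<in> (\<lambda>i. i + K) ` {..<a} \<longleftrightarrow> K \<le> k \<and> k < a + K"
      by (auto intro!: image_eqI[of _ _ "k - K"])
    ultimately show ?thesis using True by auto
  next
    case False
    define s where "s = a - K"
    have s: "a = K + s" "s < K" using False a by (auto simp: s_def)
    have x: "xor a j = K + xor s j" if "j < K" for j
      using hl[of s j 1 0] s that by simp
    \<comment> \<open>In this case the moves in \<open>K2\<close> contribute nothing new: the moves
      in \<open>A2\<close> already give all values from \<open>K\<close> to
      \<open>2 * K - 1\<close>.\<close>
    have 1: "(\<lambda>j. xor a j) ` {..<K} \<subseteq> {K..<2 * K}"
      using x xlt s(2) by fastforce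
    have dec: "{..<a} = {..<K} \<union> (\<lambda>i. K + i) ` {..<s}"
      using s by (auto simp: lessThan_atLeast0)
    have "(\<lambda>i. xor i K) ` {..<a} = (\<lambda>i. i + K) ` {..<K} \<union> id ` {..<s}"
      unfolding dec image_Un image_image using lo hi s(2)
      by (intro arg_cong2[of _ _ _ _ "(\<union>)"] image_cong) auto
    moreover have "k \<in> (\<lambda>i. i + K) ` {..<K} \<longleftrightarrow> K \<le> k \<and> k < 2 * K" for k
      by (auto intro!: image_eqI[of _ _ "k - K"])
    ultimately show ?thesis using False 1 by (auto simp: S_def s_def)
  qed
  have "grundy le ((A2 \<union> K2) \<union> B) (f K)"
  proof (rule grundy_series[OF gr(4) ser])
    show "\<forall>x\<in>A2 \<union> K2. \<exists>k\<in>S. grundy le (opt le (A2 \<union> K2) x) k"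
      "\<forall>k\<in>S. \<exists>x\<in>A2 \<union> K2. grundy le (opt le (A2 \<union> K2) x) k"
      using S by (auto simp: option_values_def)
    show "f i \<notin> S" for i using a by (auto simp: S' f_def)
    show "inj f" by (rule injI) (auto simp: f_def split: if_splits)
    show "k \<in> S \<or> (\<exists>j<i. k = f j)" if k: "k < f i" for i k
    proof (cases "k \<in> S")
      case False
      consider "a < K" "k = f (k - (a + K))" "k - (a + K) < i"
        | "\<not> a < K" "k = f (k - (a - K))" "k - (a - K) < i"
        | "\<not> a < K" "k = f (k - a)" "k - a < i"
        using k False a unfolding S' f_def by (auto split: if_splits)
      then show ?thesis by cases blast+
    qed simp
  qed
  then have "grundy le (A2 \<union> K2 \<union> B \<union> C) (xor (f K) (3 * K))"
    by (rule grundy_sum[OF _ gr(5) sum(2)])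
  then have "grundy le (A1 \<union> (A2 \<union> K2 \<union> B \<union> C)) (xor a (xor (f K) (3 * K)))"
    by (rule grundy_sum[OF gr(1) _ sum(1)])
  then have "win le (A1 \<union> (A2 \<union> K2 \<union> B \<union> C)) \<longleftrightarrow> xor a (xor (f K) (3 * K)) \<noteq> 0"
    by (rule win_iff_grundy)
  also have "\<dots> \<longleftrightarrow> a < K"
  proof (cases "a < K")
    case True
    have "f K = 2 * K + a" using True by (simp add: f_def)
    then show ?thesis
      using True hl[of a 0 2 3] hl[of a a 0 1] kpos by simp
  next
    case False
    define s where "s = a - K"
    have s: "a = K + s" "s < K" using False a by (auto simp: s_def)
    have "f K = 2 * K + s" using s by (simp add: f_def)
    then show ?thesis using hl[of s 0 2 3] hl[of s s 1 1] s kpos by simp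
  qed
  finally show ?thesis .
qed

section \<open>A loop language over monotone registers\<close>

text \<open>Registers are never decreased or reset, so a bound on the final contents bounds all
  intermediate ones; the time and the space bound both rest on this.\<close>

datatype com = Skip | Inc nat | Out bool | Seq com com | IfIn nat com com | Rep nat com

type_synonym store = "(nat \<Rightarrow> nat) \<times> bool list"

fun sem :: "bool list \<Rightarrow> com \<Rightarrow> store \<Rightarrow> store" where
  "sem x Skip s = s"
| "sem x (Inc r) s = ((fst s)(r := Suc (fst s r)), snd s)"
| "sem x (Out b) s = (fst s, snd s @ [b])"
| "sem x (Seq a b) s = sem x b (sem x a s)"
| "sem x (IfIn r a b) s = (if fst s r < length x \<and> x ! fst s r then sem x a s else sem x b s)"
| "sem x (Rep r c) s = (sem x c ^^ fst s r) s"

fun incs :: "com \<Rightarrow> nat set" where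
  "incs Skip = {}"
| "incs (Inc r) = {r}"
| "incs (Out b) = {}"
| "incs (Seq a b) = incs a \<union> incs b"
| "incs (IfIn r a b) = incs a \<union> incs b"
| "incs (Rep r c) = incs c"

text \<open>The machine compares the loop counter with \<open>r\<close> in every round, whereas
  \<open>sem\<close> fixes the number of rounds at the start. Both agree if the body leaves
  \<open>r\<close> alone.\<close>

fun wf_com :: "com \<Rightarrow> bool" where
  "wf_com (Seq a b) = (wf_com a \<and> wf_com b)"
| "wf_com (IfIn r a b) = (wf_com a \<and> wf_com b)"
| "wf_com (Rep r c) = (r \<notin> incs c \<and> wf_com c)"
| "wf_com c = True"

lemma sem_unchanged: "r \<notin> incs c \<Longrightarrow> fst (sem x c s) r = fst s r"
proof (induction c arbitrary: s)
  case (Rep r' c)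
  have "fst ((sem x c ^^ n) s) r = fst s r" for n
    by (induction n) (use Rep in auto)
  then show ?case by simp
qed auto

lemma sem_mono: "fst s r \<le> fst (sem x c s) r"
proof (induction c arbitrary: s)
  case (Seq a b)
  then show ?case by simp (meson le_trans)
next
  case (Rep r' c)
  have "fst s r \<le> fst ((sem x c ^^ n) s) r" for n
    by (induction n) (auto intro: le_trans[OF _ Rep])
  then show ?case by simp
qed auto

lemma sem_iter_mono: "m \<le> n \<Longrightarrow> fst ((sem x c ^^ m) s) r \<le> fst ((sem x c ^^ n) s) r"
  by (induction n rule: dec_induct) (auto intro: le_trans sem_mono)

text \<open>Counts steps of the stack machine if no register exceeds \<open>B\<close>. Each round of
  a loop adds a test and an increment of the counter; resetting the counter and the last, failing
  test add 2 more.\<close>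

fun cost :: "com \<Rightarrow> nat \<Rightarrow> nat" where
  "cost Skip B = 1"
| "cost (Inc r) B = 1"
| "cost (Out b) B = 1"
| "cost (Seq a b) B = 1 + cost a B + cost b B"
| "cost (IfIn r a b) B = 1 + cost a B + cost b B"
| "cost (Rep r c) B = 2 + B * (cost c B + 2)"

text \<open>The base \<open>Suc n\<close> is never 0, so powers grow with the exponent and sums and
  products keep this form.\<close>

definition poly_bounded :: "(nat \<Rightarrow> nat) \<Rightarrow> bool" where
  "poly_bounded p \<longleftrightarrow> (\<exists>c k. \<forall>n. p n \<le> c * Suc n ^ k)"

lemma poly_bounded_const [intro, simp]: "poly_bounded (\<lambda>_. c)"
  unfolding poly_bounded_def by (intro exI[of _ c] exI[of _ 0]) simp

lemma poly_bounded_id [intro, simp]: "poly_bounded (\<lambda>n. n)"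
  unfolding poly_bounded_def by (intro exI[of _ 1]) simp

lemma poly_bounded_add [intro]:
  assumes "poly_bounded p" "poly_bounded q"
  shows "poly_bounded (\<lambda>n. p n + q n)"
proof -
  obtain c k d j where *: "\<And>n. p n \<le> c * Suc n ^ k" "\<And>n. q n \<le> d * Suc n ^ j"
    using assms unfolding poly_bounded_def by blast
  have "p n + q n \<le> (c + d) * Suc n ^ (k + j)" for n
  proof -
    have "Suc n ^ k \<le> Suc n ^ (k + j)" "Suc n ^ j \<le> Suc n ^ (k + j)"
      by (intro power_increasing; simp)+
    then have "c * Suc n ^ k \<le> c * Suc n ^ (k + j)" "d * Suc n ^ j \<le> d * Suc n ^ (k + j)"
      by (simp_all only: mult_le_mono2)
    then show ?thesis using *[of n] unfolding add_mult_distrib by linarith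
  qed
  then show ?thesis unfolding poly_bounded_def by blast
qed

lemma poly_bounded_mult [intro]:
  assumes "poly_bounded p" "poly_bounded q"
  shows "poly_bounded (\<lambda>n. p n * q n)"
proof -
  obtain c k d j where *: "\<And>n. p n \<le> c * Suc n ^ k" "\<And>n. q n \<le> d * Suc n ^ j"
    using assms unfolding poly_bounded_def by blast
  have "p n * q n \<le> (c * d) * Suc n ^ (k + j)" for n
    using mult_le_mono[OF *[of n]] by (simp add: power_add mult_ac)
  then show ?thesis unfolding poly_bounded_def by blast
qed

lemma poly_bounded_power [intro]: "poly_bounded p \<Longrightarrow> poly_bounded (\<lambda>n. p n ^ k)"
  by (induction k) auto

lemma poly_bounded_Suc [intro]: "poly_bounded p \<Longrightarrow> poly_bounded (\<lambda>n. Suc (p n))"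
  using poly_bounded_add[of p "\<lambda>_. 1"] by simp

lemma poly_bounded_cost: "poly_bounded p \<Longrightarrow> poly_bounded (\<lambda>n. cost c (p n))"
proof (induction c)
  case (Rep r c)
  then show ?case unfolding cost.simps by (intro poly_bounded_add poly_bounded_mult) auto
qed auto

lemma poly_bounded_standard:
  assumes "poly_bounded p"
  shows "\<exists>c k. \<forall>n. p n \<le> c * n ^ k + c"
proof -
  obtain c k where *: "\<And>n. p n \<le> c * Suc n ^ k"
    using assms unfolding poly_bounded_def by blast
  have "Suc n ^ k \<le> 2 ^ k * n ^ k + 2 ^ k" for n
  proof (cases "n = 0")
    case False
    then have "Suc n ^ k \<le> (2 * n) ^ k" by (intro power_mono) auto
    then show ?thesis by (simp add: power_mult_distrib)
  qed (auto intro: trans_le_add2)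
  then have "p n \<le> (c * 2 ^ k) * n ^ k + c * 2 ^ k" for n
    using *[of n] mult_le_mono2[of "Suc n ^ k" "2 ^ k * n ^ k + 2 ^ k" c]
    by (simp add: distrib_left mult.assoc)
  then show ?thesis by blast
qed

section \<open>Stack machines with markers\<close>

text \<open>Registers are kept as markers on the cells of the tape: \<open>Inl r\<close> is register \<open>r\<close>, and
  \<open>Inr d\<close> is the loop counter of the repetition at nesting depth \<open>d\<close>.\<close>

type_synonym mark = "nat + nat"
type_synonym cell = "bool option \<times> bool option \<times> mark set"

datatype phase = P0 | P1 | P2

datatype op = OInc mark | OZero mark | OOut bool | OLess mark mark | ORead mark | ONop

text \<open>Every instruction is a transducer with three phases that reads the tape once from left
  to right. \<open>OInc\<close> lifts a marker and drops it in the next cell; \<open>OZero\<close>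
  sets it in the first cell and erases it elsewhere; \<open>OOut\<close> fills the first cell
  without output. \<open>OLess\<close> records which marker comes first, and looks for
  \<open>m'\<close> before \<open>m\<close> so that a tie counts as not less.\<close>

fun op_cell :: "op \<Rightarrow> phase \<Rightarrow> cell \<Rightarrow> phase \<times> cell" where
  "op_cell (OInc m) p (i, w, ms) =
     (if m \<in> ms then P1 else P0, (i, w, if p = P1 then insert m ms else ms - {m}))"
| "op_cell (OZero m) p (i, w, ms) = (P1, (i, w, if p = P0 then insert m ms else ms - {m}))"
| "op_cell (OOut b) p (i, w, ms) =
     (if p = P0 \<and> w = None then (P1, (i, Some b, ms)) else (p, (i, w, ms)))"
| "op_cell (OLess m m') p (i, w, ms) =
     (if p \<noteq> P0 then p else if m' \<in> ms then P2
      else if m \<in> ms then P1 else P0, (i, w, ms))"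
| "op_cell (ORead m) p (i, w, ms) =
     (if p \<noteq> P0 then p else if m \<in> ms then (if i = Some True then P1 else P2) else P0, (i, w, ms))"
| "op_cell ONop p c = (p, c)"

fun sweep :: "('p \<Rightarrow> 'c \<Rightarrow> 'p \<times> 'c) \<Rightarrow> 'p \<Rightarrow> 'c list \<Rightarrow> 'p \<times> 'c list" where
  "sweep f p [] = (p, [])"
| "sweep f p (a # as) = (let (p', a') = f p a; (p'', as') = sweep f p' as in (p'', a' # as'))"

lemma sweep_map_upt:
  assumes "\<And>i. m \<le> i \<Longrightarrow> i < n \<Longrightarrow> f (\<phi> i) (g i) = (\<phi> (Suc i), h i)" "m \<le> n"
  shows "sweep f (\<phi> m) (map g [m..<n]) = (\<phi> n, map h [m..<n])"
  using assms(2,1)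
proof (induction rule: inc_induct)
  case (step k)
  then show ?case by (simp add: upt_conv_Cons)
qed simp

definition nth_opt :: "'a list \<Rightarrow> nat \<Rightarrow> 'a option" where
  "nth_opt xs i = (if i < length xs then Some (xs ! i) else None)"

definition cell_at :: "bool list \<Rightarrow> mark set \<Rightarrow> (mark \<Rightarrow> nat) \<Rightarrow> bool list \<Rightarrow> nat \<Rightarrow> cell" where
  "cell_at x M u out i = (nth_opt x i, nth_opt out i, {m \<in> M. u m = i})"

fun op_upd :: "op \<Rightarrow> (mark \<Rightarrow> nat) \<times> bool list \<Rightarrow> (mark \<Rightarrow> nat) \<times> bool list" where
  "op_upd (OInc m) (u, w) = (u(m := Suc (u m)), w)"
| "op_upd (OZero m) (u, w) = (u(m := 0), w)"
| "op_upd (OOut b) (u, w) = (u, w @ [b])"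
| "op_upd _ s = s"

fun op_test :: "bool list \<Rightarrow> op \<Rightarrow> (mark \<Rightarrow> nat) \<Rightarrow> bool" where
  "op_test x (OLess m m') u = (u m < u m')"
| "op_test x (ORead m) u = (u m < length x \<and> x ! u m)"
| "op_test x _ u = False"

fun op_marks :: "op \<Rightarrow> mark set" where
  "op_marks (OInc m) = {m}"
| "op_marks (OZero m) = {m}"
| "op_marks (OLess m m') = {m, m'}"
| "op_marks (ORead m) = {m}"
| "op_marks _ = {}"

fun is_test :: "op \<Rightarrow> bool" where
  "is_test (OLess m m') = True"
| "is_test (ORead m) = True"
| "is_test _ = False"

text \<open>An instruction moves a marker or the end of the output to the right by at most one cell,
  so a single spare cell at the end suffices. In the proof, \<open>\<phi> i\<close> is the phase in
  which cell \<open>i\<close> is entered.\<close>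

lemma sweep_op:
  assumes M: "op_marks op \<subseteq> M" and L: "\<And>m. m \<in> M \<Longrightarrow> u m < L" "length w \<le> L"
  shows "\<exists>p. sweep (op_cell op) P0 (map (cell_at x M u w) [0..<Suc L]) =
      (p, map (case op_upd op (u, w) of (u', w') \<Rightarrow> cell_at x M u' w') [0..<Suc L])
      \<and> (is_test op \<longrightarrow> (p = P1 \<longleftrightarrow> op_test x op u))"
proof (cases op)
  case (OInc m)
  define \<phi> where "\<phi> i = (if 0 < i \<and> u m = i - 1 then P1 else P0)" for i
  have "sweep (op_cell op) (\<phi> 0) (map (cell_at x M u w) [0..<Suc L]) = (\<phi> (Suc L),
      map (cell_at x M (u(m := Suc (u m))) w) [0..<Suc L])"
    by (rule sweep_map_upt) (use OInc M L in \<open>auto simp: cell_at_def \<phi>_def split: if_splits\<close>)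
  then show ?thesis using OInc by (auto simp: \<phi>_def)
next
  case (OZero m)
  define \<phi> where "\<phi> i = (if i = 0 then P0 else P1)" for i :: nat
  have "sweep (op_cell op) (\<phi> 0) (map (cell_at x M u w) [0..<Suc L]) = (\<phi> (Suc L),
      map (cell_at x M (u(m := 0)) w) [0..<Suc L])"
    by (rule sweep_map_upt) (use OZero M L in \<open>auto simp: cell_at_def \<phi>_def split: if_splits\<close>)
  then show ?thesis using OZero by (auto simp: \<phi>_def)
next
  case (OOut b)
  define \<phi> where "\<phi> i = (if i \<le> length w then P0 else P1)" for i
  have "sweep (op_cell op) (\<phi> 0) (map (cell_at x M u w) [0..<Suc L]) = (\<phi> (Suc L),
      map (cell_at x M u (w @ [b])) [0..<Suc L])"
    by (rule sweep_map_upt)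
      (use OOut M L in \<open>auto simp: cell_at_def \<phi>_def nth_opt_def nth_append split: if_splits\<close>)
  then show ?thesis using OOut by (auto simp: \<phi>_def)
next
  case (OLess m m')
  define \<phi> where "\<phi> i = (if i \<le> min (u m) (u m') then P0 else if u m < u m' then P1 else P2)" for i
  have "sweep (op_cell op) (\<phi> 0)
      (map (cell_at x M u w) [0..<Suc L]) = (\<phi> (Suc L), map (cell_at x M u w) [0..<Suc L])"
    by (rule sweep_map_upt) (use OLess M L in \<open>auto simp: cell_at_def \<phi>_def split: if_splits\<close>)
  moreover have "u m < L" using OLess M L by auto
  ultimately show ?thesis using OLess by (auto simp: \<phi>_def)
next
  case (ORead m)
  define \<phi> where "\<phi> i = (if i \<le> u m then P0 else if u m < length x \<and> x ! u m then P1 else P2)" for i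
  have "sweep (op_cell op) (\<phi> 0)
      (map (cell_at x M u w) [0..<Suc L]) = (\<phi> (Suc L), map (cell_at x M u w) [0..<Suc L])"
    by (rule sweep_map_upt[OF _ le0])
      (use ORead M L in \<open>auto simp: cell_at_def nth_opt_def \<phi>_def split: if_splits;
        metis le_antisym not_less_eq_eq\<close>)
  moreover have "u m < L" using ORead M L by auto
  ultimately show ?thesis using ORead by (auto simp: \<phi>_def)
next
  case ONop
  have "sweep (op_cell op) P0 (map (cell_at x M u w) [0..<Suc L]) =
      (P0, map (cell_at x M u w) [0..<Suc L])"
    by (rule sweep_map_upt[where \<phi> = "\<lambda>_. P0"]) (use ONop in auto)
  then show ?thesis using ONop by auto
qed

text \<open>The control is a stack of items still to be done. The last number of an item is the loop
  depth; it selects the counter, so nested loops never share one.\<close>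

datatype item = Do com nat | Loop nat com nat | IncC nat

fun item_op :: "item \<Rightarrow> op" where
  "item_op (Do Skip d) = ONop"
| "item_op (Do (Inc r) d) = OInc (Inl r)"
| "item_op (Do (Out b) d) = OOut b"
| "item_op (Do (Seq a b) d) = ONop"
| "item_op (Do (IfIn r a b) d) = ORead (Inl r)"
| "item_op (Do (Rep r c) d) = OZero (Inr d)"
| "item_op (Loop r c d) = OLess (Inr d) (Inl r)"
| "item_op (IncC d) = OInc (Inr d)"

fun item_next :: "item \<Rightarrow> bool \<Rightarrow> item list" where
  "item_next (Do (Seq a b) d) t = [Do a d, Do b d]"
| "item_next (Do (IfIn r a b) d) t = [if t then Do a d else Do b d]"
| "item_next (Do (Rep r c) d) t = [Loop r c d]"
| "item_next (Loop r c d) t = (if t then [Do c (Suc d), IncC d, Loop r c d] else [])"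
| "item_next _ t = []"

type_synonym mconf = "item list \<times> (mark \<Rightarrow> nat) \<times> bool list"

fun mstep :: "bool list \<Rightarrow> mconf \<Rightarrow> mconf" where
  "mstep x ([], s) = ([], s)"
| "mstep x (it # k, s) = (item_next it (op_test x (item_op it) (fst s)) @ k, op_upd (item_op it) s)"

definition regs :: "(mark \<Rightarrow> nat) \<Rightarrow> nat \<Rightarrow> nat" where
  "regs u r = u (Inl r)"

lemma regs_upd_Inr [simp]: "regs (u(Inr d := z)) = regs u"
  by (simp add: regs_def fun_eq_iff)

text \<open>The counters \<open>Inr e\<close> with \<open>e < d\<close> belong to enclosing loops.
  Their survival is the part of the claim that carries nested loops, since a loop body runs one
  level deeper.\<close>

lemma mstep_run:
  assumes "wf_com c" "\<And>r. fst (sem x c (regs u, w)) r \<le> B"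
  shows "\<exists>n u'. n \<le> cost c B \<and> (mstep x ^^ n) (Do c d # k, u, w) = (k, u', snd (sem x c (regs u, w))) \<and>
    regs u' = fst (sem x c (regs u, w)) \<and> (\<forall>e<d. u' (Inr e) = u (Inr e))"
  using assms
proof (induction c arbitrary: u w d k)
  case Skip
  then show ?case by (intro exI[of _ 1] exI[of _ u]) auto
next
  case (Inc r)
  then show ?case by (intro exI[of _ 1] exI[of _ "u(Inl r := Suc (u (Inl r)))"]) (auto simp: regs_def fun_eq_iff)
next
  case (Out b)
  then show ?case by (intro exI[of _ 1] exI[of _ u]) auto
next
  case (Seq a b)
  let ?s = "sem x a (regs u, w)"
  have "fst ?s r \<le> B" for r
    using le_trans[OF sem_mono[of ?s r x b]] Seq.prems(2)[of r] unfolding sem.simps by blast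
  then obtain n u' where 1: "n \<le> cost a B" "regs u' = fst ?s" "\<forall>e<d. u' (Inr e) = u (Inr e)"
    "(mstep x ^^ n) (Do a d # Do b d # k, u, w) = (Do b d # k, u', snd ?s)"
    using Seq.IH(1)[of u w d "Do b d # k"] Seq.prems by auto
  have eq: "(regs u', snd ?s) = ?s" using 1 by simp
  obtain n' u'' where 2: "n' \<le> cost b B" "regs u'' = fst (sem x b ?s)" "\<forall>e<d. u'' (Inr e) = u' (Inr e)"
    "(mstep x ^^ n') (Do b d # k, u', snd ?s) = (k, u'', snd (sem x b ?s))"
    using Seq.IH(2)[of u' "snd ?s" d k] Seq.prems unfolding eq by auto
  have "(mstep x ^^ (n' + (n + 1))) (Do (Seq a b) d # k, u, w) = (k, u'', snd (sem x b ?s))"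
    using 1(4) 2(4) unfolding funpow_add by simp
  then show ?case using 1 2 by (intro exI[of _ "n' + (n + 1)"] exI[of _ u'']) auto
next
  case (IfIn r a b)
  define t where "t = (u (Inl r) < length x \<and> x ! u (Inl r))"
  define c where "c = (if t then a else b)"
  have sem_c: "sem x (IfIn r a b) (regs u, w) = sem x c (regs u, w)"
    by (simp add: c_def t_def regs_def)
  have "\<exists>n u'. n \<le> cost c B \<and> (mstep x ^^ n) (Do c d # k, u, w) = (k, u', snd (sem x c (regs u, w))) \<and>
    regs u' = fst (sem x c (regs u, w)) \<and> (\<forall>e<d. u' (Inr e) = u (Inr e))"
    using IfIn.IH(1)[of u w d k] IfIn.IH(2)[of u w d k] IfIn.prems unfolding sem_c c_def
    by (cases t) simp_all
  then obtain n u' where *: "n \<le> cost c B"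
    "(mstep x ^^ n) (Do c d # k, u, w) = (k, u', snd (sem x c (regs u, w)))"
    "regs u' = fst (sem x c (regs u, w))" "\<forall>e<d. u' (Inr e) = u (Inr e)" by blast
  have "mstep x (Do (IfIn r a b) d # k, u, w) = (Do c d # k, u, w)"
    by (simp add: c_def t_def)
  then have "(mstep x ^^ (n + 1)) (Do (IfIn r a b) d # k, u, w) = (k, u', snd (sem x c (regs u, w)))"
    using *(2) unfolding funpow_add by simp
  moreover have "n + 1 \<le> cost (IfIn r a b) B" using *(1) by (simp add: c_def split: if_splits)
  ultimately show ?case using *(3,4) unfolding sem_c by (intro exI[of _ "n + 1"] exI[of _ u']) simp
next
  case (Rep r c)
  let ?s = "\<lambda>j. (sem x c ^^ j) (regs u, w)"
  let ?N = "regs u r"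
  have N: "?N \<le> B" using Rep.prems(2)[of r] sem_mono[of "(regs u, w)" r x "Rep r c"] by simp
  have r: "r \<notin> incs c" "wf_com c" using Rep.prems by auto
  have keep: "fst (?s j) r = ?N" for j
    by (induction j) (use r in \<open>auto simp: sem_unchanged\<close>)
  \<comment> \<open>After \<open>j\<close> rounds the counter is \<open>j\<close>. The register
    bound for the next round follows from the bound on the final contents by monotonicity.\<close>
  have it: "\<exists>n u'. n \<le> j * (cost c B + 2) \<and>
     (mstep x ^^ n) (Loop r c d # k, u(Inr d := 0), w) = (Loop r c d # k, u', snd (?s j)) \<and>
     regs u' = fst (?s j) \<and> u' (Inr d) = j \<and> (\<forall>e<d. u' (Inr e) = u (Inr e))" if "j \<le> ?N" for j
    using that
  proof (induction j)
    case 0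
    show ?case by (intro exI[of _ 0] exI[of _ "u(Inr d := 0)"]) (auto simp: regs_def)
  next
    case (Suc j)
    then obtain n u' where 1: "n \<le> j * (cost c B + 2)"
     "(mstep x ^^ n) (Loop r c d # k, u(Inr d := 0), w) = (Loop r c d # k, u', snd (?s j))"
     "regs u' = fst (?s j)" "u' (Inr d) = j" "\<forall>e<d. u' (Inr e) = u (Inr e)"
      using Suc.IH[OF Suc_leD[OF Suc.prems]] by blast
    have eq: "(regs u', snd (?s j)) = ?s j" using 1(3) by simp
    have "fst (sem x c (?s j)) r' \<le> B" for r'
      using sem_iter_mono[OF Suc.prems, of x c "(regs u, w)" r'] Rep.prems(2)[of r'] by simp
    then obtain m u'' where 2: "m \<le> cost c B" "regs u'' = fst (?s (Suc j))"
      "\<forall>e<Suc d. u'' (Inr e) = u' (Inr e)"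
      "(mstep x ^^ m) (Do c (Suc d) # IncC d # Loop r c d # k, u', snd (?s j)) =
        (IncC d # Loop r c d # k, u'', snd (?s (Suc j)))"
      using Rep.IH[of u' "snd (?s j)" "Suc d" "IncC d # Loop r c d # k"] r unfolding eq by auto
    have "u' (Inl r) = ?N" using keep[of j] 1(3) by (metis regs_def)
    then have "mstep x (Loop r c d # k, u', snd (?s j)) =
        (Do c (Suc d) # IncC d # Loop r c d # k, u', snd (?s j))"
      using 1(4) Suc.prems by simp
    then have "(mstep x ^^ (1 + (m + (1 + n)))) (Loop r c d # k, u(Inr d := 0), w) =
        (Loop r c d # k, u''(Inr d := Suc (u'' (Inr d))), snd (?s (Suc j)))"
      using 1(2) 2(4) unfolding funpow_add by simp
    moreover have "u'' (Inr d) = j" using 2(3) 1(4) by simp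
    moreover have "1 + (m + (1 + n)) \<le> Suc j * (cost c B + 2)" using 1(1) 2(1) by simp
    ultimately show ?case using 1(5) 2(2,3)
      by (intro exI[of _ "1 + (m + (1 + n))"] exI[of _ "u''(Inr d := Suc (u'' (Inr d)))"] conjI)
        (simp_all del: fun_upd_apply add: fun_upd_same fun_upd_other)
  qed
  obtain n u' where 1: "n \<le> ?N * (cost c B + 2)"
     "(mstep x ^^ n) (Loop r c d # k, u(Inr d := 0), w) = (Loop r c d # k, u', snd (?s ?N))"
     "regs u' = fst (?s ?N)" "u' (Inr d) = ?N" "\<forall>e<d. u' (Inr e) = u (Inr e)"
    using it[of ?N] by auto
  have "u' (Inl r) = ?N" using keep[of ?N] 1(3) by (metis regs_def)
  then have "mstep x (Loop r c d # k, u', snd (?s ?N)) = (k, u', snd (?s ?N))"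
    using 1(4) by simp
  then have "(mstep x ^^ (1 + (n + 1))) (Do (Rep r c) d # k, u, w) = (k, u', snd (?s ?N))"
    using 1(2) unfolding funpow_add by simp
  moreover have "?N * (cost c B + 2) \<le> B * (cost c B + 2)" using N by (rule mult_le_mono1)
  then have "1 + (n + 1) \<le> cost (Rep r c) B" using 1(1) by simp
  ultimately show ?case using 1 by (intro exI[of _ "1 + (n + 1)"] exI[of _ u']) auto
qed

text \<open>A loop returns to the very stack with which it started, so only finitely many control
  stacks occur. Therefore a whole stack can be part of a state of the Turing machine.\<close>

fun stacks :: "com \<Rightarrow> nat \<Rightarrow> item list \<Rightarrow> item list set" where
  "stacks (Seq a b) d k = insert (Do (Seq a b) d # k) (stacks a d (Do b d # k) \<union> stacks b d k)"
| "stacks (IfIn r a b) d k = insert (Do (IfIn r a b) d # k) (stacks a d k \<union> stacks b d k)"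
| "stacks (Rep r c) d k = {Do (Rep r c) d # k, Loop r c d # k, IncC d # Loop r c d # k} \<union>
     stacks c (Suc d) (IncC d # Loop r c d # k)"
| "stacks c d k = {Do c d # k}"

lemma finite_stacks: "finite (stacks c d k)"
  by (induction c d k rule: stacks.induct) auto

lemma stacks_start: "Do c d # k \<in> stacks c d k"
  by (cases c) auto

lemma stacks_nonempty: "[] \<notin> stacks c d k"
  by (induction c d k rule: stacks.induct) auto

lemma stacks_closed: "it # st \<in> stacks c d k \<Longrightarrow> item_next it t @ st \<in> insert k (stacks c d k)"
proof (induction c d k rule: stacks.induct)
  case (1 a b d k)
  then show ?case using stacks_start[of a d "Do b d # k"] stacks_start[of b d k] by auto
next
  case (2 r a b d k)
  then show ?case using stacks_start[of a d k] stacks_start[of b d k] by (cases t) auto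
next
  case (3 r c d k)
  then show ?case using stacks_start[of c "Suc d" "IncC d # Loop r c d # k"] by auto
qed auto

section \<open>Turing machines over arbitrary finite alphabets\<close>

type_synonym ('q, 's) gconf = "'q \<times> 's list \<times> 's list"

text \<open>The machine model with abstract states and symbols: \<open>h\<close> is the halting state and
  \<open>bl\<close> the blank.\<close>

fun gstep :: "'q \<Rightarrow> 's \<Rightarrow> ('q \<Rightarrow> 's \<Rightarrow> 'q \<times> 's \<times> nat) \<Rightarrow> ('q, 's) gconf \<Rightarrow> ('q, 's) gconf" where
  "gstep h bl \<delta> (q, l, r) = (if q = h then (q, l, r) else
     (let s = (case r of [] \<Rightarrow> bl | a # _ \<Rightarrow> a); (q', s', m) = \<delta> q s; r' = s' # tl r
      in if m = 0 then (case l of [] \<Rightarrow> (q', [], r') | a # l' \<Rightarrow> (q', l', a # r'))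
         else if m = 1 then (q', l, r')
         else (q', s' # l, tl r)))"

text \<open>Gives the distinguished states and symbols the codes that the machine model prescribes
  for them.\<close>

lemma finite_enumeration:
  assumes "finite A" "distinct ds" "set ds \<subseteq> A"
  shows "\<exists>e. bij_betw e A {..<card A} \<and> (\<forall>i<length ds. e (ds ! i) = (i::nat))"
proof -
  obtain xs where xs: "set xs = A - set ds" "distinct xs"
    using assms(1) finite_distinct_list by (metis finite_Diff)
  let ?zs = "ds @ xs"
  have z: "distinct ?zs" "set ?zs = A" using xs assms by auto
  then have len: "length ?zs = card A" using distinct_card by metis
  have b: "bij_betw (nth ?zs) {..<card A} A"
    using bij_betw_nth[OF z(1) refl refl] unfolding len z(2) .
  let ?e = "inv_into {..<card A} (nth ?zs)"
  have "?e (ds ! i) = i" if "i < length ds" for i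
  proof -
    have "i < card A" using that len by simp
    then have "?e (?zs ! i) = i" using b by (intro inv_into_f_f) (auto simp: bij_betw_def)
    then show ?thesis using that by (simp add: nth_append)
  qed
  then show ?thesis using bij_betw_inv_into[OF b] by blast
qed

text \<open>The rest \<open>r\<close> behind the output must not begin with a bit, because
  \<open>tm_output\<close> reads on as long as there are bits. A halted configuration does not
  change, so the run may be prolonged from \<open>t\<close> to a bound of the form
  \<open>c * n ^ k + c\<close>.\<close>

lemma gstep_to_tm:
  fixes SY :: "'s set" and ST :: "'q set"
  assumes fin: "finite ST" "finite SY" and in_ST: "st0 \<in> ST" "h \<in> ST" "st0 \<noteq> h"
    and in_SY: "bl \<in> SY" "bF \<in> SY" "bT \<in> SY" "distinct [bl, bF, bT]"
    and closed: "\<And>q s. q \<in> ST \<Longrightarrow> s \<in> SY \<Longrightarrow>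
      fst (\<delta> q s) \<in> ST \<and> fst (snd (\<delta> q s)) \<in> SY \<and> snd (snd (\<delta> q s)) \<le> 2"
    and run: "\<And>x. \<exists>l r. (gstep h bl \<delta> ^^ t (length x)) (st0, [], map (\<lambda>b. if b then bT else bF) x) =
        (h, l, map (\<lambda>b. if b then bT else bF) (f x) @ r) \<and> (r \<noteq> [] \<longrightarrow> hd r \<notin> {bT, bF}) \<and> set r \<subseteq> SY"
    and poly: "poly_bounded t"
  shows "poly_time_computable f"
proof -
  obtain es where es0: "bij_betw es SY {..<card SY}" "\<And>i. i < 3 \<Longrightarrow> es ([bl, bF, bT] ! i) = i"
    using finite_enumeration[of SY "[bl, bF, bT]"] fin in_SY by auto
  have es: "bij_betw es SY {..<card SY}" "es bl = 0" "es bF = 1" "es bT = 2"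
    using es0(1) es0(2)[of 0] es0(2)[of 1] es0(2)[of 2] by simp_all
  obtain eq where eq0: "bij_betw eq ST {..<card ST}" "\<And>i. i < 2 \<Longrightarrow> eq ([st0, h] ! i) = i"
    using finite_enumeration[of ST "[st0, h]"] fin in_ST by auto
  have eq: "bij_betw eq ST {..<card ST}" "eq st0 = 0" "eq h = 1"
    using eq0(1) eq0(2)[of 0] eq0(2)[of 1] by simp_all
  define dq where "dq = inv_into ST eq"
  define dsy where "dsy = inv_into SY es"
  have dq: "dq (eq q) = q" if "q \<in> ST" for q
    using that eq(1) unfolding dq_def by (intro inv_into_f_f) (auto simp: bij_betw_def)
  have dsy: "dsy (es s) = s" if "s \<in> SY" for s
    using that es(1) unfolding dsy_def by (intro inv_into_f_f) (auto simp: bij_betw_def)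
  have dq': "dq i \<in> ST" if "i < card ST" for i
    using that eq(1) unfolding dq_def bij_betw_def by (metis inv_into_into lessThan_iff)
  have dsy': "dsy i \<in> SY" if "i < card SY" for i
    using that es(1) unfolding dsy_def bij_betw_def by (metis inv_into_into lessThan_iff)
  have eqlt: "eq q < card ST" if "q \<in> ST" for q using that eq(1) by (auto simp: bij_betw_def)
  have eslt: "es s < card SY" if "s \<in> SY" for s using that es(1) by (auto simp: bij_betw_def)
  have eq1: "eq q = 1 \<longleftrightarrow> q = h" if "q \<in> ST" for q using dq that eq(3) in_ST(2) by metis
  define D where "D i j = (case \<delta> (dq i) (dsy j) of (q, s, m) \<Rightarrow> (eq q, es s, m))" for i j
  let ?M = "(card ST, card SY, D)"
  define ec where "ec c = (case c of (q, l, r) \<Rightarrow> (eq q, map es l, map es r))" for c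
  have wf: "wf_tm ?M"
  proof -
    have "card {st0, h} \<le> card ST" using fin in_ST by (intro card_mono) auto
    moreover have "card {bl, bF, bT} \<le> card SY" using fin in_SY by (intro card_mono) auto
    moreover have "fst (D i j) < card ST \<and> fst (snd (D i j)) < card SY \<and> snd (snd (D i j)) \<le> 2"
      if "i < card ST" "j < card SY" for i j
      using closed[OF dq'[OF that(1)] dsy'[OF that(2)]] eqlt eslt
      by (auto simp: D_def split: prod.splits)
    ultimately show ?thesis using in_ST in_SY by (auto simp: wf_tm_def)
  qed
  define ok where "ok c = (case c of (q, l, r) \<Rightarrow> q \<in> ST \<and> set l \<subseteq> SY \<and> set r \<subseteq> SY)" for c
  have step: "tm_step ?M (ec c) = ec (gstep h bl \<delta> c) \<and> ok (gstep h bl \<delta> c)" if ok: "ok c" for c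
  proof -
    obtain q l r where c: "c = (q, l, r)" using prod_cases3 by blast
    have q: "q \<in> ST" and l: "set l \<subseteq> SY" and r: "set r \<subseteq> SY" using ok c by (auto simp: ok_def)
    show ?thesis
    proof (cases "q = h")
      case True
      then show ?thesis using ok c eq(3) by (simp add: tm_step_def ec_def)
    next
      case False
      define s where "s = (case r of [] \<Rightarrow> bl | a # _ \<Rightarrow> a)"
      have s: "s \<in> SY" using r in_SY by (auto simp: s_def split: list.splits)
      have s': "(case map es r of [] \<Rightarrow> 0 | a # _ \<Rightarrow> a) = es s"
        using es(2) by (auto simp: s_def split: list.splits)
      obtain q' w m where d: "\<delta> q s = (q', w, m)" using prod_cases3 by blast
      have D: "D (eq q) (es s) = (eq q', es w, m)" using d dq[OF q] dsy[OF s] by (simp add: D_def)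
      have cl: "q' \<in> ST" "w \<in> SY" using closed[OF q s] d by auto
      have tl: "set (tl r) \<subseteq> SY" using r by (cases r) auto
      have g: "gstep h bl \<delta> c = (if m = 0 then (case l of [] \<Rightarrow> (q', [], w # tl r) | a # l' \<Rightarrow> (q', l', a # w # tl r))
         else if m = 1 then (q', l, w # tl r) else (q', w # l, tl r))"
        using False d by (simp add: c s_def[symmetric] Let_def)
      have g': "tm_step ?M (ec c) = (if m = 0 then (case map es l of [] \<Rightarrow> (eq q', [], es w # map es (tl r))
          | a # l' \<Rightarrow> (eq q', l', a # es w # map es (tl r)))
         else if m = 1 then (eq q', map es l, es w # map es (tl r)) else (eq q', es w # map es l, map es (tl r)))"
        using False eq1[OF q] D s' by (cases l) (simp_all add: c tm_step_def ec_def map_tl Let_def)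
      show ?thesis unfolding g g' using cl l tl by (auto simp: ec_def ok_def split: list.splits)
    qed
  qed
  have steps: "tm_run ?M n (ec c) = ec ((gstep h bl \<delta> ^^ n) c) \<and> ok ((gstep h bl \<delta> ^^ n) c)" if "ok c" for c n
    by (induction n) (use that step in \<open>auto simp: tm_run_def\<close>)
  obtain c k where ck: "\<And>n. t n \<le> c * n ^ k + c" using poly_bounded_standard[OF poly] by blast
  have halt: "(gstep h bl \<delta> ^^ n) (h, l, r) = (h, l, r)" for n l r
    by (induction n) auto
  have "fst (tm_run ?M (c * length x ^ k + c) (init_config x)) = 1 \<and>
      tm_output (tm_run ?M (c * length x ^ k + c) (init_config x)) = f x" for x
  proof -
    let ?b = "map (\<lambda>b. if b then bT else bF)"
    let ?n = "c * length x ^ k + c"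
    obtain l r where lr: "(gstep h bl \<delta> ^^ t (length x)) (st0, [], ?b x) = (h, l, ?b (f x) @ r)"
      "r \<noteq> [] \<longrightarrow> hd r \<notin> {bT, bF}" "set r \<subseteq> SY" using run by blast
    have "?n = (?n - t (length x)) + t (length x)" using ck by simp
    then have n: "(gstep h bl \<delta> ^^ ?n) (st0, [], ?b x) = (h, l, ?b (f x) @ r)"
      using lr(1) halt by (metis comp_apply funpow_add)
    have "init_config x = ec (st0, [], ?b x)"
      using es eq by (auto simp: init_config_def ec_def sym_of_bit_def)
    moreover have "ok (st0, [], ?b x)" using in_ST in_SY by (auto simp: ok_def)
    ultimately have "tm_run ?M ?n (init_config x) = ec (h, l, ?b (f x) @ r)"
      using steps n by metis
    then have 1: "tm_run ?M ?n (init_config x) = (1, map es l, map es (?b (f x)) @ map es r)"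
      using eq(3) by (simp add: ec_def)
    have "r \<noteq> [] \<longrightarrow> es (hd r) \<noteq> 1 \<and> es (hd r) \<noteq> 2"
      using lr(2,3) in_SY dsy es by (metis hd_in_set insertCI subsetD)
    then have "takeWhile (\<lambda>s. s = 1 \<or> s = 2) (map es r) = []" by (cases r) auto
    then have "takeWhile (\<lambda>s. s = 1 \<or> s = 2) (map es (?b (f x)) @ map es r) = map es (?b (f x))"
      using es by (subst takeWhile_append2) auto
    then have "tm_output (1, map es l, map es (?b (f x)) @ map es r) = map (\<lambda>s. s = 2) (map es (?b (f x)))"
      by (simp add: tm_output_def)
    also have "\<dots> = f x" using es by (auto intro!: map_idI split: if_splits)
    finally show ?thesis using 1 by simp
  qed
  then show ?thesis unfolding poly_time_computable_def Let_def using wf by blast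
qed

section \<open>Compiling the loop language to Turing machines\<close>

datatype tst = TInit bool | THalt | TRight "item list" phase | TLeft "item list" | TFin

text \<open>The flag of a cell marks the left end of the tape.\<close>

datatype sym = Blank | Bit bool | Cell bool cell

definition after :: "item list \<Rightarrow> phase \<Rightarrow> tst" where
  "after st p = (let st' = item_next (hd st) (p = P1) @ tl st in if st' = [] then TFin else TLeft st')"

fun erase :: "sym \<Rightarrow> sym" where
  "erase (Cell f (i, w, ms)) = (case w of None \<Rightarrow> Blank | Some b \<Rightarrow> Bit b)"
| "erase s = s"

text \<open>The initial pass turns the input into cells: register 0 is marked right behind the
  input, since it starts with the input length, and all other markers go to the flagged first cell.
  Every pass to the right ends on a blank, which becomes a new cell, so the tape grows with each
  instruction and always has room. The last pass leaves only the output.\<close>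

fun delta :: "com \<Rightarrow> mark set \<Rightarrow> tst \<Rightarrow> sym \<Rightarrow> tst \<times> sym \<times> nat" where
  "delta c M (TInit f) (Bit b) = (TInit False, Cell f (Some b, None, if f then M - {Inl 0} else {}), 2)"
| "delta c M (TInit f) Blank = (TLeft [Do c 0], Cell f (None, None, if f then M else {Inl 0}), 1)"
| "delta c M (TRight st p) (Cell f a) =
     (case op_cell (item_op (hd st)) p a of (p', a') \<Rightarrow> (TRight st p', Cell f a', 2))"
| "delta c M (TRight st p) Blank =
     (case op_cell (item_op (hd st)) p (None, None, {}) of (p', a') \<Rightarrow> (after st p', Cell False a', 1))"
| "delta c M (TLeft st) (Cell f a) =
     (if f then (TRight st P0, Cell f a, 1) else (TLeft st, Cell f a, 0))"
| "delta c M TFin (Cell f a) =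
     (if f then (THalt, erase (Cell f a), 1) else (TFin, erase (Cell f a), 0))"
| "delta c M _ _ = (THalt, Blank, 1)"

definition tape :: "bool list \<Rightarrow> mark set \<Rightarrow> (mark \<Rightarrow> nat) \<Rightarrow> bool list \<Rightarrow> nat \<Rightarrow> sym list" where
  "tape x M u w L = map (\<lambda>i. Cell (i = 0) (cell_at x M u w i)) [0..<L]"

lemma tape_Suc: "tape x M u w (Suc L) = tape x M u w L @ [Cell (L = 0) (cell_at x M u w L)]"
  by (simp add: tape_def)

lemma item_next_no_test: "\<not> is_test (item_op it) \<Longrightarrow> item_next it t = item_next it t'"
  by (cases "(it, t)" rule: item_next.cases) auto

lemma sweep_length: "length (snd (sweep f p as)) = length as"
  by (induction as arbitrary: p) (auto split: prod.splits, metis snd_conv)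

context
  fixes c :: com and M :: "mark set"
begin

abbreviation step where "step \<equiv> gstep THalt Blank (delta c M)"

lemma step_right:
  "sweep (op_cell (item_op (hd st))) p (as @ [(None, None, {})]) = (p', bs) \<Longrightarrow> length fs = length as \<Longrightarrow>
   (step ^^ Suc (length as)) (TRight st p, l, map2 Cell fs as) =
     (after st p', rev (map2 Cell fs (butlast bs)) @ l, [Cell False (last bs)])"
proof (induction as arbitrary: p fs l bs)
  case Nil
  then show ?case by (auto split: prod.splits)
next
  case (Cons a as)
  obtain f fs' where fs: "fs = f # fs'" "length fs' = length as" using Cons.prems(2) by (cases fs) auto
  obtain q a' where q: "op_cell (item_op (hd st)) p a = (q, a')"
    using prod.exhaust by blast
  obtain bs' where bs: "bs = a' # bs'" "sweep (op_cell (item_op (hd st))) q (as @ [(None, None, {})]) = (p', bs')"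
    using Cons.prems(1) q by (auto split: prod.splits)
  have "bs' \<noteq> []" using sweep_length[of "op_cell (item_op (hd st))" q "as @ [(None, None, {})]"] bs(2) by auto
  moreover have "step (TRight st p, l, map2 Cell fs (a # as)) = (TRight st q, Cell f a' # l, map2 Cell fs' as)"
    using q fs by simp
  moreover have "(step ^^ Suc (Suc (length as))) (TRight st p, l, map2 Cell fs (a # as)) =
      (step ^^ Suc (length as)) (step (TRight st p, l, map2 Cell fs (a # as)))"
    by (simp only: funpow_Suc_right comp_apply)
  ultimately show ?case using Cons.IH[OF bs(2) fs(2), of "Cell f a' # l"] fs bs
    by (simp del: funpow.simps gstep.simps delta.simps)
qed

text \<open>The common form of the passes in \<open>TLeft\<close> and \<open>TFin\<close>;
  \<open>e\<close> is what the pass does to a cell.\<close>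

lemma step_back:
  fixes a as
  defines "T \<equiv> Cell True a # map (Cell False) as"
  assumes q: "q \<noteq> THalt" "\<And>f b. delta c M q (Cell f b) = (if f then (q', e (Cell f b), 1) else (q, e (Cell f b), 0))"
  shows "(step ^^ Suc (length as)) (q, tl (rev T), hd (rev T) # r) = (q', [], map e T @ r)"
  unfolding T_def
proof (induction as arbitrary: r rule: rev_induct)
  case Nil
  then show ?case by (simp add: q)
next
  case (snoc b as)
  let ?T = "Cell True a # map (Cell False) as"
  obtain y ys where y: "rev ?T = y # ys" by (cases "rev ?T") auto
  have "step (q, rev ?T, Cell False b # r) = (q, tl (rev ?T), hd (rev ?T) # e (Cell False b) # r)"
    unfolding y by (simp add: q)
  moreover have "(step ^^ Suc (Suc (length as))) (q, rev ?T, Cell False b # r) =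
      (step ^^ Suc (length as)) (step (q, rev ?T, Cell False b # r))"
    by (simp only: funpow_Suc_right comp_apply)
  ultimately show ?case using snoc[of "e (Cell False b) # r"]
    by (simp del: funpow.simps gstep.simps)
qed

lemma step_left:
  fixes a as
  defines "T \<equiv> Cell True a # map (Cell False) as"
  shows "(step ^^ Suc (length as)) (TLeft st, tl (rev T), hd (rev T) # r) = (TRight st P0, [], T @ r)"
  unfolding T_def by (subst step_back[where e = "\<lambda>s. s"]) simp_all

lemma step_fin:
  fixes a as
  defines "T \<equiv> Cell True a # map (Cell False) as"
  shows "(step ^^ Suc (length as)) (TFin, tl (rev T), hd (rev T) # r) = (THalt, [], map erase T @ r)"
  unfolding T_def by (rule step_back) simp_all

lemma tape_Cons:
  "tape x M u w (Suc L) = Cell True (cell_at x M u w 0) # map (Cell False) (map (cell_at x M u w) [1..<Suc L])"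
  unfolding tape_def by (subst upt_conv_Cons) auto

text \<open>An instruction takes \<open>L + 1\<close> steps to the right, the last of them on the
  blank, and \<open>L + 1\<close> steps back to the flagged cell.\<close>

lemma step_mstep:
  assumes st: "mstep x (it # k, u, w) = (st', u', w')"
    and M: "op_marks (item_op it) \<subseteq> M" and L: "\<And>m. m \<in> M \<Longrightarrow> u m < L" "length w \<le> L" "length x \<le> L" "L \<noteq> 0"
  shows "(step ^^ (2 * L + 2)) (TRight (it # k) P0, [], tape x M u w L) =
    (if st' = [] then (THalt, [], map erase (tape x M u' w' (Suc L)))
     else (TRight st' P0, [], tape x M u' w' (Suc L)))"
proof -
  obtain p where p: "sweep (op_cell (item_op it)) P0 (map (cell_at x M u w) [0..<Suc L]) =
      (p, map (cell_at x M u' w') [0..<Suc L])" "is_test (item_op it) \<longrightarrow> (p = P1 \<longleftrightarrow> op_test x (item_op it) u)"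
    using sweep_op[where x = x and op = "item_op it" and M = M and u = u and L = L and w = w, OF M L(1,2)] st
    by (auto simp del: upt_Suc)
  have blank: "cell_at x M u w L = (None, None, {})"
    using L(1-3) by (auto simp: cell_at_def nth_opt_def)
  have "item_next it (p = P1) = item_next it (op_test x (item_op it) u)"
    using p(2) item_next_no_test[of it "p = P1" "op_test x (item_op it) u"] by auto
  then have st': "after (it # k) p = (if st' = [] then TFin else TLeft st')"
    using st by (simp add: after_def)
  have tp: "tape x M u w L = map2 Cell (map (\<lambda>i. i = 0) [0..<L]) (map (cell_at x M u w) [0..<L])" for u w
    by (simp add: tape_def zip_map_map zip_same_conv_map)
  have "(step ^^ Suc L) (TRight (it # k) P0, [], tape x M u w L) =
     (after (it # k) p, rev (tape x M u' w' L), [Cell False (cell_at x M u' w' L)])"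
    using step_right[of "it # k" P0 "map (cell_at x M u w) [0..<L]" p "map (cell_at x M u' w') [0..<Suc L]"
        "map (\<lambda>i. i = 0) [0..<L]" "[]"] p(1) blank unfolding tp by (simp del: funpow.simps)
  also have "\<dots> = (after (it # k) p, tl (rev (tape x M u' w' (Suc L))), hd (rev (tape x M u' w' (Suc L))) # [])"
    using L(4) by (simp add: tape_Suc)
  finally have "(step ^^ (Suc L + Suc L)) (TRight (it # k) P0, [], tape x M u w L) =
     (step ^^ Suc L) (after (it # k) p, tl (rev (tape x M u' w' (Suc L))), hd (rev (tape x M u' w' (Suc L))) # [])"
    unfolding funpow_add by simp
  moreover have "length (map (cell_at x M u' w') [1..<Suc L]) = L" by simp
  ultimately show ?thesis
    using step_left[of "map (cell_at x M u' w') [1..<Suc L]" st' "cell_at x M u' w' 0" "[]"]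
      step_fin[of "map (cell_at x M u' w') [1..<Suc L]" "cell_at x M u' w' 0" "[]"] st'
    unfolding tape_Cons[symmetric] by (simp add: mult_2)
qed

lemma step_init:
  fixes x
  assumes "Inl 0 \<in> M"
  defines "u \<equiv> (\<lambda>m. if m = Inl 0 then length x else 0)"
  shows "(step ^^ (2 * Suc (length x))) (TInit True, [], map Bit x) =
    (TRight [Do c 0] P0, [], tape x M u [] (Suc (length x)))"
proof -
  have "(step ^^ j) (TInit True, [], map Bit x) = (TInit (j = 0), rev (tape x M u [] j), map Bit (drop j x))"
    if "j \<le> length x" for j
    using that
  proof (induction j)
    case (Suc j)
    have d: "drop j x = x ! j # drop (Suc j) x" using Suc.prems by (simp add: Cons_nth_drop_Suc)
    have "cell_at x M u [] j = (Some (x ! j), None, if j = 0 then M - {Inl 0} else {})"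
      using Suc.prems by (auto simp: cell_at_def nth_opt_def u_def)
    then show ?case using Suc by (simp add: d tape_Suc)
  qed (simp add: tape_def)
  from this[of "length x"] have "(step ^^ length x) (TInit True, [], map Bit x) =
      (TInit (x = []), rev (tape x M u [] (length x)), [])" by simp
  moreover have "cell_at x M u [] (length x) = (None, None, if x = [] then M else {Inl 0})"
    using assms(1) by (auto simp: cell_at_def nth_opt_def u_def)
  ultimately have "(step ^^ Suc (length x)) (TInit True, [], map Bit x) =
      (TLeft [Do c 0], tl (rev (tape x M u [] (Suc (length x)))), hd (rev (tape x M u [] (Suc (length x)))) # [])"
    by (simp add: tape_Suc)
  then have "(step ^^ (Suc (length x) + Suc (length x))) (TInit True, [], map Bit x) = (step ^^ Suc (length x))
      (TLeft [Do c 0], tl (rev (tape x M u [] (Suc (length x)))), hd (rev (tape x M u [] (Suc (length x)))) # [])"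
    unfolding funpow_add by (simp del: funpow.simps)
  then show ?thesis
    using step_left[of "map (cell_at x M u []) [1..<Suc (length x)]" "[Do c 0]" "cell_at x M u [] 0" "[]"]
    unfolding tape_Cons[symmetric] by (simp add: mult_2 del: funpow.simps upt_Suc)
qed

lemma step_run:
  assumes run: "(mstep x ^^ n) ([Do c 0], u, []) = ([], u', w')"
    and M: "\<And>st. st \<in> stacks c 0 [] \<Longrightarrow> op_marks (item_op (hd st)) \<subseteq> M"
    and L: "\<And>m. m \<in> M \<Longrightarrow> u m < L" "length x \<le> L" "L \<noteq> 0"
  shows "\<exists>t\<le>n * (2 * (L + n) + 2). \<exists>L'\<ge>length w'. (step ^^ t) (TRight [Do c 0] P0, [], tape x M u [] L) =
    (THalt, [], map erase (tape x M u' w' L'))"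
proof -
  let ?m = "\<lambda>j. (mstep x ^^ j) ([Do c 0], u, [])"
  \<comment> \<open>\<open>mstep\<close> idles on the empty stack, but the Turing machine winds up
    as soon as the stack is empty, so the simulation is followed up to that moment only.\<close>
  define n0 where "n0 = (LEAST j. fst (?m j) = [])"
  have n0: "fst (?m n0) = []" "n0 \<le> n" unfolding n0_def
    using run LeastI[of "\<lambda>j. fst (?m j) = []" n] Least_le[of "\<lambda>j. fst (?m j) = []" n] by simp_all
  have before: "fst (?m j) \<noteq> []" if "j < n0" for j using that not_less_Least unfolding n0_def by blast
  have stay: "(mstep x ^^ i) ([], s) = ([], s)" for i s by (induction i) auto
  have "?m n = (mstep x ^^ (n - n0)) (?m n0)"
    using n0(2) by (metis le_add_diff_inverse2 funpow_add comp_apply)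
  then have m0: "?m n0 = ([], u', w')" using n0(1) run stay by (metis prod.collapse)
  have inv: "fst (?m j) \<in> insert [] (stacks c 0 []) \<and> (\<forall>m\<in>M. fst (snd (?m j)) m < L + j) \<and>
     length (snd (snd (?m j))) \<le> L + j" for j
  proof (induction j)
    case 0
    then show ?case using L stacks_start[of c 0 "[]"] by simp
  next
    case (Suc j)
    obtain st v o' where s: "?m j = (st, v, o')" using prod_cases3 by blast
    show ?case
    proof (cases st)
      case Nil
      then show ?thesis using Suc s by auto
    next
      case (Cons it k)
      have "it # k \<in> stacks c 0 []" using Suc s Cons by auto
      then have "item_next it (op_test x (item_op it) v) @ k \<in> insert [] (stacks c 0 [])"
        by (rule stacks_closed)
      moreover have "\<forall>m\<in>M. fst (op_upd (item_op it) (v, o')) m < Suc (L + j)"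
        "length (snd (op_upd (item_op it) (v, o'))) \<le> Suc (L + j)"
        using Suc s by (cases "item_op it"; force simp: less_Suc_eq)+
      ultimately show ?thesis using s Cons by simp
    qed
  qed
  have main: "\<exists>t\<le>j * (2 * (L + j) + 2). (step ^^ t) (TRight [Do c 0] P0, [], tape x M u [] L) =
     (if fst (?m j) = [] then (THalt, [], map erase (tape x M (fst (snd (?m j))) (snd (snd (?m j))) (L + j)))
      else (TRight (fst (?m j)) P0, [], tape x M (fst (snd (?m j))) (snd (snd (?m j))) (L + j)))"
    if "j \<le> n0" for j
    using that
  proof (induction j)
    case 0
    show ?case by (intro exI[of _ 0]) simp
  next
    case (Suc j)
    then obtain t where t: "t \<le> j * (2 * (L + j) + 2)"
      "(step ^^ t) (TRight [Do c 0] P0, [], tape x M u [] L) =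
       (TRight (fst (?m j)) P0, [], tape x M (fst (snd (?m j))) (snd (snd (?m j))) (L + j))"
      using before[of j] by auto
    obtain it k v o' where s: "?m j = (it # k, v, o')"
      using before[of j] Suc.prems by (metis Suc_le_lessD list.exhaust prod.collapse)
    obtain st' v' o'' where s': "mstep x (it # k, v, o') = (st', v', o'')" using prod_cases3 by blast
    have mem: "it # k \<in> stacks c 0 []" using inv[of j] s by simp
    have "(step ^^ (2 * (L + j) + 2)) (TRight (it # k) P0, [], tape x M v o' (L + j)) =
      (if st' = [] then (THalt, [], map erase (tape x M v' o'' (Suc (L + j))))
       else (TRight st' P0, [], tape x M v' o'' (Suc (L + j))))"
      using M[OF mem] inv[of j] s L by (intro step_mstep[OF s']) auto
    then have "(step ^^ (2 * (L + j) + 2 + t)) (TRight [Do c 0] P0, [], tape x M u [] L) =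
      (if st' = [] then (THalt, [], map erase (tape x M v' o'' (Suc (L + j))))
       else (TRight st' P0, [], tape x M v' o'' (Suc (L + j))))"
      using t(2) s unfolding funpow_add by (simp del: funpow.simps)
    moreover have "2 * (L + j) + 2 + t \<le> Suc j * (2 * (L + Suc j) + 2)"
      using t(1) by (simp add: algebra_simps)
    moreover have "?m (Suc j) = (st', v', o'')" using s s' by simp
    ultimately show ?case by (intro exI[of _ "2 * (L + j) + 2 + t"]) (simp del: funpow.simps(2) mult_Suc)
  qed
  obtain t where t: "t \<le> n0 * (2 * (L + n0) + 2)"
    "(step ^^ t) (TRight [Do c 0] P0, [], tape x M u [] L) = (THalt, [], map erase (tape x M u' w' (L + n0)))"
    using main[of n0] m0 by auto
  have "n0 * (2 * (L + n0) + 2) \<le> n * (2 * (L + n) + 2)"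
    using n0(2) by (intro mult_le_mono) auto
  moreover have "length w' \<le> L + n0" using inv[of n0] m0 by simp
  ultimately show ?thesis using t by (intro exI[of _ t] conjI exI[of _ "L + n0"]) auto
qed

end

definition init_store :: "bool list \<Rightarrow> store" where
  "init_store x = ((\<lambda>_. 0)(0 := length x), [])"

theorem poly_time_com:
  assumes wf: "wf_com c" and B: "\<And>x r. fst (sem x c (init_store x)) r \<le> B (length x)"
    and poly: "poly_bounded B"
  shows "poly_time_computable (\<lambda>x. snd (sem x c (init_store x)))"
proof -
  \<comment> \<open>Only markers that occur in the program, to keep the alphabet finite; register 0
    is added because it receives the input length.\<close>
  define M where "M = insert (Inl 0) (\<Union>st\<in>stacks c 0 []. op_marks (item_op (hd st)))"
  have opfin: "finite (op_marks op)" for op by (cases op) auto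
  have finM: "finite M" unfolding M_def using finite_stacks opfin by auto
  define SY where "SY = {Blank, Bit True, Bit False} \<union>
     (\<lambda>(f, i, w, ms). Cell f (i, w, ms)) ` (UNIV \<times> UNIV \<times> UNIV \<times> Pow M)"
  define ST where "ST = {TInit True, TInit False, THalt, TFin} \<union>
     (\<lambda>(st, p). TRight st p) ` (stacks c 0 [] \<times> {P0, P1, P2}) \<union> TLeft ` stacks c 0 []"
  define N where "N n = cost c (B n)" for n
  \<comment> \<open>The initial pass and the way back, followed by at most \<open>N n\<close>
    instructions, each with two passes over a tape that grows by one cell per instruction.\<close>
  define t where "t n = 2 * Suc n + N n * (2 * (Suc n + N n) + 2)" for n
  have SY_Cell: "Cell f (i, w, ms) \<in> SY \<longleftrightarrow> ms \<subseteq> M" for f i w ms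
    unfolding SY_def by (force simp: image_iff)
  show ?thesis
  proof (rule gstep_to_tm[where ST = ST and SY = SY and \<delta> = "delta c M" and t = t
        and ?st0.0 = "TInit True" and h = THalt and bl = Blank and bT = "Bit True" and bF = "Bit False"])
    show "finite ST" unfolding ST_def using finite_stacks by auto
    show "finite SY" unfolding SY_def using finM by (auto intro!: finite_cartesian_product)
    show "poly_bounded t"
      using poly_bounded_cost[OF poly, of c] unfolding t_def N_def
      by (intro poly_bounded_add poly_bounded_mult poly_bounded_Suc) auto
    show "fst (delta c M q s) \<in> ST \<and> fst (snd (delta c M q s)) \<in> SY \<and> snd (snd (delta c M q s)) \<le> 2"
      if q: "q \<in> ST" and s: "s \<in> SY" for q s
    proof -
      have cellM: "snd (snd (snd (op_cell (item_op (hd st)) p a))) \<subseteq> M"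
        if "st \<in> stacks c 0 []" "snd (snd a) \<subseteq> M" for st p a
      proof -
        have "op_marks (item_op (hd st)) \<subseteq> M" using that unfolding M_def by auto
        then show ?thesis using that(2)
          by (cases a; cases "item_op (hd st)") (auto split: if_splits)
      qed
      have ph: "(p::phase) \<in> {P0, P1, P2}" for p by (cases p) auto
      have aft: "after st p \<in> ST" if "st \<in> stacks c 0 []" for st p
      proof -
        have "st \<noteq> []" using that stacks_nonempty by blast
        then obtain it k where "st = it # k" by (cases st) auto
        then have "item_next (hd st) (p = P1) @ tl st \<in> insert [] (stacks c 0 [])"
          using stacks_closed[of it k c 0 "[]"] that by simp
        then show ?thesis by (auto simp: after_def ST_def Let_def)
      qed
      consider f b where "q = TInit f" "s = Bit b" | f where "q = TInit f" "s = Blank"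
        | st p f a where "q = TRight st p" "s = Cell f a" | st p where "q = TRight st p" "s = Blank"
        | st f a where "q = TLeft st" "s = Cell f a" | f a where "q = TFin" "s = Cell f a"
        | "delta c M q s = (THalt, Blank, 1)"
        by (cases q; cases s) auto
      then show ?thesis
      proof cases
        case 1
        then show ?thesis by (auto simp: SY_Cell) (auto simp: ST_def)
      next
        case 2
        then show ?thesis using stacks_start[of c 0 "[]"]
          by (auto simp: SY_Cell M_def) (auto simp: ST_def)
      next
        case 3
        obtain p' i w ms where e: "op_cell (item_op (hd st)) p a = (p', i, w, ms)"
          using prod_cases4 by blast
        have "st \<in> stacks c 0 []" using q 3 by (auto simp: ST_def)
        moreover have "snd (snd a) \<subseteq> M" using s 3 by (cases a) (simp add: SY_Cell)
        ultimately have "ms \<subseteq> M" "TRight st p' \<in> ST"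
          using cellM[of st a p] e ph[of p'] by (auto simp: ST_def)
        then show ?thesis using 3 e by (simp add: SY_Cell)
      next
        case 4
        obtain p' i w ms where e: "op_cell (item_op (hd st)) p (None, None, {}) = (p', i, w, ms)"
          using prod_cases4 by blast
        have st: "st \<in> stacks c 0 []" using q 4 by (auto simp: ST_def)
        then have "ms \<subseteq> M" using cellM[of st "(None, None, {})" p] e by simp
        then show ?thesis using 4 e aft[OF st] by (simp add: SY_Cell)
      next
        case 5
        then show ?thesis using q s by (auto simp: ST_def)
      next
        case 6
        then show ?thesis by (cases a) (auto simp: ST_def SY_def split: option.splits)
      next
        case 7
        then show ?thesis by (simp add: ST_def SY_def)
      qed
    qed
    show "\<exists>l r. (gstep THalt Blank (delta c M) ^^ t (length x))
        (TInit True, [], map (\<lambda>b. if b then Bit True else Bit False) x) =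
        (THalt, l, map (\<lambda>b. if b then Bit True else Bit False) (snd (sem x c (init_store x))) @ r) \<and>
        (r \<noteq> [] \<longrightarrow> hd r \<notin> {Bit True, Bit False}) \<and> set r \<subseteq> SY" for x
    proof -
      let ?g = "gstep THalt Blank (delta c M)"
      let ?out = "snd (sem x c (init_store x))"
      define u where "u = (\<lambda>m::mark. if m = Inl 0 then length x else 0)"
      have "regs u = (\<lambda>_. 0)(0 := length x)" by (auto simp: regs_def u_def)
      then have init: "init_store x = (regs u, [])" by (simp add: init_store_def)
      obtain n u' where n: "n \<le> N (length x)" "(mstep x ^^ n) ([Do c 0], u, []) = ([], u', ?out)"
        using mstep_run[of c x u "[]" "B (length x)" 0 "[]"] wf B[of x] unfolding init N_def by auto
      have ul: "u m < Suc (length x)" for m by (simp add: u_def)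
      have Mst: "op_marks (item_op (hd st)) \<subseteq> M" if "st \<in> stacks c 0 []" for st
        using that unfolding M_def by blast
      obtain t' L' where t': "t' \<le> n * (2 * (Suc (length x) + n) + 2)" "length ?out \<le> L'"
        "(?g ^^ t') (TRight [Do c 0] P0, [], tape x M u [] (Suc (length x))) =
           (THalt, [], map erase (tape x M u' ?out L'))"
        using step_run[where x = x and u = u and L = "Suc (length x)", OF n(2) Mst ul] by auto
      have "n * (2 * (Suc (length x) + n) + 2) \<le> N (length x) * (2 * (Suc (length x) + N (length x)) + 2)"
        using n(1) by (intro mult_le_mono) auto
      then have le: "t' + 2 * Suc (length x) \<le> t (length x)" using t'(1) by (simp add: t_def)
      have bits: "map (\<lambda>b. if b then Bit True else Bit False) z = map Bit z" for z by auto
      have "Inl 0 \<in> M" by (simp add: M_def)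
      from step_init[OF this, of x c] have s0: "(?g ^^ (2 * Suc (length x))) (TInit True, [], map Bit x) =
          (TRight [Do c 0] P0, [], tape x M u [] (Suc (length x)))"
        unfolding u_def .
      have 1: "(?g ^^ (t' + 2 * Suc (length x))) (TInit True, [], map Bit x) =
          (THalt, [], map erase (tape x M u' ?out L'))"
        by (simp only: funpow_add comp_apply s0 t'(3))
      have halt: "(?g ^^ i) (THalt, l, r) = (THalt, l, r)" for i l r by (induction i) auto
      obtain d where d: "t (length x) = d + (t' + 2 * Suc (length x))"
        using le le_Suc_ex[of "t' + 2 * Suc (length x)"] by (auto simp: add.commute)
      have "(?g ^^ t (length x)) (TInit True, [], map Bit x) = (THalt, [], map erase (tape x M u' ?out L'))"
        unfolding d funpow_add[of d] comp_apply 1 by (rule halt)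
      moreover have "map erase (tape x M u' ?out L') = map Bit ?out @ replicate (L' - length ?out) Blank"
        using t'(2) by (intro nth_equalityI)
          (auto simp: tape_def cell_at_def nth_opt_def nth_append)
      ultimately show ?thesis unfolding bits
        by (intro exI[of _ "[]"] exI[of _ "replicate (L' - length ?out) Blank"]) (auto simp: SY_def)
    qed
  qed (auto simp: ST_def SY_def)
qed

section \<open>Symbolic circuit segments\<close>

definition run_gates :: "bool list \<Rightarrow> bool list \<Rightarrow> circuit \<Rightarrow> bool list" where
  "run_gates inp vs gs = foldl (\<lambda>vs g. vs @ [gval inp vs g]) vs gs"

lemma run_gates_simps [simp]:
  "run_gates inp vs [] = vs"
  "run_gates inp vs (g # gs) = run_gates inp (vs @ [gval inp vs g]) gs"
  "run_gates inp vs (gs @ hs) = run_gates inp (run_gates inp vs gs) hs"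
  by (simp_all add: run_gates_def)

text \<open>A reference \<open>(r, k)\<close> stands for the index \<open>v r + k\<close>, where \<open>v r\<close> irs the content of
  register \<open>r\<close> when the gate is printed.\<close>

type_synonym sref = "nat \<times> nat"

datatype sgate = SInp sref | SConst bool | SNot sref | SAnd sref sref | SOr sref sref

definition idx :: "(nat \<Rightarrow> nat) \<Rightarrow> sref \<Rightarrow> nat" where
  "idx v r = v (fst r) + snd r"

fun inst :: "(nat \<Rightarrow> nat) \<Rightarrow> sgate \<Rightarrow> gate" where
  "inst v (SInp r) = Inp (idx v r)"
| "inst v (SConst b) = Const b"
| "inst v (SNot r) = NotG (idx v r)"
| "inst v (SAnd r s) = AndG (idx v r) (idx v s)"
| "inst v (SOr r s) = OrG (idx v r) (idx v s)"

fun sregs :: "sgate \<Rightarrow> nat set" where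
  "sregs (SInp r) = {fst r}"
| "sregs (SConst b) = {}"
| "sregs (SNot r) = {fst r}"
| "sregs (SAnd r s) = {fst r, fst s}"
| "sregs (SOr r s) = {fst r, fst s}"

lemma inst_cong: "(\<And>r. r \<in> sregs g \<Longrightarrow> v r = v' r) \<Longrightarrow> inst v g = inst v' g"
  by (cases g) (auto simp: idx_def)

text \<open>\<open>cur\<close> holds the number of the first gate of the current block,
  \<open>k\<close> gates of which are already there. A gate of the same block is thus addressed as
  \<open>(cur, j)\<close> wherever the block is printed.\<close>

definition appends ::
  "nat \<Rightarrow> sref list \<Rightarrow> nat \<Rightarrow> sgate list \<Rightarrow> (bool list \<Rightarrow> bool list \<Rightarrow> bool) \<Rightarrow> bool" where
  "appends cur rs k G P \<longleftrightarrow> (\<forall>g\<in>set G. sregs g \<subseteq> insert cur (fst ` set rs)) \<and>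
    (\<forall>v inp vs. length vs = v cur + k \<longrightarrow> (\<forall>r\<in>set rs. idx v r < length vs) \<longrightarrow>
      (\<exists>ws. length ws = length G \<and> run_gates inp vs (map (inst v) G) = vs @ ws \<and>
        P (map (\<lambda>r. vs ! idx v r) rs) ws))"

lemma appendsD:
  assumes "appends cur rs k G P" "length vs = v cur + k" "\<forall>r\<in>set rs. idx v r < length vs"
  obtains ws where "length ws = length G" "run_gates inp vs (map (inst v) G) = vs @ ws"
    "P (map (\<lambda>r. vs ! idx v r) rs) ws"
  using assms unfolding appends_def by blast

lemma appends_regs: "appends cur rs k G P \<Longrightarrow> \<forall>g\<in>set G. sregs g \<subseteq> insert cur (fst ` set rs)"
  by (simp add: appends_def)

lemma appendsI:
  assumes "\<forall>g\<in>set G. sregs g \<subseteq> insert cur (fst ` set rs)"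
    and "\<And>v inp vs. length vs = v cur + k \<Longrightarrow> \<forall>r\<in>set rs. idx v r < length vs \<Longrightarrow>
      \<exists>ws. length ws = length G \<and> run_gates inp vs (map (inst v) G) = vs @ ws \<and>
        P (map (\<lambda>r. vs ! idx v r) rs) ws"
  shows "appends cur rs k G P"
  using assms unfolding appends_def by blast

lemma old_vals:
  "\<forall>r\<in>set rs. idx v r < length vs \<Longrightarrow> map (\<lambda>r. (vs @ ws) ! idx v r) rs = map (\<lambda>r. vs ! idx v r) rs"
  by (auto simp: nth_append)

text \<open>Shannon expansion: the value of the first reference selects between the circuits of the
  two cofactors, which have one argument less.\<close>

lemma segment_for_function:
  fixes F :: "bool list \<Rightarrow> bool"
  shows "\<exists>G. G \<noteq> [] \<and> appends cur rs k G (\<lambda>bs ws. last ws = F bs)"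
proof (induction rs arbitrary: F k)
  case Nil
  show ?case by (intro exI[of _ "[SConst (F [])]"]) (simp add: appends_def)
next
  case (Cons r rs)
  obtain G1 where G1: "G1 \<noteq> []" "appends cur rs k G1 (\<lambda>bs ws. last ws = F (True # bs))"
    using Cons.IH[of k "\<lambda>bs. F (True # bs)"] by blast
  let ?k0 = "k + length G1"
  obtain G0 where G0: "G0 \<noteq> []" "appends cur rs ?k0 G0 (\<lambda>bs ws. last ws = F (False # bs))"
    using Cons.IH[of ?k0 "\<lambda>bs. F (False # bs)"] by blast
  \<comment> \<open>The four gates at the end of \<open>?G\<close> form a multiplexer. Gates
    \<open>?k0 - 1\<close> and \<open>?e - 1\<close> of the block are the last gates of
    \<open>G1\<close> and \<open>G0\<close>, which carry the values of the cofactors.\<close>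
  let ?e = "?k0 + length G0"
  let ?G = "G1 @ G0 @ [SNot r, SAnd r (cur, ?k0 - 1), SAnd (cur, ?e) (cur, ?e - 1), SOr (cur, ?e + 1) (cur, ?e + 2)]"
  have "appends cur (r # rs) k ?G (\<lambda>bs ws. last ws = F bs)"
  proof (rule appendsI)
    show "\<forall>g\<in>set ?G. sregs g \<subseteq> insert cur (fst ` set (r # rs))"
      using appends_regs[OF G1(2)] appends_regs[OF G0(2)] by auto
    fix v inp and vs :: "bool list"
    assume len: "length vs = v cur + k" and rrs: "\<forall>r\<in>set (r # rs). idx v r < length vs"
    then have rs: "\<forall>r\<in>set rs. idx v r < length vs" and r: "idx v r < length vs" by simp_all
    obtain w1 where w1: "length w1 = length G1" "run_gates inp vs (map (inst v) G1) = vs @ w1"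
        "last w1 = F (True # map (\<lambda>r. vs ! idx v r) rs)" by (rule appendsD[OF G1(2) len rs])
    have "length (vs @ w1) = v cur + ?k0" "\<forall>r\<in>set rs. idx v r < length (vs @ w1)"
      using len rs w1(1) by auto
    from appendsD[where inp = inp, OF G0(2) this] obtain w0 where w0: "length w0 = length G0"
        "run_gates inp (vs @ w1) (map (inst v) G0) = (vs @ w1) @ w0"
        "last w0 = F (False # map (\<lambda>r. vs ! idx v r) rs)"
      unfolding old_vals[OF rs] .
    define b where "b = vs ! idx v r"
    have ne: "w1 \<noteq> []" "w0 \<noteq> []" using w1(1) w0(1) G1(1) G0(1) by auto
    have l1: "last w1 = w1 ! (length G1 - 1)" "last w0 = w0 ! (length G0 - 1)"
      using ne w1(1) w0(1) by (simp_all add: last_conv_nth)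
    have pos: "length G1 > 0" "length G0 > 0" using G1(1) G0(1) by auto
    have i: "idx v (cur, ?k0 - 1) = length vs + (length G1 - 1)"
      "idx v (cur, ?e - 1) = length vs + length w1 + (length G0 - 1)"
      "idx v (cur, ?e) = length vs + length w1 + length w0"
      "idx v (cur, ?e + 1) = length vs + length w1 + length w0 + 1"
      "idx v (cur, ?e + 2) = length vs + length w1 + length w0 + 2"
      using len w1(1) w0(1) pos unfolding idx_def fst_conv snd_conv by linarith+
    obtain g1 g0 where g: "length G1 = Suc g1" "length G0 = Suc g0"
      using pos by (metis Suc_pred)
    have refs: "ref (vs @ w1 @ w0 @ us) (idx v r) = b"
      "ref (vs @ w1 @ w0 @ us) (idx v (cur, ?k0 - 1)) = last w1"
      "ref (vs @ w1 @ w0 @ us) (idx v (cur, ?e - 1)) = last w0"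
      "ref (vs @ w1 @ w0 @ c # us) (idx v (cur, ?e)) = c"
      "ref (vs @ w1 @ w0 @ c # d # us) (idx v (cur, ?e + 1)) = d"
      "ref (vs @ w1 @ w0 @ c # d # e # us) (idx v (cur, ?e + 2)) = e" for us c d e
      unfolding i l1 using g r w1(1) w0(1) by (simp_all add: ref_def nth_append b_def)
    let ?new = "[\<not> b, b \<and> last w1, \<not> b \<and> last w0, b \<and> last w1 \<or> \<not> b \<and> last w0]"
    have "run_gates inp vs (map (inst v) ?G) = vs @ (w1 @ w0 @ ?new)"
      by (simp only: map_append list.map inst.simps run_gates_simps w1(2) w0(2) gval.simps
          append_assoc append.simps refs refs(1-3)[of "[]", unfolded append_Nil2])
    moreover have "(b \<and> last w1 \<or> \<not> b \<and> last w0) = F (map (\<lambda>r. vs ! idx v r) (r # rs))"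
      by (cases b) (simp_all add: w1(3) w0(3) flip: b_def)
    ultimately show "\<exists>ws. length ws = length ?G \<and> run_gates inp vs (map (inst v) ?G) = vs @ ws \<and>
        last ws = F (map (\<lambda>r. vs ! idx v r) (r # rs))"
      using w1(1) w0(1) by (intro exI[of _ "w1 @ w0 @ ?new"]) auto
  qed
  then show ?case by (intro exI[of _ ?G]) simp
qed

lemma segment_for_functions:
  fixes F :: "bool list \<Rightarrow> bool list"
  shows "\<exists>G ps. length ps = n \<and> (\<forall>p\<in>set ps. p < length G) \<and>
    appends cur rs k G (\<lambda>bs ws. \<forall>j<n. ws ! (ps ! j) = F bs ! j)"
proof (induction n)
  case 0
  show ?case by (intro exI[of _ "[]"]) (simp add: appends_def)
next
  case (Suc n)
  then obtain G ps where G: "length ps = n" "\<forall>p\<in>set ps. p < length G"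
    "appends cur rs k G (\<lambda>bs ws. \<forall>j<n. ws ! (ps ! j) = F bs ! j)" by blast
  obtain H where H: "H \<noteq> []" "appends cur rs (k + length G) H (\<lambda>bs ws. last ws = F bs ! n)"
    using segment_for_function[of cur rs "k + length G" "\<lambda>bs. F bs ! n"] by blast
  let ?ps = "ps @ [length G + (length H - 1)]"
  have "appends cur rs k (G @ H) (\<lambda>bs ws. \<forall>j<Suc n. ws ! (?ps ! j) = F bs ! j)"
  proof (rule appendsI)
    show "\<forall>g\<in>set (G @ H). sregs g \<subseteq> insert cur (fst ` set rs)"
      using appends_regs[OF G(3)] appends_regs[OF H(2)] by auto
    fix v inp and vs :: "bool list"
    assume len: "length vs = v cur + k" and rs: "\<forall>r\<in>set rs. idx v r < length vs"
    obtain ws where ws: "length ws = length G" "run_gates inp vs (map (inst v) G) = vs @ ws"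
        "\<forall>j<n. ws ! (ps ! j) = F (map (\<lambda>r. vs ! idx v r) rs) ! j" by (rule appendsD[OF G(3) len rs])
    have "length (vs @ ws) = v cur + (k + length G)" "\<forall>r\<in>set rs. idx v r < length (vs @ ws)"
      using len rs ws(1) by auto
    from appendsD[where inp = inp, OF H(2) this] obtain us where us: "length us = length H"
        "run_gates inp (vs @ ws) (map (inst v) H) = (vs @ ws) @ us"
        "last us = F (map (\<lambda>r. vs ! idx v r) rs) ! n"
      unfolding old_vals[OF rs] .
    have "us \<noteq> []" using us(1) H(1) by auto
    then have "us ! (length H - 1) = last us" using us(1) by (simp add: last_conv_nth)
    moreover have "ps ! j < length G" if "j < n" for j using that G(1,2) by simp
    ultimately have "\<forall>j<Suc n. (ws @ us) ! (?ps ! j) = F (map (\<lambda>r. vs ! idx v r) rs) ! j"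
      using ws us G(1) by (auto simp: less_Suc_eq nth_append)
    then show "\<exists>ws. length ws = length (G @ H) \<and> run_gates inp vs (map (inst v) (G @ H)) = vs @ ws \<and>
        (\<forall>j<Suc n. ws ! (?ps ! j) = F (map (\<lambda>r. vs ! idx v r) rs) ! j)"
      using ws us by (intro exI[of _ "ws @ us"]) simp
  qed
  moreover have "length ?ps = Suc n" "\<forall>p\<in>set ?ps. p < length (G @ H)" using G(1,2) H(1) by auto
  ultimately show ?case by blast
qed

text \<open>A self-contained block: it reads the input bits \<open>irs\<close> and the earlier gates
  \<open>rs\<close>, and delivers its result in its last \<open>B\<close> gates, where later blocks
  find it at a fixed offset.\<close>

definition computes ::
  "nat \<Rightarrow> sref list \<Rightarrow> sref list \<Rightarrow> nat \<Rightarrow> (bool list \<Rightarrow> bool list) \<Rightarrow> sgate list \<Rightarrow> bool" where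
  "computes cur irs rs B F G \<longleftrightarrow> (\<forall>g\<in>set G. sregs g \<subseteq> insert cur (fst ` (set irs \<union> set rs))) \<and>
    (\<forall>v inp vs. length vs = v cur \<longrightarrow> (\<forall>r\<in>set rs. idx v r < length vs) \<longrightarrow>
      (\<exists>ws. length ws = length G \<and> run_gates inp vs (map (inst v) G) = vs @ ws \<and>
        drop (length G - B) ws = F (map (\<lambda>r. ref inp (idx v r)) irs @ map (\<lambda>r. vs ! idx v r) rs)))"

text \<open>Layout of the block: input gates, the circuit, constants as padding, and copies of the
  \<open>B\<close> results, each copy being the conjunction of a gate with itself. The padding
  realises every sufficiently large length, so that different gadgets can be made equally
  long.\<close>

lemma block_for_function:
  assumes B: "\<And>bs. length (F bs) = B"
  shows "\<exists>n0. \<forall>n\<ge>n0. \<exists>G. length G = n \<and> computes cur irs rs B F G"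
proof -
  let ?k = "length irs"
  let ?rs = "map (\<lambda>i. (cur, i)) [0..<?k] @ rs"
  obtain G ps where G: "length ps = B" "\<forall>p\<in>set ps. p < length G"
    "appends cur ?rs ?k G (\<lambda>bs ws. \<forall>j<B. ws ! (ps ! j) = F bs ! j)"
    using segment_for_functions[of B cur ?rs ?k F] by blast
  have inps: "run_gates inp vs (map (inst v) (map SInp irs)) = vs @ map (\<lambda>r. ref inp (idx v r)) irs" for inp vs v "irs"
    by (induction "irs" arbitrary: vs) auto
  have pad: "run_gates inp vs (map (inst v) (replicate d (SConst False))) = vs @ replicate d False" for inp vs v d
    by (induction d arbitrary: vs) (auto simp: replicate_append_same[symmetric])
  have copies: "run_gates inp vs (map (inst v) (map (\<lambda>p. SAnd (cur, ?k + p) (cur, ?k + p)) ps)) =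
      vs @ map (\<lambda>p. vs ! (v cur + ?k + p)) ps"
    if "\<forall>p\<in>set ps. v cur + ?k + p < length vs" for inp vs v ps
    using that
  proof (induction ps arbitrary: vs)
    case (Cons p ps)
    have eq: "map (\<lambda>q. (vs @ [vs ! (v cur + ?k + p)]) ! (v cur + ?k + q)) ps = map (\<lambda>q. vs ! (v cur + ?k + q)) ps"
      using Cons.prems by (auto simp: nth_append)
    have "\<forall>q\<in>set ps. v cur + ?k + q < length (vs @ [vs ! (v cur + ?k + p)])" using Cons.prems by auto
    note IH = Cons.IH[OF this, unfolded eq]
    have "gval inp vs (inst v (SAnd (cur, ?k + p) (cur, ?k + p))) = vs ! (v cur + ?k + p)"
      using Cons.prems by (auto simp: idx_def ref_def add.assoc)
    then show ?case by (simp only: list.map run_gates_simps IH append_assoc append.simps)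
  qed simp
  show ?thesis
  proof (intro exI[of _ "?k + length G + B"] allI impI)
    fix n assume n: "?k + length G + B \<le> n"
    let ?d = "n - (?k + length G + B)"
    let ?H = "map SInp irs @ G @ replicate ?d (SConst False) @ map (\<lambda>p. SAnd (cur, ?k + p) (cur, ?k + p)) ps"
    have "length ?H = n" using n G(1) by simp
    moreover have "computes cur irs rs B F ?H"
      unfolding computes_def
    proof (intro conjI allI impI)
      show "\<forall>g\<in>set ?H. sregs g \<subseteq> insert cur (fst ` (set irs \<union> set rs))"
      proof
        fix g assume "g \<in> set ?H"
        then consider "g \<in> set G" | "g \<in> SInp ` set irs" | "g = SConst False"
          | p where "g = SAnd (cur, ?k + p) (cur, ?k + p)" by auto
        then show "sregs g \<subseteq> insert cur (fst ` (set irs \<union> set rs))"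
        proof cases
          case 1
          then have "sregs g \<subseteq> insert cur (fst ` set ?rs)" using appends_regs[OF G(3)] by blast
          also have "\<dots> \<subseteq> insert cur (fst ` (set irs \<union> set rs))" by auto
          finally show ?thesis .
        next
          case 2
          then show ?thesis by force
        qed auto
      qed
      fix v inp and vs :: "bool list" assume len: "length vs = v cur" and rs: "\<forall>r\<in>set rs. idx v r < length vs"
      let ?i = "map (\<lambda>r. ref inp (idx v r)) irs"
      have "map (\<lambda>r. (vs @ ?i) ! idx v r) (map (\<lambda>i. (cur, i)) [0..<?k]) = ?i"
        using len by (intro nth_equalityI) (auto simp: idx_def nth_append)
      then have eq: "map (\<lambda>r. (vs @ ?i) ! idx v r) ?rs = ?i @ map (\<lambda>r. vs ! idx v r) rs"
        unfolding map_append old_vals[OF rs] by (rule arg_cong)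
      have "length (vs @ ?i) = v cur + ?k" "\<forall>r\<in>set ?rs. idx v r < length (vs @ ?i)"
        using rs len by (auto simp: idx_def)
      from appendsD[where inp = inp, OF G(3) this] obtain ws where ws: "length ws = length G"
        "run_gates inp (vs @ ?i) (map (inst v) G) = (vs @ ?i) @ ws"
        "\<forall>j<B. ws ! (ps ! j) = F (?i @ map (\<lambda>r. vs ! idx v r) rs) ! j"
        unfolding eq .
      let ?vs = "((vs @ ?i) @ ws) @ replicate ?d False"
      have lt: "\<forall>p\<in>set ps. v cur + ?k + p < length ?vs" using G(2) len ws(1) by auto
      have "map (\<lambda>p. ?vs ! (v cur + ?k + p)) ps = map (\<lambda>p. ws ! p) ps"
        using G(2) len ws(1) by (auto simp: nth_append)
      also have "\<dots> = F (?i @ map (\<lambda>r. vs ! idx v r) rs)"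
        using ws(3) G(1) B by (intro nth_equalityI) auto
      finally have out: "map (\<lambda>p. ?vs ! (v cur + ?k + p)) ps = F (?i @ map (\<lambda>r. vs ! idx v r) rs)" .
      have "run_gates inp vs (map (inst v) ?H) = vs @ (?i @ ws @ replicate ?d False @ F (?i @ map (\<lambda>r. vs ! idx v r) rs))"
        unfolding map_append run_gates_simps inps ws(2) pad copies[where ps = ps and v = v and vs = ?vs, OF lt, unfolded out] by simp
      then show "\<exists>ws. length ws = length ?H \<and> run_gates inp vs (map (inst v) ?H) = vs @ ws \<and>
        drop (length ?H - B) ws = F (?i @ map (\<lambda>r. vs ! idx v r) rs)"
        using ws(1) G(1) B
        by (intro exI[of _ "?i @ ws @ replicate ?d False @ F (?i @ map (\<lambda>r. vs ! idx v r) rs)"]) simp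
    qed
    ultimately show "\<exists>G. length G = n \<and> computes cur irs rs B F G" by blast
  qed
qed

section \<open>Circuits composed of blocks of equal length\<close>

fun blocks :: "(nat \<Rightarrow> 'd \<Rightarrow> circuit) \<Rightarrow> nat \<Rightarrow> 'd list \<Rightarrow> circuit" where
  "blocks f i [] = []"
| "blocks f i (d # ds) = f i d @ blocks f (Suc i) ds"

lemma blocks_append [simp]: "blocks f i (ds @ es) = blocks f i ds @ blocks f (i + length ds) es"
  by (induction ds arbitrary: i) auto

lemma length_blocks: "(\<And>i d. length (f i d) = n) \<Longrightarrow> length (blocks f i ds) = n * length ds"
  by (induction ds arbitrary: i) auto

definition slice :: "nat \<Rightarrow> nat \<Rightarrow> bool list \<Rightarrow> nat \<Rightarrow> bool list" where
  "slice n B vs i = take B (drop (i * n + (n - B)) vs)"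

lemma run_blocks:
  assumes "B \<le> n" and bits: "\<And>i. length (bits i) = B"
    and step: "\<And>k vs. k < length ds \<Longrightarrow> length vs = k * n \<Longrightarrow> (\<And>i. i < k \<Longrightarrow> slice n B vs i = bits i) \<Longrightarrow>
      \<exists>ws. run_gates inp vs (f k (ds ! k)) = vs @ ws \<and> length ws = n \<and> drop (n - B) ws = bits k"
  shows "k \<le> length ds \<Longrightarrow> length (run_gates inp [] (blocks f 0 (take k ds))) = k * n \<and>
    (\<forall>i<k. slice n B (run_gates inp [] (blocks f 0 (take k ds))) i = bits i)"
proof (induction k)
  case (Suc k)
  let ?vs = "run_gates inp [] (blocks f 0 (take k ds))"
  have IH: "length ?vs = k * n" "\<And>i. i < k \<Longrightarrow> slice n B ?vs i = bits i" using Suc by auto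
  then obtain ws where ws: "run_gates inp ?vs (f k (ds ! k)) = ?vs @ ws" "length ws = n" "drop (n - B) ws = bits k"
    using step[of k ?vs] Suc.prems by auto
  have t: "run_gates inp [] (blocks f 0 (take (Suc k) ds)) = ?vs @ ws"
    using Suc.prems ws(1) by (simp add: take_Suc_conv_app_nth min_absorb2)
  have "slice n B (?vs @ ws) i = bits i" if i: "i < Suc k" for i
  proof (cases "i = k")
    case True
    then show ?thesis using IH(1) ws(2,3) assms(1) bits[of k] by (simp add: slice_def)
  next
    case False
    then have "Suc i \<le> k" using i by simp
    then have "Suc i * n \<le> k * n" by (rule mult_le_mono1)
    then have "i * n + (n - B) + B \<le> length ?vs" using IH(1) assms(1) by simp
    then have "slice n B (?vs @ ws) i = slice n B ?vs i" by (simp add: slice_def)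
    then show ?thesis using IH(2) i False by simp
  qed
  then show ?case unfolding t using IH(1) ws(2) by simp
qed simp

text \<open>The output of a circuit is its last gate, hence the last bit that the last block
  delivers.\<close>

lemma circ_out_blocks:
  assumes "0 < B" "B \<le> n" and bits: "\<And>i. length (bits i) = B" and ne: "ds \<noteq> []"
    and step: "\<And>k vs. k < length ds \<Longrightarrow> length vs = k * n \<Longrightarrow> (\<And>i. i < k \<Longrightarrow> slice n B vs i = bits i) \<Longrightarrow>
      \<exists>ws. run_gates inp vs (f k (ds ! k)) = vs @ ws \<and> length ws = n \<and> drop (n - B) ws = bits k"
  shows "circ_out (blocks f 0 ds) inp = last (bits (length ds - 1))"
proof -
  let ?vs = "run_gates inp [] (blocks f 0 ds)"
  let ?k = "length ds - 1"
  have "length (run_gates inp [] (blocks f 0 (take (length ds) ds))) = length ds * n \<and>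
      (\<forall>i<length ds. slice n B (run_gates inp [] (blocks f 0 (take (length ds) ds))) i = bits i)"
    by (rule run_blocks[where B = B and n = n and bits = bits and ds = ds and f = f and inp = inp and
        k = "length ds", OF assms(2) bits step]) simp_all
  moreover have "?k < length ds" using ne by simp
  ultimately have *: "length ?vs = length ds * n" "slice n B ?vs ?k = bits ?k" by simp_all
  have "?k * n + n = length ds * n" using ne by (cases ds) auto
  then have e: "?k * n + (n - B) + B = length ?vs" using *(1) assms(2) by simp
  then have "bits ?k = drop (?k * n + (n - B)) ?vs" using *(2) by (simp add: slice_def)
  moreover have "?k * n + (n - B) < length ?vs" using e assms(1) by simp
  ultimately have "last (bits ?k) = last ?vs" by simp
  moreover have "blocks f 0 ds \<noteq> []" using *(1) ne assms(1,2) by auto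
  ultimately show ?thesis by (simp add: circ_out_def eval_gates_def run_gates_def)
qed

section \<open>Turing machine runs as a cellular automaton on a helix\<close>

datatype hcell = Wall | WallL | HC "nat option" nat

text \<open>\<open>WallL\<close> is the left wall of the initial row; it launches the head in the cell next to it.\<close>

definition from_left :: "(nat \<Rightarrow> nat \<Rightarrow> nat \<times> nat \<times> nat) \<Rightarrow> hcell \<Rightarrow> nat option" where
  "from_left \<delta> c = (case c of WallL \<Rightarrow> Some 0 | Wall \<Rightarrow> None | HC None s \<Rightarrow> None
     | HC (Some q) s \<Rightarrow> if q \<noteq> 1 \<and> snd (snd (\<delta> q s)) \<noteq> 0 \<and> snd (snd (\<delta> q s)) \<noteq> 1
         then Some (fst (\<delta> q s)) else None)"

definition from_right :: "(nat \<Rightarrow> nat \<Rightarrow> nat \<times> nat \<times> nat) \<Rightarrow> hcell \<Rightarrow> nat option" where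
  "from_right \<delta> c = (case c of WallL \<Rightarrow> None | Wall \<Rightarrow> None | HC None s \<Rightarrow> None
     | HC (Some q) s \<Rightarrow> if q \<noteq> 1 \<and> snd (snd (\<delta> q s)) = 0 then Some (fst (\<delta> q s)) else None)"

text \<open>A move to the left at the wall leaves the head in place, as in \<open>tm_step\<close>.
  Walls reproduce themselves, so the rule is the same all along the helix.\<close>

definition rule :: "(nat \<Rightarrow> nat \<Rightarrow> nat \<times> nat \<times> nat) \<Rightarrow> hcell \<Rightarrow> hcell \<Rightarrow> hcell \<Rightarrow> hcell" where
  "rule \<delta> a b c = (case b of WallL \<Rightarrow> Wall | Wall \<Rightarrow> Wall
     | HC None s \<Rightarrow> HC (case from_left \<delta> a of Some q \<Rightarrow> Some q | None \<Rightarrow> from_right \<delta> c) s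
     | HC (Some q) s \<Rightarrow> if q = 1 then b else
         (case \<delta> q s of (q', s', m) \<Rightarrow>
           HC (if m = 1 \<or> m = 0 \<and> a \<in> {Wall, WallL} then Some q' else None) s'))"

definition tape_at :: "nat list \<Rightarrow> nat list \<Rightarrow> nat \<Rightarrow> nat" where
  "tape_at l r j = (if j < length (rev l @ r) then (rev l @ r) ! j else 0)"

definition conf_cell :: "config \<Rightarrow> nat \<Rightarrow> hcell" where
  "conf_cell c j = (case c of (q, l, r) \<Rightarrow> HC (if j = length l then Some q else None) (tape_at l r j))"

lemma tape_at_write: "tape_at l (s # tl r) j = (if j = length l then s else tape_at l r j)"
proof (cases r)
  case Nil
  then show ?thesis by (auto simp: tape_at_def nth_append)
next
  case (Cons a r')
  then show ?thesis
    by (auto simp: tape_at_def nth_append nth_Cons split: nat.splits)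
qed

lemma tape_at_shift: "tape_at (a # l) r = tape_at l (a # r)"
  by (simp add: tape_at_def fun_eq_iff)

lemma tape_at_head: "tape_at l r (length l) = (case r of [] \<Rightarrow> 0 | a # _ \<Rightarrow> a)"
  by (auto simp: tape_at_def nth_append split: list.splits)

lemma tm_step_cells:
  assumes "q \<noteq> 1" "\<delta> q (tape_at l r (length l)) = (q', s', m)"
  obtains l' r' where "tm_step (Q, S, \<delta>) (q, l, r) = (q', l', r')"
    "length l' = (if m = 0 then length l - 1 else if m = 1 then length l else Suc (length l))"
    "\<And>j. tape_at l' r' j = (if j = length l then s' else tape_at l r j)"
proof -
  have w: "tape_at (s' # l) (tl r) j = (if j = length l then s' else tape_at l r j)" for j
    unfolding tape_at_shift by (rule tape_at_write)
  have st: "tm_step (Q, S, \<delta>) (q, l, r) =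
      (if m = 0 then (case l of [] \<Rightarrow> (q', [], s' # tl r) | a # l' \<Rightarrow> (q', l', a # s' # tl r))
       else if m = 1 then (q', l, s' # tl r) else (q', s' # l, tl r))"
    using assms by (simp add: tm_step_def tape_at_head Let_def)
  show ?thesis
  proof (cases "m = 0 \<and> l \<noteq> []")
    case True
    then obtain a k where k: "l = a # k" by (cases l) auto
    show ?thesis
      by (rule that[of k "a # s' # tl r"])
        (use st True k tape_at_write[of l s' r] tape_at_shift[of a k "s' # tl r"] in simp_all)
  next
    case False
    show ?thesis
      by (rule that[of "if m = 0 \<or> m = 1 then l else s' # l" "if m = 0 \<or> m = 1 then s' # tl r else tl r"])
        (use st False w tape_at_write[of l s' r] in auto)
  qed
qed

text \<open>The right neighbour may be a wall in place of a tape cell that does not carry the head,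
  since no head could arrive from there.\<close>

lemma rule_conf:
  assumes R: "c = conf_cell (q, l, r) (Suc j) \<or> c = Wall \<and> length l \<noteq> Suc j"
    and A: "a = (if j = 0 then Wall else conf_cell (q, l, r) (j - 1))"
  shows "rule \<delta> a (conf_cell (q, l, r) j) c = conf_cell (tm_step (Q, S, \<delta>) (q, l, r)) j"
proof (cases "q = 1")
  case True
  have "from_left \<delta> a = None" "from_right \<delta> c = None"
    using True R A by (auto simp: from_left_def from_right_def conf_cell_def split: option.splits)
  then show ?thesis using True by (simp add: rule_def conf_cell_def tm_step_def)
next
  case False
  obtain q' s' m where d: "\<delta> q (tape_at l r (length l)) = (q', s', m)" using prod_cases3 by blast
  obtain l' r' where st: "tm_step (Q, S, \<delta>) (q, l, r) = (q', l', r')"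
    "length l' = (if m = 0 then length l - 1 else if m = 1 then length l else Suc (length l))"
    "\<And>j. tape_at l' r' j = (if j = length l then s' else tape_at l r j)"
    using tm_step_cells[of q \<delta> l r q' s' m Q S, OF False d] by metis
  have fl: "from_left \<delta> a = (if j = Suc (length l) \<and> m \<noteq> 0 \<and> m \<noteq> 1 then Some q' else None)"
    using A False d by (auto simp: from_left_def conf_cell_def)
  have fr: "from_right \<delta> c = (if length l = Suc j \<and> m = 0 then Some q' else None)"
    using R False d by (auto simp: from_right_def conf_cell_def)
  show ?thesis
  proof (cases "j = length l")
    case True
    have "a \<in> {Wall, WallL} \<longleftrightarrow> j = 0" using A by (auto simp: conf_cell_def)
    then have "m = 1 \<or> m = 0 \<and> a \<in> {Wall, WallL} \<longleftrightarrow> j = length l'"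
      using st(2) True by (cases l) auto
    then show ?thesis using True False d st(1,3) by (simp add: rule_def conf_cell_def)
  next
    case F: False
    then show ?thesis using fl fr st by (auto simp: rule_def conf_cell_def)
  qed
qed

text \<open>The output is exactly \<open>[True]\<close>: the halted head reads symbol 2, and the
  symbol to its right is not a bit.\<close>

definition accepts :: "hcell \<Rightarrow> hcell \<Rightarrow> bool" where
  "accepts b c \<longleftrightarrow> (\<exists>h s. b = HC (Some 1) 2 \<and> c = HC h s \<and> s \<noteq> 1 \<and> s \<noteq> 2)"

lemma tm_output_eq_True:
  "tm_output (q, l, r) = [True] \<longleftrightarrow>
     tape_at l r (length l) = 2 \<and> tape_at l r (Suc (length l)) \<notin> {1, 2}"
proof -
  have "tape_at l r (Suc (length l)) = (case r of _ # b # _ \<Rightarrow> b | _ \<Rightarrow> 0)"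
    by (auto simp: tape_at_def nth_append split: list.splits)
  then show ?thesis
    by (auto simp: tm_output_def tape_at_head split: list.splits)
qed

definition hcells :: "nat \<Rightarrow> nat \<Rightarrow> hcell set" where
  "hcells Q S = {Wall, WallL} \<union> (\<lambda>(h, s). HC h s) ` (insert None (Some ` {..<Q}) \<times> {..<S})"

lemma finite_hcells: "finite (hcells Q S)"
  by (simp add: hcells_def)

lemma HC_in_hcells: "HC h s \<in> hcells Q S \<longleftrightarrow> (h = None \<or> (\<exists>q<Q. h = Some q)) \<and> s < S"
  by (auto simp: hcells_def image_iff)

text \<open>A row has one wall and more than \<open>T\<close> tape cells, so the head cannot leave
  it within \<open>T\<close> steps; \<open>N\<close> steps suffice to inspect the row of the
  configuration at time \<open>T\<close>.\<close>

locale helix =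
  fixes Q S \<delta> and z :: "bool list" and T W N :: nat
  assumes wf: "wf_tm (Q, S, \<delta>)"
    and halts: "fst (tm_run (Q, S, \<delta>) T (init_config z)) = 1"
    and W: "T + 3 < W" and N: "(T + 3) * W = N"
begin

abbreviation conf :: "nat \<Rightarrow> config" where
  "conf t \<equiv> tm_run (Q, S, \<delta>) t (init_config z)"

definition initc :: "nat \<Rightarrow> hcell" where
  "initc i = (if i = 0 then WallL else HC None (tape_at [] (map sym_of_bit z) (i - 1)))"

text \<open>Row 0 is the tape without a head, which appears in row 1 only; so row
  \<open>t + 1\<close> holds the configuration after \<open>t\<close> steps. With this delay the
  initial tape cells depend on their symbols alone.\<close>

definition hx :: "nat \<Rightarrow> hcell" where
  "hx i = (if i < W then initc i else if i mod W = 0 then Wall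
     else conf_cell (conf (i div W - 1)) (i mod W - 1))"

lemma conf_Suc: "conf (Suc t) = tm_step (Q, S, \<delta>) (conf t)"
  by (simp add: tm_run_def)

lemma conf_stays: "fst (conf s) = 1 \<Longrightarrow> conf (s + k) = conf s"
proof (induction k)
  case (Suc k)
  then show ?case using conf_Suc[of "s + k"]
    by (cases "conf s") (auto simp: tm_step_def)
qed simp

lemma conf_halted: "fst (conf s) = 1 \<Longrightarrow> conf s = conf T"
  using conf_stays[of s "T - s"] conf_stays[of T "s - T"] halts by (cases "s \<le> T") auto

lemma length_step: "length (fst (snd (tm_step M c))) \<le> Suc (length (fst (snd c)))"
  by (cases c; cases M) (auto simp: tm_step_def Let_def split: prod.splits list.splits)

lemma head_bound: "length (fst (snd (conf s))) \<le> T"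
proof -
  have *: "length (fst (snd (conf s))) \<le> s" for s
  proof (induction s)
    case 0
    then show ?case by (simp add: tm_run_def init_config_def)
  next
    case (Suc s)
    then show ?case using length_step[of "(Q, S, \<delta>)" "conf s"] unfolding conf_Suc by simp
  qed
  show ?thesis
  proof (cases "s \<le> T")
    case True
    then show ?thesis using * le_trans by blast
  next
    case False
    then have "conf s = conf T" using conf_stays[OF halts, of "s - T"] by simp
    then show ?thesis using * by simp
  qed
qed

lemma hx_row: "p < W \<Longrightarrow> hx (Suc t * W + p) = (if p = 0 then Wall else conf_cell (conf t) (p - 1))"
proof -
  assume p: "p < W"
  define i where "i = Suc t * W + p"
  have "i div W = Suc t" unfolding i_def using p by (subst div_mult_self3) auto
  moreover have "i mod W = p" unfolding i_def using p by (subst mod_mult_self3) auto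
  moreover have "\<not> i < W" by (simp add: i_def)
  ultimately show ?thesis unfolding i_def[symmetric] by (simp add: hx_def)
qed

text \<open>For the last cell of a row the right parent is the wall of its own row, which is
  harmless because the head never gets that far; a wall does not react to its neighbours. Cell
  \<open>W\<close> would have a left parent with a negative number, so the rule starts at
  \<open>W + 1\<close>.\<close>

lemma hx_step:
  assumes "W < i"
  shows "hx i = rule \<delta> (hx (i - W - 1)) (hx (i - W)) (hx (i - W + 1))"
proof -
  define t where "t = i div W - 1"
  define p where "p = i mod W"
  have Wpos: "0 < W" using W by simp
  have "i div W \<ge> 1" using assms Wpos by (simp add: div_greater_zero_iff Suc_le_eq)
  then have "i div W = Suc t" by (simp add: t_def)
  then have i: "i = Suc t * W + p" by (metis p_def div_mult_mod_eq)
  have p: "p < W" using Wpos by (simp add: p_def)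
  have i1: "i - W = t * W + p" using i by simp
  show ?thesis
  proof (cases "p = 0")
    case True
    then obtain t' where t': "t = Suc t'" using i assms by (cases t) auto
    have "hx (i - W) = Wall" using hx_row[of 0 t'] Wpos unfolding i1 t' True by simp
    then show ?thesis using hx_row[of p t] p True by (simp add: rule_def i)
  next
    case False
    have i0: "i - W - 1 = t * W + (p - 1)" using i1 False by simp
    have i2: "i - W + 1 = t * W + Suc p" using i1 by simp
    have hi: "hx i = conf_cell (conf t) (p - 1)" using hx_row[OF p, of t] False i by simp
    show ?thesis
    proof (cases t)
      case 0
      have a: "hx (i - W - 1) = initc (p - 1)" "hx (i - W) = initc p"
        using p less_imp_diff_less[OF p, of 1] unfolding i0 i1 0 by (simp_all add: hx_def)
      have "from_right \<delta> (hx (i - W + 1)) = None"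
      proof (cases "Suc p < W")
        case True
        then show ?thesis unfolding i2 0 by (simp add: hx_def initc_def from_right_def)
      next
        case F: False
        then have "Suc p = W" using p by simp
        then show ?thesis using hx_row[of 0 0] Wpos unfolding i2 0 by (simp add: from_right_def)
      qed
      moreover have "conf 0 = (0, [], map sym_of_bit z)" by (simp add: tm_run_def init_config_def)
      ultimately show ?thesis using False unfolding hi a 0
        by (auto simp: rule_def initc_def conf_cell_def from_left_def)
    next
      case (Suc t')
      obtain q l r where c: "conf t' = (q, l, r)" using prod_cases3 by blast
      have A: "hx (i - W - 1) = (if p - 1 = 0 then Wall else conf_cell (q, l, r) (p - 1 - 1))"
        unfolding i0 Suc using hx_row[of "p - 1" t'] p c by simp
      have B: "hx (i - W) = conf_cell (q, l, r) (p - 1)"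
        unfolding i1 Suc using hx_row[of p t'] p c False by simp
      have C: "hx (i - W + 1) = conf_cell (q, l, r) (Suc (p - 1)) \<or>
          hx (i - W + 1) = Wall \<and> length l \<noteq> Suc (p - 1)"
      proof (cases "Suc p < W")
        case True
        then show ?thesis unfolding i2 Suc using hx_row[of "Suc p" t'] c False by simp
      next
        case F: False
        then have "Suc p = W" using p by simp
        moreover have "length l \<le> T" using head_bound[of t'] c by simp
        ultimately show ?thesis using hx_row[of 0 "Suc t'"] W Wpos False unfolding i2 Suc
          by (simp add: add.commute)
      qed
      show ?thesis unfolding hi Suc conf_Suc c B by (rule rule_conf[OF C A, symmetric])
    qed
  qed
qed

text \<open>The acceptance flag travels along the helix. Cell \<open>k\<close> checks two of its own
  parents, so the flag only adds a reference to the preceding block.\<close>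

definition hacc :: "nat \<Rightarrow> bool" where
  "hacc i \<longleftrightarrow> (\<exists>k. W < k \<and> k \<le> i \<and> accepts (hx (k - W)) (hx (k - W + 1)))"

lemma hacc_init: "i \<le> W \<Longrightarrow> \<not> hacc i"
  by (auto simp: hacc_def)

lemma hacc_step: "W < i \<Longrightarrow> hacc i \<longleftrightarrow> hacc (i - 1) \<or> accepts (hx (i - W)) (hx (i - W + 1))"
  unfolding hacc_def by (cases i) (auto simp: le_Suc_eq)

text \<open>An accepting pair contains a halted head, so it belongs to a halted configuration, and
  all of these equal the one at time \<open>T\<close>. Conversely, that configuration is found in
  row \<open>T + 1\<close>.\<close>

lemma hacc_iff: "hacc (W + N) \<longleftrightarrow> tm_output (conf T) = [True]"
proof
  have Wpos: "0 < W" using W by simp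
  assume "hacc (W + N)"
  then obtain j where j: "0 < j" "accepts (hx j) (hx (Suc j))"
    unfolding hacc_def by (metis Suc_eq_plus1 zero_less_diff)
  define t where "t = j div W - 1"
  define p where "p = j mod W"
  have "W \<le> j" "p \<noteq> 0"
    using j(2) by (auto simp: hx_def accepts_def p_def initc_def split: if_splits)
  then have "j div W = Suc t" using Wpos by (simp add: t_def div_greater_zero_iff)
  then have jt: "j = Suc t * W + p" by (metis p_def div_mult_mod_eq)
  have p: "p < W" using Wpos by (simp add: p_def)
  have hj: "hx j = conf_cell (conf t) (p - 1)" using hx_row[OF p, of t] \<open>p \<noteq> 0\<close> jt by simp
  obtain q l r where c: "conf t = (q, l, r)" using prod_cases3 by blast
  have q: "q = 1" "length l = p - 1" "tape_at l r (length l) = 2"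
    using j(2) unfolding hj c by (auto simp: accepts_def conf_cell_def split: if_splits)
  have "Suc p < W"
  proof (rule ccontr)
    assume "\<not> Suc p < W"
    then have "Suc j = Suc (Suc t) * W + 0" using p jt by simp
    then have "hx (Suc j) = Wall" using hx_row[of 0 "Suc t"] Wpos by simp
    then show False using j(2) by (simp add: accepts_def)
  qed
  then have "hx (Suc j) = conf_cell (q, l, r) p" using hx_row[of "Suc p" t] jt c by simp
  then have "tape_at l r (Suc (length l)) \<notin> {1, 2}"
    using j(2) q(2) \<open>p \<noteq> 0\<close> by (auto simp: accepts_def conf_cell_def)
  then have "tm_output (conf t) = [True]" using q(3) by (simp add: c tm_output_eq_True)
  then show "tm_output (conf T) = [True]" using conf_halted[of t] q(1) c by simp
next
  assume out: "tm_output (conf T) = [True]"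
  obtain q l r where c: "conf T = (q, l, r)" using prod_cases3 by blast
  have l: "length l \<le> T" using head_bound[of T] c by simp
  let ?p = "Suc (length l)"
  have t: "q = 1" "tape_at l r (length l) = 2" "tape_at l r ?p \<notin> {1, 2}"
    using halts out unfolding c by (simp_all add: tm_output_eq_True)
  define j where "j = Suc T * W + ?p"
  have "hx j = HC (Some 1) 2" using hx_row[of ?p T] W l t c by (simp add: conf_cell_def j_def)
  moreover have "hx (j + 1) = HC None (tape_at l r ?p)"
    using hx_row[of "Suc ?p" T] W l t c by (simp add: conf_cell_def j_def)
  moreover have "j \<le> N" using l W unfolding N[symmetric] by (simp add: algebra_simps j_def)
  moreover have "0 < j" by (simp add: j_def)
  ultimately show "hacc (W + N)" unfolding hacc_def using t(3)
    by (intro exI[of _ "j + W"]) (auto simp: accepts_def)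
qed

lemma conf_wf: "case conf t of (q, l, r) \<Rightarrow> q < Q \<and> set l \<subseteq> {..<S} \<and> set r \<subseteq> {..<S}"
proof (induction t)
  case 0
  then show ?case using wf by (auto simp: tm_run_def init_config_def wf_tm_def sym_of_bit_def)
next
  case (Suc t)
  obtain q l r where c: "conf t = (q, l, r)" using prod_cases3 by blast
  define s where "s = (case r of [] \<Rightarrow> 0 | a # _ \<Rightarrow> a)"
  obtain q' s' m where d: "\<delta> q s = (q', s', m)" using prod_cases3 by blast
  have "s < S" using Suc c wf by (auto simp: s_def wf_tm_def split: list.splits)
  then have "q' < Q" "s' < S" using Suc c wf d by (force simp: wf_tm_def)+
  moreover have "set (tl r) \<subseteq> {..<S}" using Suc c by (cases r) auto
  ultimately show ?case using Suc d unfolding conf_Suc c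
    by (auto simp: tm_step_def Let_def s_def[symmetric] split: list.splits)
qed

lemma tape_at_less: "set l \<subseteq> {..<S} \<Longrightarrow> set r \<subseteq> {..<S} \<Longrightarrow> tape_at l r j < S"
proof -
  assume "set l \<subseteq> {..<S}" "set r \<subseteq> {..<S}"
  then have "\<forall>s\<in>set (rev l @ r). s < S" by auto
  then show ?thesis using wf unfolding tape_at_def by (auto simp: wf_tm_def simp del: set_append)
qed

lemma hx_hcells: "hx i \<in> hcells Q S"
proof -
  have "conf_cell (conf t) j \<in> hcells Q S" for t j
    using conf_wf[of t] tape_at_less by (cases "conf t") (auto simp: conf_cell_def HC_in_hcells)
  moreover have "initc i \<in> hcells Q S"
  proof (cases "i = 0")
    case False
    have "set (map sym_of_bit z) \<subseteq> {..<S}" using wf by (auto simp: sym_of_bit_def wf_tm_def)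
    then show ?thesis using False tape_at_less[of "[]"] by (simp add: initc_def HC_in_hcells)
  qed (simp add: initc_def hcells_def)
  ultimately show ?thesis by (auto simp: hx_def hcells_def)
qed

end

section \<open>The membership circuit and the order circuit\<close>

lemma slice_refs:
  assumes "slice n B vs i = bs" "length bs = B" "B \<le> n" "Suc i * n \<le> length vs"
  shows "map (\<lambda>b. vs ! (i * n + (n - B) + b)) [0..<B] = bs"
proof -
  have "i * n + (n - B) + B \<le> length vs" using assms(3,4) by simp
  then have "map (\<lambda>b. vs ! (i * n + (n - B) + b)) [0..<B] = slice n B vs i"
    by (intro nth_equalityI) (auto simp: slice_def)
  then show ?thesis using assms(1) by simp
qed

lemma computesD:
  assumes "computes cur irs rs B F G" "length vs = v cur" "\<And>r. r \<in> set rs \<Longrightarrow> idx v r < length vs"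
    and "map (\<lambda>r. ref inp (idx v r)) irs @ map (\<lambda>r. vs ! idx v r) rs = bs" "length G = n"
  shows "\<exists>ws. run_gates inp vs (map (inst v) G) = vs @ ws \<and> length ws = n \<and> drop (n - B) ws = F bs"
  using assms unfolding computes_def by blast

abbreviation lsb_val :: "bool list \<Rightarrow> nat" where
  "lsb_val \<equiv> horner_sum of_bool 2"

text \<open>A point is \<open>tag @ b # y\<close> with a 4-bit tag. Tags \<open>0, 1\<close> and \<open>2, 3\<close> form the two
  chains of length \<open>a\<close>, tags \<open>4\<close> and \<open>5\<close> the lower and the upper chain of length \<open>K\<close>, and tags
  \<open>6, 7, 8\<close> the chain of length \<open>3 * K\<close>, where \<open>K\<close> is the number of strings \<open>b # y\<close>.
  Within a tag the points are ordered by \<open>lsb_val\<close>.\<close>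

definition tag_less :: "(nat \<times> nat) set" where
  "tag_less = {(0, 1), (2, 3), (2, 5), (3, 5), (4, 5), (6, 7), (6, 8), (7, 8)}"

text \<open>Tags 0 and 2 contain every rejecting string twice, since \<open>b\<close> is free there;
  fixing \<open>b\<close> leaves \<open>2 ^ m\<close> points for each of the tags 1 and 3.\<close>

definition is_point :: "bool list \<Rightarrow> bool \<Rightarrow> bool \<Rightarrow> bool" where
  "is_point tag b rejected \<longleftrightarrow> (let k = lsb_val tag in
     if k \<in> {0, 2} then rejected else if k \<in> {1, 3} then \<not> b else k \<le> 8)"

definition point_le :: "bool list \<Rightarrow> bool list \<Rightarrow> bool \<Rightarrow> bool" where
  "point_le tag tag' c \<longleftrightarrow> (if tag = tag' then c else (lsb_val tag, lsb_val tag') \<in> tag_less)"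

section \<open>The order circuit\<close>

datatype odesc = OFirst | OBit nat | OLast

text \<open>Register 17 is the first gate of block \<open>i\<close>, 18 the last gate of the block
  before, 6 the offset of the second point; 19 and 20 locate the current digit in the two
  points.\<close>

definition order_vals :: "nat \<Rightarrow> nat \<Rightarrow> nat \<Rightarrow> odesc \<Rightarrow> nat \<Rightarrow> nat" where
  "order_vals n p i d r = (if r = 17 then i * n else if r = 18 then (i - 1) * n + (n - 1)
     else if r = 6 then p else case d of OBit j \<Rightarrow> if r = 19 then j else if r = 20 then p + j else 0 | _ \<Rightarrow> 0)"

definition order_block :: "nat \<Rightarrow> nat \<Rightarrow> (odesc \<Rightarrow> sgate list) \<Rightarrow> nat \<Rightarrow> odesc \<Rightarrow> circuit" where
  "order_block n p seg i d = map (inst (order_vals n p i d)) (seg d)"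

text \<open>Comparison from the least significant digit upward: different digits override the
  verdict on the lower digits, equal digits keep it.\<close>

abbreviation compare_fun :: "bool list \<Rightarrow> bool list" where
  "compare_fun \<equiv> \<lambda>bs. [\<not> bs ! 0 \<and> bs ! 1 \<or> (bs ! 0 \<longleftrightarrow> bs ! 1) \<and> bs ! 2]"

abbreviation le_fun :: "bool list \<Rightarrow> bool list" where
  "le_fun \<equiv> \<lambda>bs. [point_le (take 4 bs) (take 4 (drop 4 bs)) (bs ! 8)]"

text \<open>Register 9 holds 0 and register 6 the length of a point, so these are the two
  tags.\<close>

abbreviation order_refs :: "sref list" where
  "order_refs \<equiv> [(9, 0), (9, 1), (9, 2), (9, 3)] @ [(6, 0), (6, 1), (6, 2), (6, 3)]"

definition order_segments :: "nat \<Rightarrow> sgate list \<Rightarrow> sgate list \<Rightarrow> sgate list \<Rightarrow> bool" where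
  "order_segments n H0 H1 H2 \<longleftrightarrow> length H0 = n \<and> length H1 = n \<and> length H2 = n \<and>
     computes 17 [] [] 1 (\<lambda>_. [True]) H0 \<and>
     computes 17 [(19, 4), (20, 4)] [(18, 0)] 1
       compare_fun H1 \<and>
     computes 17 order_refs [(18, 0)] 1
       le_fun H2"

definition order_descs :: "nat \<Rightarrow> odesc list" where
  "order_descs m = OFirst # map OBit [0..<Suc m] @ [OLast]"

lemma lsb_val_snoc: "lsb_val (xs @ [x]) = lsb_val xs + 2 ^ length xs * of_bool x"
  by (simp add: horner_sum_append)

lemma take4: "4 \<le> length p \<Longrightarrow> take 4 p = [p ! 0, p ! 1, p ! 2, p ! 3]"
  by (intro nth_equalityI) (auto simp: nth_Cons numeral_eq_Suc less_Suc_eq split: nat.splits)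

lemma order_circuit:
  assumes seg: "order_segments n (seg OFirst) (seg (OBit 0)) (seg OLast)" "\<And>j. seg (OBit j) = seg (OBit 0)"
    and n: "1 \<le> n" and p: "length p = 5 + m" "length q = 5 + m"
  shows "circ_out (blocks (order_block n (5 + m) seg) 0 (order_descs m)) (p @ q) =
    point_le (take 4 p) (take 4 q) (lsb_val (drop 4 p) \<le> lsb_val (drop 4 q))"
proof -
  let ?u = "drop 4 p" and ?w = "drop 4 q"
  define c where "c k \<longleftrightarrow> lsb_val (take k ?u) \<le> lsb_val (take k ?w)" for k
  define res where "res = point_le (take 4 p) (take 4 q) (lsb_val ?u \<le> lsb_val ?w)"
  define bits where "bits k = (if k \<le> Suc m then [c k] else [res])" for k
  have c_Suc: "c (Suc k) \<longleftrightarrow> \<not> ?u ! k \<and> ?w ! k \<or> (?u ! k \<longleftrightarrow> ?w ! k) \<and> c k" if "k \<le> m" for k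
  proof -
    have 1: "take (Suc k) ?u = take k ?u @ [?u ! k]" "take (Suc k) ?w = take k ?w @ [?w ! k]"
      using that p by (simp_all add: take_Suc_conv_app_nth)
    have "length (take k ?u) = k" "length (take k ?w) = k" using that p by simp_all
    then have "lsb_val (take k ?u) < 2 ^ k" "lsb_val (take k ?w) < 2 ^ k"
      using horner_sum_of_bool_2_less[of "take k ?u"] horner_sum_of_bool_2_less[of "take k ?w"] by simp_all
    then show ?thesis using that p unfolding c_def 1 lsb_val_snoc by auto
  qed
  have c_end: "c (Suc m) \<longleftrightarrow> lsb_val ?u \<le> lsb_val ?w" using p by (simp add: c_def)
  have "circ_out (blocks (order_block n (5 + m) seg) 0 (order_descs m)) (p @ q) =
      last (bits (length (order_descs m) - 1))"
  proof (rule circ_out_blocks[where B = 1 and n = n])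
    show "0 < (1::nat)" "1 \<le> n" "order_descs m \<noteq> []" using n by (simp_all add: order_descs_def)
    show "length (bits i) = 1" for i by (simp add: bits_def)
    fix k and vs :: "bool list"
    assume k: "k < length (order_descs m)" and len: "length vs = k * n"
      and vs: "\<And>i. i < k \<Longrightarrow> slice n 1 vs i = bits i"
    have prev: "idx (order_vals n (5 + m) k d) (18, 0) < length vs \<and>
        vs ! idx (order_vals n (5 + m) k d) (18, 0) = hd (bits (k - 1))" if "0 < k" for d
    proof -
      have 1: "Suc (k - 1) * n = length vs" using that len by simp
      have one: "map (\<lambda>b. vs ! ((k - 1) * n + (n - 1) + b)) [0..<1] = bits (k - 1)"
        using that 1 vs n by (intro slice_refs) (auto simp: bits_def)
      have "vs ! ((k - 1) * n + (n - 1)) = hd (bits (k - 1))"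
        unfolding one[symmetric] by simp
      moreover have "(k - 1) * n + (n - 1) < length vs" using 1 n by (cases n) auto
      ultimately show ?thesis by (simp add: idx_def order_vals_def)
    qed
    have "k < m + 3" using k by (simp add: order_descs_def)
    then consider "k = 0" | j where "k = Suc j" "j \<le> m" | "k = Suc (Suc m)"
    proof (cases k)
      case (Suc j)
      then show thesis using that(2)[of j] that(3) \<open>k < m + 3\<close> by (cases "j \<le> m") auto
    qed (use that(1) in simp)
    then show "\<exists>ws. run_gates (p @ q) vs (order_block n (5 + m) seg k (order_descs m ! k)) = vs @ ws \<and>
        length ws = n \<and> drop (n - 1) ws = bits k"
    proof cases
      case 1
      then have d: "order_descs m ! k = OFirst" "bits k = [True]"
        by (simp_all add: order_descs_def bits_def c_def)
      show ?thesis unfolding d order_block_def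
        by (rule computesD[where F = "\<lambda>_. [True]" and bs = "[]"])
          (use seg(1) len in \<open>auto simp: order_segments_def order_vals_def\<close>)
    next
      case 2
      then have d: "order_descs m ! k = OBit j" by (simp add: order_descs_def nth_append)
      have b: "bits k = compare_fun [?u ! j, ?w ! j, hd (bits (k - 1))]"
        using 2 c_Suc[of j] by (simp add: bits_def)
      show ?thesis unfolding d order_block_def seg(2)[of j] b
        by (rule computesD[where F = compare_fun])
          (use seg(1) len prev[of "OBit j"] 2 p in
            \<open>auto simp: order_segments_def order_vals_def idx_def ref_def nth_append add.commute[of 4 j]\<close>)
    next
      case 3
      then have d: "order_descs m ! k = OLast" by (simp add: order_descs_def nth_append)
      have b: "bits k = [point_le (take 4 p) (take 4 q) (hd (bits (k - 1)))]"
        using 3 c_end by (simp add: bits_def res_def)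
      have i: "ref (p @ q) i = p ! i" "ref (p @ q) (5 + (m + i)) = q ! i" if "i < 4" for i
        using that p by (simp_all add: ref_def nth_append)
      let ?v = "order_vals n (5 + m) k OLast"
      have "map (\<lambda>r. ref (p @ q) (idx ?v r)) order_refs @
          map (\<lambda>r. vs ! idx ?v r) [(18, 0)] = (take 4 p @ take 4 q) @ [hd (bits (k - 1))]"
        using i[of 0] i[of 1] i[of 2] i[of 3] prev[of OLast] 3 p
        by (simp add: take4 idx_def order_vals_def add.assoc numeral_2_eq_2)
      note cmp = computesD[OF _ _ _ this, where n = n and cur = 17 and B = 1 and G = "seg OLast"]
      show ?thesis unfolding d order_block_def b
        using cmp[where F = le_fun]
          seg(1) len prev[of OLast] 3 p by (auto simp: order_segments_def order_vals_def nth_append)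
    qed
  qed
  then show ?thesis by (simp add: bits_def order_descs_def res_def)
qed


section \<open>The membership circuit\<close>

datatype mdesc = MCell hcell | MInput nat | MStep | MLast

text \<open>Registers 13, 14 and 15 point to the results of the three parents of cell
  \<open>i\<close>, register 12 to those of the block before, which supply the flag.\<close>

definition member_vals :: "nat \<Rightarrow> nat \<Rightarrow> nat \<Rightarrow> nat \<Rightarrow> mdesc \<Rightarrow> nat \<Rightarrow> nat" where
  "member_vals n B W i d r = (if r = 11 then i * n else if r = 12 then (i - 1) * n + (n - B)
     else if r = 13 then (i - W - 1) * n + (n - B) else if r = 14 then (i - W) * n + (n - B)
     else if r = 15 then (i - W + 1) * n + (n - B)
     else if r = 10 then (case d of MInput j \<Rightarrow> j | _ \<Rightarrow> 0) else 0)"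

definition member_block :: "nat \<Rightarrow> nat \<Rightarrow> nat \<Rightarrow> (mdesc \<Rightarrow> sgate list) \<Rightarrow> nat \<Rightarrow> mdesc \<Rightarrow> circuit" where
  "member_block n B W seg i d = map (inst (member_vals n B W i d)) (seg d)"

definition one_hot :: "hcell list \<Rightarrow> hcell \<Rightarrow> bool list" where
  "one_hot cs c = map (\<lambda>d. d = c) cs"

text \<open>Gadgets are obtained for functions on all bit strings, so the decoding has to be
  total.\<close>

definition un_hot :: "hcell list \<Rightarrow> bool list \<Rightarrow> hcell" where
  "un_hot cs bs = (SOME c. c \<in> set cs \<and> one_hot cs c = bs)"

lemma un_hot: "c \<in> set cs \<Longrightarrow> un_hot cs (one_hot cs c) = c"
  unfolding un_hot_def by (rule some_equality) (auto simp: one_hot_def)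

text \<open>The output of a block of the membership circuit: the accumulated acceptance flag, followed
  by the one-hot encoding of a cell.\<close>

definition cell_bits :: "hcell list \<Rightarrow> bool \<Rightarrow> hcell \<Rightarrow> bool list" where
  "cell_bits cs a c = a # one_hot cs c"

abbreviation input_fun :: "hcell list \<Rightarrow> bool list \<Rightarrow> bool list" where
  "input_fun cs \<equiv> \<lambda>bs. cell_bits cs False (HC None (sym_of_bit (bs ! 0)))"

text \<open>Every block delivers \<open>B\<close> bits, so the answer is repeated; its last copy is
  the output gate.\<close>

abbreviation point_fun :: "nat \<Rightarrow> bool list \<Rightarrow> bool list" where
  "point_fun B \<equiv> \<lambda>bs. replicate B (is_point (take 4 bs) (bs ! 4) (\<not> bs ! 5))"

text \<open>The argument consists of four block results of \<open>B\<close> bits each, in the order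
  of \<open>step_refs\<close>: the first supplies the flag, the others the three parent
  cells.\<close>

definition step_fun :: "(nat \<Rightarrow> nat \<Rightarrow> nat \<times> nat \<times> nat) \<Rightarrow> hcell list \<Rightarrow> bool list \<Rightarrow> bool list" where
  "step_fun \<delta> cs bs = (let B = Suc (length cs); cell = (\<lambda>j. un_hot cs (tl (take B (drop (j * B) bs)))) in
     cell_bits cs (hd bs \<or> accepts (cell 2) (cell 3)) (rule \<delta> (cell 1) (cell 2) (cell 3)))"

abbreviation step_refs :: "nat \<Rightarrow> sref list" where
  "step_refs B \<equiv> concat (map (\<lambda>r. map (\<lambda>b. (r, b)) [0..<B]) [12, 13, 14, 15])"

abbreviation point_refs :: "sref list" where
  "point_refs \<equiv> [(9, 0), (9, 1), (9, 2), (9, 3), (9, 4)]"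

text \<open>The offset 5 in the reference of the input blocks skips the tag and \<open>b\<close>,
  which precede the choice bits.\<close>

definition member_segments ::
  "(nat \<Rightarrow> nat \<Rightarrow> nat \<times> nat \<times> nat) \<Rightarrow> hcell list \<Rightarrow> nat \<Rightarrow> hcell set \<Rightarrow> (mdesc \<Rightarrow> sgate list) \<Rightarrow> bool" where
  "member_segments \<delta> cs n C seg \<longleftrightarrow> (let B = Suc (length cs) in
     (\<forall>d. length (seg d) = n) \<and>
     (\<forall>c\<in>C. computes 11 [] [] B (\<lambda>_. cell_bits cs False c) (seg (MCell c))) \<and>
     (\<forall>j. computes 11 [(10, 5)] [] B (input_fun cs) (seg (MInput j))) \<and>
     computes 11 [] (step_refs B) B (step_fun \<delta> cs) (seg MStep) \<and>
     computes 11 point_refs [(12, 0)] B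
       (point_fun B) (seg MLast))"

context helix
begin

lemma member_circuit:
  assumes seg: "member_segments \<delta> cs n C seg" and B: "B = Suc (length cs)" "B \<le> n"
    and cs: "set cs = hcells Q S"
    and init: "length ics = Suc W" "\<And>i. i \<le> W \<Longrightarrow> ics ! i = MCell (hx i) \<and> hx i \<in> C \<or>
       (\<exists>j<m. ics ! i = MInput j \<and> hx i = HC None (sym_of_bit (p ! (5 + j))))"
    and p: "length p = 5 + m"
  shows "circ_out (blocks (member_block n B W seg) 0 (ics @ replicate N MStep @ [MLast])) p =
    is_point (take 4 p) (p ! 4) (tm_output (conf T) \<noteq> [True])"
proof -
  let ?ds = "ics @ replicate N MStep @ [MLast]"
  define res where "res = is_point (take 4 p) (p ! 4) (\<not> hacc (W + N))"
  \<comment> \<open>Block \<open>k\<close> delivers the flag and cell \<open>k\<close> of the helix;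
    the final block, with number \<open>W + N + 1\<close>, delivers the answer.\<close>
  define bits where "bits k = (if k \<le> W + N then cell_bits cs (hacc k) (hx k) else replicate B res)" for k
  have lenb: "length (bits k) = B" for k by (simp add: bits_def B cell_bits_def one_hot_def)
  have "circ_out (blocks (member_block n B W seg) 0 ?ds) p = last (bits (length ?ds - 1))"
  proof (rule circ_out_blocks[where B = B and n = n])
    show "0 < B" "B \<le> n" "?ds \<noteq> []" using B by simp_all
    show "length (bits i) = B" for i by (rule lenb)
    fix k and vs :: "bool list"
    assume k: "k < length ?ds" and len: "length vs = k * n"
      and vs: "\<And>i. i < k \<Longrightarrow> slice n B vs i = bits i"
    have refs: "map (\<lambda>b. vs ! (i * n + (n - B) + b)) [0..<B] = bits i" if "i < k" for i
    proof (rule slice_refs)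
      have "Suc i * n \<le> k * n" using that by (intro mult_le_mono1) simp
      then show "Suc i * n \<le> length vs" using len by simp
    qed (use that vs lenb B(2) in auto)
    have bound: "i * n + (n - B) + b < length vs" if "i < k" "b < B" for i b
    proof -
      have "Suc i * n \<le> k * n" using that by (intro mult_le_mono1) simp
      then show ?thesis using len that(2) B(2) by simp
    qed
    consider "k \<le> W" | "W < k" "k \<le> W + N" | "k = Suc (W + N)"
      using k init(1) by fastforce
    then show "\<exists>ws. run_gates p vs (member_block n B W seg k (?ds ! k)) = vs @ ws \<and>
        length ws = n \<and> drop (n - B) ws = bits k"
    proof cases
      case 1
      then have d: "?ds ! k = ics ! k" using init(1) by (simp add: nth_append)
      have b: "bits k = cell_bits cs False (hx k)" using 1 hacc_init[OF 1] by (simp add: bits_def)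
      from init(2)[OF 1] consider "ics ! k = MCell (hx k)" "hx k \<in> C"
        | j where "j < m" "ics ! k = MInput j" "hx k = HC None (sym_of_bit (p ! (5 + j)))" by blast
      then show ?thesis
      proof cases
        case 1
        show ?thesis unfolding d 1(1) b member_block_def
          by (rule computesD[where F = "\<lambda>_. cell_bits cs False (hx k)" and bs = "[]"])
            (use seg B len 1(2) in \<open>auto simp: member_segments_def member_vals_def Let_def\<close>)
      next
        case (2 j)
        let ?F = "input_fun cs"
        have b': "bits k = ?F [p ! (5 + j)]" using b 2 by simp
        show ?thesis unfolding d 2(2) b' member_block_def
          by (rule computesD[where F = ?F])
            (use seg B len 2 p in \<open>auto simp: member_segments_def member_vals_def Let_def idx_def ref_def add.commute[of 5 j]\<close>)
      qed
    next
      case 2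
      then have d: "?ds ! k = MStep" using init(1) by (simp add: nth_append)
      let ?v = "member_vals n B W k MStep"
      let ?rs = "step_refs B"
      let ?bs = "bits (k - 1) @ bits (k - W - 1) @ bits (k - W) @ bits (k - W + 1)"
      have lt: "k - 1 < k" "k - W - 1 < k" "k - W < k" "k - W + 1 < k" using 2(1) W by simp_all
      have vals: "map (\<lambda>r. ref p (idx ?v r)) [] @ map (\<lambda>r. vs ! idx ?v r) ?rs = ?bs"
        using refs[OF lt(1)] refs[OF lt(2)] refs[OF lt(3)] refs[OF lt(4)]
        by (simp add: idx_def member_vals_def comp_def)
      have cell: "un_hot cs (tl (bits i)) = hx i" if "i \<le> W + N" for i
        using that hx_hcells[of i] by (simp add: bits_def cell_bits_def cs un_hot)
      have sl: "take B (drop (1 * B) ?bs) = bits (k - W - 1)" "take B (drop (2 * B) ?bs) = bits (k - W)"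
        "take B (drop (3 * B) ?bs) = bits (k - W + 1)"
        using lenb by (simp_all add: numeral_3_eq_3)
      have "k - 1 \<le> W + N" using 2 by simp
      then have "hd ?bs = hacc (k - 1)" by (simp add: bits_def cell_bits_def)
      then have "step_fun \<delta> cs ?bs = cell_bits cs (hacc k) (hx k)"
        using 2 cell[of "k - W - 1"] cell[of "k - W"] cell[of "k - W + 1"] lt hacc_step[OF 2(1)] hx_step[OF 2(1)]
        unfolding step_fun_def Let_def B(1)[symmetric] sl by simp
      then have b: "bits k = step_fun \<delta> cs ?bs" using 2 by (simp add: bits_def)
      show ?thesis unfolding d b member_block_def
      proof (rule computesD[OF _ _ _ vals])
        show "computes 11 [] ?rs B (step_fun \<delta> cs) (seg MStep)" "length (seg MStep) = n"
          using seg unfolding member_segments_def Let_def B(1)[symmetric] by auto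
        show "length vs = ?v 11" using len by (simp add: member_vals_def)
        fix r assume "r \<in> set ?rs"
        then show "idx ?v r < length vs"
          using bound[OF lt(1)] bound[OF lt(2)] bound[OF lt(3)] bound[OF lt(4)]
          by (auto simp: idx_def member_vals_def)
      qed
    next
      case 3
      then have d: "?ds ! k = MLast" using init(1) by (simp add: nth_append)
      let ?v = "member_vals n B W k MLast"
      let ?F = "point_fun B"
      have lt: "k - 1 < k" using 3 by simp
      have "vs ! ((k - 1) * n + (n - B)) = hd (bits (k - 1))"
        unfolding refs[OF lt, symmetric] using B(1) by (simp add: upt_conv_Cons del: upt_Suc)
      then have acc: "vs ! idx ?v (12, 0) = hacc (W + N)"
        using 3 by (simp add: idx_def member_vals_def bits_def cell_bits_def)
      have vals: "map (\<lambda>r. ref p (idx ?v r)) point_refs @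
          map (\<lambda>r. vs ! idx ?v r) [(12, 0)] = take 4 p @ [p ! 4, hacc (W + N)]"
        using acc p by (simp add: take4 idx_def member_vals_def ref_def numeral_2_eq_2)
      have "?F (take 4 p @ [p ! 4, hacc (W + N)]) = replicate B res"
        using p by (simp add: res_def nth_append)
      then have b: "bits k = ?F (take 4 p @ [p ! 4, hacc (W + N)])" using 3 by (simp add: bits_def)
      show ?thesis unfolding d b member_block_def
      proof (rule computesD[OF _ _ _ vals])
        show "computes 11 point_refs [(12, 0)] B ?F (seg MLast)" "length (seg MLast) = n"
          using seg unfolding member_segments_def Let_def B(1)[symmetric] by auto
        show "length vs = ?v 11" using len by (simp add: member_vals_def)
        show "idx ?v r < length vs" if "r \<in> set [(12, 0)]" for r
          using that bound[OF lt, of 0] B(1) by (simp add: idx_def member_vals_def)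
      qed
    qed
  qed
  also have "length ?ds - 1 = Suc (W + N)" using init(1) by simp
  also have "last (bits (Suc (W + N))) = res" using B(1) by (simp add: bits_def)
  finally show ?thesis by (simp add: res_def hacc_iff)
qed

end

section \<open>The poset of a counting problem\<close>

lemma lsb_val_inj: "length xs = length ys \<Longrightarrow> lsb_val xs = lsb_val ys \<Longrightarrow> xs = ys"
proof (induction xs ys rule: list_induct2)
  case (Cons x xs y ys)
  then have e: "of_bool x + 2 * lsb_val xs = of_bool y + 2 * lsb_val ys" by simp
  then have "x = y" by (cases x; cases y; simp; presburger)
  then show ?case using e Cons.IH by simp
qed simp

text \<open>In an N, \<open>b\<close> lies above the incomparable points \<open>a\<close> and
  \<open>c\<close>, which forces \<open>b\<close> to have tag 5. Then \<open>c\<close> has a tag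
  below 5, and every tag above that of \<open>c\<close> is 5 or below 5, so \<open>d\<close> would
  be comparable with \<open>b\<close>.\<close>

lemma tagged_order:
  fixes t u :: "'a \<Rightarrow> nat"
  assumes inj: "\<And>x y. x \<in> P \<Longrightarrow> y \<in> P \<Longrightarrow> t x = t y \<Longrightarrow> u x = u y \<Longrightarrow> x = y"
    and le: "\<And>x y. x \<in> P \<Longrightarrow> y \<in> P \<Longrightarrow> le x y \<longleftrightarrow> (if t x = t y then u x \<le> u y else (t x, t y) \<in> tag_less)"
  shows "partial_order_on_set P le" "N_free P le"
proof -
  have irr: "(k, k) \<notin> tag_less" for k by (auto simp: tag_less_def)
  have tr: "(i, k) \<in> tag_less" if "(i, j) \<in> tag_less" "(j, k) \<in> tag_less" for i j k
    using that unfolding tag_less_def by (elim insertE emptyE; simp)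
  show "partial_order_on_set P le"
    unfolding partial_order_on_set_def
  proof (intro conjI ballI impI)
    show "le x x" if "x \<in> P" for x using le that by simp
    show "x = y" if "x \<in> P" "y \<in> P" "le x y \<and> le y x" for x y
    proof (cases "t x = t y")
      case False
      then have "(t x, t y) \<in> tag_less" "(t y, t x) \<in> tag_less" using le that by auto
      then show ?thesis using irr tr by blast
    qed (use inj le that in auto)
    show "le x z" if "x \<in> P" "y \<in> P" "z \<in> P" "le x y \<and> le y z" for x y z
    proof (cases "t x = t y \<or> t y = t z")
      case True
      then show ?thesis using le[OF that(1,2)] le[OF that(2,3)] le[OF that(1,3)] that(4)
        by (auto split: if_splits)
    next
      case False
      then have "(t x, t y) \<in> tag_less" "(t y, t z) \<in> tag_less"
        using le[OF that(1,2)] le[OF that(2,3)] that(4) by auto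
      then have "(t x, t z) \<in> tag_less" by (rule tr)
      moreover from this have "t x \<noteq> t z" using irr by metis
      ultimately show ?thesis using le[OF that(1,3)] by simp
    qed
  qed
  have str: "t x = t y \<or> (t x, t y) \<in> tag_less" if "x \<in> P" "y \<in> P" "strict le x y" for x y
    using le[OF that(1,2)] that(3) by (auto simp: strict_def split: if_splits)
  have inc: "t x \<noteq> t y \<and> (t x, t y) \<notin> tag_less \<and> (t y, t x) \<notin> tag_less"
    if "x \<in> P" "y \<in> P" "incomparable le x y" for x y
    using le[OF that(1,2)] le[OF that(2,1)] that(3) by (auto simp: incomparable_def split: if_splits)
  have top: "j = 5" if "(i, j) \<in> tag_less" "(k, j) \<in> tag_less" "i \<noteq> k" "(i, k) \<notin> tag_less" "(k, i) \<notin> tag_less"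
    for i j k using that unfolding tag_less_def by (elim insertE emptyE; simp)
  have below: "(l, 5) \<in> tag_less" if "(k, 5) \<in> tag_less" "(k, l) \<in> tag_less" "l \<noteq> 5" for k l
    using that unfolding tag_less_def by (elim insertE emptyE; simp)
  show "N_free P le"
    unfolding N_free_def
  proof (intro notI, elim bexE conjE)
    fix a b c d
    assume m: "a \<in> P" "b \<in> P" "c \<in> P" "d \<in> P" "strict le a b" "strict le c d" "strict le c b"
      "incomparable le a c" "incomparable le a d" "incomparable le b d"
    note i = inc[OF m(1,3,8)] inc[OF m(2,4,10)]
    have "(t a, t b) \<in> tag_less" using str[OF m(1,2,5)] str[OF m(3,2,7)] i(1) by auto
    moreover have "(t c, t b) \<in> tag_less" using str[OF m(3,2,7)] calculation i(1) by auto
    moreover have "(t c, t d) \<in> tag_less" using str[OF m(3,4,6)] calculation i(2) by auto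
    ultimately show False using top[of "t a" "t b" "t c"] below[of "t c" "t d"] i by auto
  qed
qed

lemma card_bool_lists: "finite {y :: bool list. length y = m}" "card {y :: bool list. length y = m} = 2 ^ m"
  using finite_lists_length_eq[of "UNIV :: bool set" m] card_lists_length_eq[of "UNIV :: bool set" m]
  by simp_all

lemma card_tag:
  assumes "k < 16"
  shows "card {p. length p = 5 + m \<and> lsb_val (take 4 p) = k \<and> R (p ! 4) (drop 5 p)} =
    card {y. length y = m \<and> R False y} + card {y. length y = m \<and> R True y}" (is "card ?A = card ?F + card ?T")
proof -
  define tag where "tag = map (bit k) [0..<4]"
  have tag: "length tag = 4" "lsb_val tag = k"
    using assms by (simp_all add: tag_def horner_sum_bit_eq_take_bit take_bit_nat_eq_self)
  have "?A = (\<lambda>y. tag @ False # y) ` ?F \<union> (\<lambda>y. tag @ True # y) ` ?T"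
  proof (intro equalityI subsetI)
    fix p assume p: "p \<in> ?A"
    then have "take 4 p = tag" using tag by (intro lsb_val_inj) auto
    moreover have "p = take 4 p @ p ! 4 # drop 5 p"
      using p id_take_nth_drop[of 4 p] by simp
    ultimately have "p = tag @ p ! 4 # drop 5 p" by simp
    then show "p \<in> (\<lambda>y. tag @ False # y) ` ?F \<union> (\<lambda>y. tag @ True # y) ` ?T"
      using p by (cases "p ! 4") (auto intro!: image_eqI[of _ _ "drop 5 p"])
  qed (use tag in \<open>auto simp: nth_append\<close>)
  moreover have "finite ?F" "finite ?T" using card_bool_lists(1)[of m] by (auto intro: rev_finite_subset)
  moreover have "card ((\<lambda>y. tag @ False # y) ` ?F) = card ?F" "card ((\<lambda>y. tag @ True # y) ` ?T) = card ?T"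
    by (simp_all add: card_image inj_on_def)
  moreover have "(\<lambda>y. tag @ False # y) ` ?F \<inter> (\<lambda>y. tag @ True # y) ` ?T = {}" by auto
  ultimately show ?thesis by (simp add: card_Un_disjoint)
qed

theorem counting_poset:
  fixes acc :: "bool list \<Rightarrow> bool" and le :: "bool list \<Rightarrow> bool list \<Rightarrow> bool"
  assumes le: "\<And>p q. p \<in> P \<Longrightarrow> q \<in> P \<Longrightarrow>
      le p q \<longleftrightarrow> point_le (take 4 p) (take 4 q) (lsb_val (drop 4 p) \<le> lsb_val (drop 4 q))"
    and P: "P = {p. length p = 5 + m \<and> is_point (take 4 p) (p ! 4) (\<not> acc (drop 5 p))}"
  shows "partial_order_on_set P le" "N_free P le"
    "exists_game le P \<longleftrightarrow> 2 ^ m < 2 * card {y. length y = m \<and> acc y}"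
proof -
  let ?t = "\<lambda>p. lsb_val (take 4 p)" and ?u = "\<lambda>p. lsb_val (drop 4 p)"
  let ?K = "2 ^ Suc m :: nat"
  have len: "length p = 5 + m" if "p \<in> P" for p using that P by simp
  have tag_eq: "take 4 p = take 4 q \<longleftrightarrow> ?t p = ?t q" if "p \<in> P" "q \<in> P" for p q
    using len[OF that(1)] len[OF that(2)] by (auto intro: lsb_val_inj)
  have le': "le p q \<longleftrightarrow> (if ?t p = ?t q then ?u p \<le> ?u q else (?t p, ?t q) \<in> tag_less)"
    if "p \<in> P" "q \<in> P" for p q
    using le[OF that] tag_eq[OF that] by (simp add: point_le_def)
  have inj: "p = q" if "p \<in> P" "q \<in> P" "?t p = ?t q" "?u p = ?u q" for p q
  proof -
    have "take 4 p = take 4 q" using tag_eq that by blast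
    moreover have "drop 4 p = drop 4 q" using len that by (intro lsb_val_inj) auto
    ultimately show ?thesis by (metis append_take_drop_id)
  qed
  show "partial_order_on_set P le" "N_free P le" using tagged_order[of P ?t ?u le, OF inj le'] by blast+
  have ult: "?u p < ?K" if "p \<in> P" for p
    using horner_sum_of_bool_2_less[of "drop 4 p"] len[OF that] by simp
  \<comment> \<open>A lexicographic rank by tag and number, which serves all five chains at
    once.\<close>
  define r where "r p = ?t p * ?K + ?u p" for p
  have r_le: "r p \<le> r q \<longleftrightarrow> ?t p < ?t q \<or> ?t p = ?t q \<and> ?u p \<le> ?u q" if "p \<in> P" "q \<in> P" for p q
  proof (cases "?t p" "?t q" rule: linorder_cases)
    case less
    then have "Suc (?t p) * ?K \<le> ?t q * ?K" by (intro mult_le_mono1) simp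
    then show ?thesis using ult[OF that(1)] less by (simp add: r_def)
  next
    case greater
    then have "Suc (?t q) * ?K \<le> ?t p * ?K" by (intro mult_le_mono1) simp
    then show ?thesis using ult[OF that(2)] greater by (simp add: r_def)
  qed (simp add: r_def)
  define A where "A T = {p \<in> P. ?t p \<in> T}" for T
  define rej where "rej = card {y. length y = m \<and> \<not> acc y}"
  define a where "a = 2 * rej + 2 ^ m"
  have fin: "finite P"
    unfolding P using card_bool_lists(1)[of "5 + m"] by (auto intro: rev_finite_subset)
  have card1: "card (A {k}) = (if k \<in> {0, 2} then 2 * rej else if k \<in> {1, 3} then 2 ^ m else ?K)" if "k \<le> 8" for k
  proof -
    have "A {k} = {p. length p = 5 + m \<and> lsb_val (take 4 p) = k \<and>
        (if k \<in> {0, 2} then \<not> acc (drop 5 p) else if k \<in> {1, 3} then \<not> p ! 4 else True)}"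
      using that unfolding A_def P is_point_def Let_def by auto
    then show ?thesis
      using card_tag[of k m "\<lambda>b y. if k \<in> {0, 2} then \<not> acc y else if k \<in> {1, 3} then \<not> b else True"] that
        card_bool_lists(2)[of m] by (auto simp: rej_def)
  qed
  have card_A: "card (A (insert k T)) = card (A {k}) + card (A T)" if "k \<notin> T" for k T
  proof -
    have "A (insert k T) = A {k} \<union> A T" "A {k} \<inter> A T = {}" using that by (auto simp: A_def)
    then show ?thesis using fin by (simp add: card_Un_disjoint A_def)
  qed
  have tag8: "?t p \<le> 8" if "p \<in> P" for p
    using that unfolding P is_point_def Let_def by (auto split: if_splits)
  have tags: "k \<in> {0, 1, 2, 3, 4, 5, 6, 7, 8}" if "k \<le> (8::nat)" for k using that by auto
  have P_eq: "P = A {0, 1} \<union> (A {2, 3} \<union> A {4} \<union> A {5} \<union> A {6, 7, 8})"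
  proof (intro equalityI subsetI)
    fix p assume "p \<in> P"
    then show "p \<in> A {0, 1} \<union> (A {2, 3} \<union> A {4} \<union> A {5} \<union> A {6, 7, 8})"
      using tags[OF tag8[of p]] by (auto simp: A_def)
  qed (auto simp: A_def)
  have rej: "rej + card {y. length y = m \<and> acc y} = 2 ^ m"
  proof -
    have "{y. length y = m} = {y. length y = m \<and> \<not> acc y} \<union> {y. length y = m \<and> acc y}" by auto
    moreover have "finite {y. length y = m \<and> \<not> acc y}" "finite {y. length y = m \<and> acc y}"
      using card_bool_lists(1)[of m] by (auto intro: rev_finite_subset)
    ultimately show ?thesis using card_bool_lists(2)[of m] unfolding rej_def
      by (metis (no_types, lifting) card_Un_disjoint disjoint_iff mem_Collect_eq)
  qed
  \<comment> \<open>A union of tags is a chain if \<open>tag_less\<close> orders these tags like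
    numbers.\<close>
  have chain: "finite (A T) \<and> inj_on r (A T) \<and> (\<forall>x\<in>A T. \<forall>y\<in>A T. le x y \<longleftrightarrow> r x \<le> r y)"
    if T: "\<And>i j. i \<in> T \<Longrightarrow> j \<in> T \<Longrightarrow> i \<noteq> j \<Longrightarrow> (i, j) \<in> tag_less \<longleftrightarrow> i < j" for T
  proof (intro conjI ballI)
    show "finite (A T)" using fin by (simp add: A_def)
    show "inj_on r (A T)"
    proof (rule inj_onI)
      fix x y assume xy: "x \<in> A T" "y \<in> A T" and eq: "r x = r y"
      have m: "x \<in> P" "y \<in> P" using xy by (simp_all add: A_def)
      have "?t x < ?t y \<or> ?t x = ?t y \<and> ?u x \<le> ?u y" "?t y < ?t x \<or> ?t y = ?t x \<and> ?u y \<le> ?u x"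
        unfolding r_le[OF m, symmetric] r_le[OF m(2,1), symmetric] eq by simp_all
      then have "?t x = ?t y" "?u x = ?u y" by linarith+
      then show "x = y" by (rule inj[OF m])
    qed
    fix x y assume xy: "x \<in> A T" "y \<in> A T"
    then have m: "x \<in> P" "y \<in> P" by (simp_all add: A_def)
    show "le x y \<longleftrightarrow> r x \<le> r y"
    proof (cases "?t x = ?t y")
      case True
      then show ?thesis unfolding r_le[OF m] le'[OF m] by simp
    next
      case False
      then have "(?t x, ?t y) \<in> tag_less \<longleftrightarrow> ?t x < ?t y" using T xy by (simp add: A_def)
      then show ?thesis using False unfolding r_le[OF m] le'[OF m] by simp
    qed
  qed
  have rel: "le x y \<longleftrightarrow> (?t x, ?t y) \<in> tag_less" if "x \<in> A T" "y \<in> A T'" "T \<inter> T' = {}" for x y T T'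
  proof -
    have "?t x \<noteq> ?t y" using that by (auto simp: A_def)
    then show ?thesis using le'[of x y] that(1,2) by (simp add: A_def)
  qed
  have cross: "\<forall>x\<in>A T. \<forall>y\<in>A T'. le x y = b \<and> \<not> le y x"
    if "T \<inter> T' = {}" "\<forall>i\<in>T. \<forall>j\<in>T'. ((i, j) \<in> tag_less) = b \<and> (j, i) \<notin> tag_less" for T T' b
  proof (intro ballI)
    fix x y assume xy: "x \<in> A T" "y \<in> A T'"
    then have "?t x \<in> T" "?t y \<in> T'" by (simp_all add: A_def)
    then show "le x y = b \<and> \<not> le y x"
      using rel[OF xy that(1)] rel[OF xy(2,1)] that by (simp add: Int_commute)
  qed
  have Un: "A T \<union> A T' = A (T \<union> T')" for T T' by (auto simp: A_def)
  have "win le (A {0, 1} \<union> (A {2, 3} \<union> A {4} \<union> A {5} \<union> A {6, 7, 8})) \<longleftrightarrow> a < ?K"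
  proof (rule threshold_game[where e = "Suc m" and r = r])
    have "0 < (2::nat) ^ m" by simp
    then show "a < 2 * ?K" using rej unfolding a_def power_Suc by linarith
    show "finite Z \<and> inj_on r Z \<and> (\<forall>x\<in>Z. \<forall>y\<in>Z. le x y = (r x \<le> r y))"
      if "Z \<in> {A {0, 1}, A {2, 3}, A {4}, A {5}, A {6, 7, 8}}" for Z
      using that by (elim insertE emptyE; hypsubst; intro chain) (auto simp: tag_less_def)
    show "card (A {0, 1}) = a" "card (A {2, 3}) = a" "card (A {4}) = ?K" "card (A {5}) = ?K"
      "card (A {6, 7, 8}) = 3 * ?K"
      by (simp_all add: card_A[of 0 "{1}"] card_A[of 2 "{3}"] card_A[of 6 "{7, 8}"] card_A[of 7 "{8}"] card1 a_def del: One_nat_def)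
    show "\<forall>x\<in>A {2, 3}. \<forall>y\<in>A {4}. \<not> le x y \<and> \<not> le y x"
      using cross[of "{2, 3}" "{4}" False] by (simp add: tag_less_def)
    show "\<forall>x\<in>A {2, 3} \<union> A {4}. \<forall>y\<in>A {5}. le x y \<and> \<not> le y x"
      unfolding Un using cross[of "{2, 3} \<union> {4}" "{5}" True] by (simp add: tag_less_def)
    show "\<forall>x\<in>A {0, 1}. \<forall>y\<in>A {2, 3} \<union> A {4} \<union> A {5} \<union> A {6, 7, 8}. \<not> le x y \<and> \<not> le y x"
      unfolding Un using cross[of "{0, 1}" "{2, 3} \<union> {4} \<union> {5} \<union> {6, 7, 8}" False] by (simp add: tag_less_def)
    show "\<forall>x\<in>A {2, 3} \<union> A {4} \<union> A {5}. \<forall>y\<in>A {6, 7, 8}. \<not> le x y \<and> \<not> le y x"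
      unfolding Un using cross[of "{2, 3} \<union> {4} \<union> {5}" "{6, 7, 8}" False] by (simp add: tag_less_def)
  qed simp
  also have "a < ?K \<longleftrightarrow> 2 ^ m < 2 * card {y. length y = m \<and> acc y}"
    using rej unfolding a_def by simp linarith
  finally show "exists_game le P \<longleftrightarrow> 2 ^ m < 2 * card {y. length y = m \<and> acc y}"
    unfolding exists_game_def P_eq[symmetric] .
qed

section \<open>Programs that print circuits\<close>

fun seqs :: "com list \<Rightarrow> com" where
  "seqs [] = Skip"
| "seqs (c # cs) = Seq c (seqs cs)"

lemma sem_seqs_append: "sem x (seqs (as @ bs)) s = sem x (seqs bs) (sem x (seqs as) s)"
  by (induction as arbitrary: s) auto

lemma incs_seqs [simp]: "incs (seqs cs) = (\<Union>c\<in>set cs. incs c)"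
  by (induction cs) auto

lemma wf_seqs [simp]: "wf_com (seqs cs) \<longleftrightarrow> (\<forall>c\<in>set cs. wf_com c)"
  by (induction cs) auto

lemma sem_Rep_iterate:
  assumes "\<And>i. i < n \<Longrightarrow> sem x c (S i) = S (Suc i)" "fst (S 0) r = n"
  shows "sem x (Rep r c) (S 0) = S n"
proof -
  have "(sem x c ^^ i) (S 0) = S i" if "i \<le> n" for i
    using that by (induction i) (use assms in auto)
  then show ?thesis using assms(2) by simp
qed

lemma sem_Rep_add:
  assumes "\<And>z. sem x c (v(r := z), w) = (v(r := z + d), w)" "r \<noteq> s"
  shows "sem x (Rep s c) (v, w) = (v(r := v r + v s * d), w)"
proof -
  have "(sem x c ^^ i) (v, w) = (v(r := v r + i * d), w)" for i
    by (induction i) (simp_all add: assms(1) add.assoc add.commute[of d] del: fun_upd_apply)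
  then show ?thesis by simp
qed

section \<open>Arithmetic on registers\<close>

definition add_const :: "nat \<Rightarrow> nat \<Rightarrow> com" where
  "add_const r k = seqs (replicate k (Inc r))"

lemma sem_add_const [simp]: "sem x (add_const r k) (v, w) = (v(r := v r + k), w)"
  unfolding add_const_def by (induction k arbitrary: v) (auto simp: fun_eq_iff)

lemma incs_add_const: "incs (add_const r k) \<subseteq> {r}"
  by (auto simp: add_const_def)

lemma wf_add_const [simp]: "wf_com (add_const r k)"
  by (simp add: add_const_def)

definition add_mult :: "nat \<Rightarrow> nat \<Rightarrow> nat \<Rightarrow> com" where
  "add_mult r s k = Rep s (add_const r k)"

lemma sem_add_mult [simp]:
  assumes "r \<noteq> s"
  shows "sem x (add_mult r s k) (v, w) = (v(r := v r + v s * k), w)"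
  using sem_Rep_add[of x "add_const r k" v r w k s] assms by (simp add: add_mult_def)

definition add_prod :: "nat \<Rightarrow> nat \<Rightarrow> nat \<Rightarrow> com" where
  "add_prod r s t = Rep s (add_mult r t 1)"

lemma sem_add_prod [simp]:
  assumes "r \<noteq> s" "r \<noteq> t"
  shows "sem x (add_prod r s t) (v, w) = (v(r := v r + v s * v t), w)"
  using sem_Rep_add[of x "add_mult r t 1" v r w "v t" s] assms by (simp add: add_prod_def)

text \<open>\<open>k\<close> nested loops over the same register \<open>s\<close> run the innermost
  addition \<open>v s ^ k\<close> times.\<close>

definition add_poly :: "nat \<Rightarrow> nat \<Rightarrow> nat \<Rightarrow> nat \<Rightarrow> com" where
  "add_poly r s c k = Seq ((Rep s ^^ k) (add_const r c)) (add_const r c)"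

lemma sem_add_poly [simp]:
  assumes "r \<noteq> s"
  shows "sem x (add_poly r s c k) (v, w) = (v(r := v r + (c * v s ^ k + c)), w)"
proof -
  have "sem x ((Rep s ^^ k) (add_const r c)) (v, w) = (v(r := v r + c * v s ^ k), w)" for v
  proof (induction k arbitrary: v)
    case (Suc k)
    have "sem x ((Rep s ^^ k) (add_const r c)) (v(r := z), w) = (v(r := z + c * v s ^ k), w)" for z
      using Suc[of "v(r := z)"] assms by (simp del: fun_upd_apply add: fun_upd_same fun_upd_other)
    from sem_Rep_add[OF this assms] show ?case by (simp add: mult_ac del: fun_upd_apply)
  qed simp
  then show ?thesis by (simp add: add_poly_def add.assoc)
qed

lemma wf_arith [simp]:
  "r \<noteq> s \<Longrightarrow> wf_com (add_mult r s k)"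
  "r \<noteq> s \<Longrightarrow> r \<noteq> t \<Longrightarrow> wf_com (add_prod r s t)"
  "r \<noteq> s \<Longrightarrow> wf_com (add_poly r s c k)"
proof -
  show 1: "r \<noteq> s \<Longrightarrow> wf_com (add_mult r s k)" for r s k
    using incs_add_const[of r k] by (auto simp: add_mult_def)
  show "r \<noteq> s \<Longrightarrow> r \<noteq> t \<Longrightarrow> wf_com (add_prod r s t)"
    using 1[of r t 1] incs_add_const[of r 1] by (auto simp: add_prod_def add_mult_def)
  have "r \<noteq> s \<Longrightarrow> wf_com ((Rep s ^^ k) (add_const r c)) \<and> incs ((Rep s ^^ k) (add_const r c)) \<subseteq> {r}"
    using incs_add_const[of r c] by (induction k) auto
  then show "r \<noteq> s \<Longrightarrow> wf_com (add_poly r s c k)" by (simp add: add_poly_def)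
qed

section \<open>Printing gates\<close>

definition outs :: "bool list \<Rightarrow> com" where
  "outs bs = seqs (map Out bs)"

lemma sem_outs [simp]: "sem x (outs bs) (v, w) = (v, w @ bs)"
  unfolding outs_def by (induction bs arbitrary: w) auto

text \<open>Numbers are encoded in unary, so a loop over the register prints the variable part of an
  address, and the offset follows as a constant string.\<close>

definition emit_idx :: "sref \<Rightarrow> com" where
  "emit_idx r = Seq (Rep (fst r) (Out True)) (outs (replicate (snd r) True @ [False]))"

lemma sem_emit_idx [simp]: "sem x (emit_idx r) (v, w) = (v, w @ enc_nat (idx v r))"
proof -
  have "sem x (Rep (fst r) (Out True)) (v, w) = (v, w @ replicate (v (fst r)) True)"
    using sem_Rep_iterate[where S = "\<lambda>i. (v, w @ replicate i True)" and n = "v (fst r)" and r = "fst r"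
        and c = "Out True" and x = x] by (simp add: replicate_append_same)
  then show ?thesis by (simp add: emit_idx_def enc_nat_def idx_def replicate_add)
qed

fun emit :: "sgate \<Rightarrow> com" where
  "emit (SInp r) = Seq (outs (enc_nat 0)) (emit_idx r)"
| "emit (SConst b) = outs (enc_nat 1 @ [b])"
| "emit (SNot r) = Seq (outs (enc_nat 2)) (emit_idx r)"
| "emit (SAnd r s) = Seq (outs (enc_nat 3)) (Seq (emit_idx r) (emit_idx s))"
| "emit (SOr r s) = Seq (outs (enc_nat 4)) (Seq (emit_idx r) (emit_idx s))"

lemma sem_emit [simp]: "sem x (emit g) (v, w) = (v, w @ enc_gate (inst v g))"
  by (cases g) auto

abbreviation enc_gates :: "circuit \<Rightarrow> bool list" where
  "enc_gates gs \<equiv> concat (map enc_gate gs)"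

definition emits :: "sgate list \<Rightarrow> com" where
  "emits G = seqs (map emit G)"

lemma sem_emits [simp]: "sem x (emits G) (v, w) = (v, w @ enc_gates (map (inst v) G))"
  unfolding emits_def by (induction G arbitrary: w) auto

lemma sem_emits_eq: "map (inst v) G = gs \<Longrightarrow> sem x (emits G) (v, w) = (v, w @ enc_gates gs)"
  by simp

lemma incs_emit [simp]: "incs (outs bs) = {}" "incs (emit_idx r) = {}" "incs (emit g) = {}" "incs (emits G) = {}"
proof -
  show 1: "incs (outs bs) = {}" for bs by (auto simp: outs_def)
  show 2: "incs (emit_idx r) = {}" for r by (simp add: emit_idx_def 1)
  show 3: "incs (emit g) = {}" for g by (cases g) (simp_all add: 1 2)
  show "incs (emits G) = {}" by (simp add: emits_def 3)
qed

lemma wf_emit [simp]: "wf_com (outs bs)" "wf_com (emit_idx r)" "wf_com (emit g)" "wf_com (emits G)"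
proof -
  show 1: "wf_com (outs bs)" for bs by (auto simp: outs_def)
  show 2: "wf_com (emit_idx r)" for r by (simp add: emit_idx_def 1)
  show 3: "wf_com (emit g)" for g by (cases g) (simp_all add: 1 2)
  show "wf_com (emits G)" by (simp add: emits_def 3)
qed

section \<open>Printing circuits block by block\<close>

definition advance :: "nat \<Rightarrow> nat list \<Rightarrow> com" where
  "advance k rs = seqs (map (\<lambda>r. add_const r k) rs)"

lemma incs_advance: "incs (advance k rs) \<subseteq> set rs"
  using incs_add_const by (fastforce simp: advance_def)

lemma wf_advance [simp]: "wf_com (advance k rs)"
  by (simp add: advance_def)

lemma sem_advance_simps [simp]:
  "sem x (advance k []) s = s"
  "sem x (advance k (r # rs)) (v, w) = sem x (advance k rs) (v(r := v r + k), w)"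
  by (simp_all add: advance_def)

text \<open>A gadget mentions few registers; only on these must the registers of the program agree
  with \<open>order_vals\<close> or \<open>member_vals\<close>.\<close>

lemma inst_segment:
  assumes "computes cur irs rs B F G" "\<And>r. r \<in> insert cur (fst ` (set irs \<union> set rs)) \<Longrightarrow> v r = v' r"
  shows "map (inst v) G = map (inst v') G"
proof (rule map_cong[OF refl inst_cong])
  fix g r assume "g \<in> set G" "r \<in> sregs g"
  then show "v r = v' r" using assms unfolding computes_def by blast
qed

text \<open>Registers: \<open>1\<close> number of choice bits \<open>m\<close>, \<open>2\<close> input length of the verifier, \<open>3\<close> its running time
  \<open>T\<close>, \<open>4\<close> width \<open>W\<close> of the helix, \<open>5\<close> number of its steps, \<open>6\<close> length of a point, \<open>7\<close> and \<open>8\<close>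
  sizes of the membership and order circuits; \<open>9\<close> stays \<open>0\<close>; the others are the pointers used in
  \<open>member_vals\<close> and \<open>order_vals\<close>, and \<open>16\<close> is the position in the input.\<close>

definition start_vals :: "nat \<Rightarrow> nat \<Rightarrow> nat \<Rightarrow> nat \<Rightarrow> nat \<Rightarrow> nat \<Rightarrow> nat" where
  "start_vals nx m T n B = (let len = 2 * nx + m + 2; W = len + T + 4; N = (T + 3) * W in
     (\<lambda>_. 0)(0 := nx, 1 := m, 2 := len, 3 := T, 4 := W, 5 := N, 6 := 5 + m,
       7 := (W + N + 2) * n, 8 := (m + 3) * n, 12 := W * n + (n - B), 13 := n - B,
       14 := n + (n - B), 15 := 2 * n + (n - B), 18 := n - 1, 20 := 5 + m))"

text \<open>Register 3 receives the running time for inputs of length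
  \<open>2 * length x + m + 2\<close>, the length of \<open>pair_enc x y\<close> for every choice
  string \<open>y\<close> of length \<open>m\<close>.\<close>

definition arith_com :: "nat \<Rightarrow> nat \<Rightarrow> nat \<Rightarrow> nat \<Rightarrow> nat \<Rightarrow> nat \<Rightarrow> com" where
  "arith_com c1 k1 c2 k2 n B = seqs ([add_poly 1 0 c1 k1, add_mult 2 0 2, add_mult 2 1 1, add_const 2 2] @
    [add_poly 3 2 c2 k2, add_mult 4 2 1, add_mult 4 3 1, add_const 4 4, add_prod 5 3 4, add_mult 5 4 3,
     add_mult 6 1 1, add_const 6 5, add_mult 7 4 n, add_mult 7 5 n, add_const 7 (2 * n),
     add_mult 8 1 n, add_const 8 (3 * n), add_mult 12 4 n, add_const 12 (n - B), add_const 13 (n - B),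
     add_const 14 (n + (n - B)), add_const 15 (2 * n + (n - B)), add_const 18 (n - 1), add_mult 20 6 1])"

lemma sem_arith_com:
  assumes "m = c1 * length x ^ k1 + c1" "T = c2 * (2 * length x + m + 2) ^ k2 + c2"
  shows "sem x (arith_com c1 k1 c2 k2 n B) (init_store x) = (start_vals (length x) m T n B, [])"
proof -
  obtain len where len: "2 * length x + m + 2 = len" by blast
  have T: "c2 * len ^ k2 + c2 = T" using assms(2) unfolding len by simp
  have 1: "sem x (seqs [add_poly 1 0 c1 k1, add_mult 2 0 2, add_mult 2 1 1, add_const 2 2]) (init_store x) =
      ((\<lambda>_. 0)(0 := length x, 1 := m, 2 := len), [])"
    by (simp add: init_store_def assms(1)[symmetric] len[symmetric] mult.commute[of "length x" 2])
  show ?thesis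
    unfolding arith_com_def sem_seqs_append 1 start_vals_def Let_def len
    by (simp add: T) (simp add: fun_eq_iff algebra_simps)
qed

lemma wf_arith_com: "wf_com (arith_com c1 k1 c2 k2 n B)"
  by (simp add: arith_com_def)

text \<open>\<open>b\<close> and \<open>y\<close> together have \<open>m + 1\<close> digits, but
  register 1 holds \<open>m\<close>; hence the additional copy of the body. Register 18 is not
  advanced after the first block, which keeps it on the last gate of the preceding block.\<close>

definition order_com :: "nat \<Rightarrow> (odesc \<Rightarrow> sgate list) \<Rightarrow> com" where
  "order_com n seg = (let body = seqs [emits (seg (OBit 0)), advance n [17, 18], Inc 19, Inc 20] in
     seqs [emits (seg OFirst), advance n [17], Rep 1 body, body, emits (seg OLast)])"

lemma wf_order_com: "wf_com (order_com n seg)"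
  using incs_advance[of n "[17, 18]"] by (auto simp: order_com_def Let_def)

lemma sem_order_com:
  assumes seg: "order_segments n (seg OFirst) (seg (OBit 0)) (seg OLast)" "\<And>j. seg (OBit j) = seg (OBit 0)"
  shows "sem x (order_com n seg) (start_vals nx m T n B, w) =
     ((start_vals nx m T n B)(17 := Suc (Suc m) * n, 18 := Suc m * n + (n - 1), 19 := Suc m, 20 := 5 + m + Suc m),
      w @ enc_gates (blocks (order_block n (5 + m) seg) 0 (order_descs m)))"
proof -
  let ?v0 = "start_vals nx m T n B"
  \<comment> \<open>\<open>V j\<close> and \<open>W j\<close> are the registers and the output just
    before the block for digit \<open>j\<close>.\<close>
  define V where "V j = ?v0(17 := Suc j * n, 18 := j * n + (n - 1), 19 := j, 20 := 5 + m + j)" for j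
  define f where "f = order_block n (5 + m) seg"
  define W where "W j = w @ enc_gates (f 0 OFirst @ blocks f 1 (map OBit [0..<j]))" for j
  let ?body = "seqs [emits (seg (OBit 0)), advance n [17, 18], Inc 19, Inc 20]"
  have v0: "?v0 6 = 5 + m" "?v0 9 = 0" "?v0 17 = 0" "?v0 18 = n - 1" "?v0 19 = 0" "?v0 20 = 5 + m" "?v0 1 = m"
    by (simp_all add: start_vals_def Let_def)
  have first: "map (inst ?v0) (seg OFirst) = f 0 OFirst"
    unfolding f_def order_block_def
    by (rule inst_segment[where F = "\<lambda>_. [True]"])
      (use seg(1) v0 in \<open>auto simp: order_segments_def order_vals_def\<close>)
  have V0: "?v0(17 := n) = V 0" using v0 by (auto simp: V_def fun_eq_iff)
  have body: "sem x ?body (V j, W j) = (V (Suc j), W (Suc j))" for j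
  proof -
    have "map (inst (V j)) (seg (OBit 0)) = map (inst (order_vals n (5 + m) (Suc j) (OBit j))) (seg (OBit 0))"
      by (rule inst_segment[where F = compare_fun])
        (use seg(1) v0 in \<open>auto simp: order_segments_def order_vals_def V_def\<close>)
    then have "map (inst (V j)) (seg (OBit 0)) = f (Suc j) (OBit j)"
      unfolding f_def order_block_def seg(2)[of j] .
    moreover have "(V j)(17 := V j 17 + n, 18 := V j 18 + n, 19 := Suc (V j 19), 20 := Suc (V j 20)) = V (Suc j)"
      by (auto simp: V_def fun_eq_iff)
    ultimately show ?thesis by (simp add: W_def V_def)
  qed
  have last: "map (inst (V (Suc m))) (seg OLast) = f (Suc (Suc m)) OLast"
    unfolding f_def order_block_def
    by (rule inst_segment[where F = le_fun])
      (use seg(1) v0 in \<open>auto simp: order_segments_def order_vals_def V_def\<close>)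
  have "V 0 1 = m" using v0 by (simp add: V_def)
  then have "sem x (Rep 1 ?body) (V 0, W 0) = (V m, W m)"
    using sem_Rep_iterate[where S = "\<lambda>j. (V j, W j)" and x = x and c = ?body and n = m and r = 1] body by simp
  moreover have "sem x (seqs [emits (seg OFirst), advance n [17]]) (?v0, w) = (V 0, W 0)"
    using first V0 v0 by (simp add: W_def)
  ultimately have "sem x (order_com n seg) (?v0, w) = (V (Suc m), W (Suc m) @ enc_gates (f (Suc (Suc m)) OLast))"
    using body[of m] last unfolding order_com_def Let_def by simp
  moreover have "W (Suc m) @ enc_gates (f (Suc (Suc m)) OLast) = w @ enc_gates (blocks f 0 (order_descs m))"
    by (simp add: W_def order_descs_def)
  ultimately show ?thesis by (simp add: V_def f_def)
qed


definition block_com :: "nat \<Rightarrow> (mdesc \<Rightarrow> sgate list) \<Rightarrow> mdesc \<Rightarrow> com" where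
  "block_com n seg d = Seq (emits (seg d)) (advance n [11])"

abbreviation bit_cell :: "bool \<Rightarrow> mdesc" where
  "bit_cell b \<equiv> MCell (HC None (sym_of_bit b))"

abbreviation blank_cell :: mdesc where
  "blank_cell \<equiv> MCell (HC None 0)"

text \<open>Cells 0 to \<open>W\<close>: the left wall, the tape with \<open>pair_enc x y\<close>,
  where \<open>x\<close> is hardwired and \<open>y\<close> is read from the input of the circuit,
  blanks up to the width of a row, and the wall of row 1, which lies before the reach of the step
  rule.\<close>

definition init_descs :: "bool list \<Rightarrow> nat \<Rightarrow> nat \<Rightarrow> mdesc list" where
  "init_descs x m T = [MCell WallL] @ concat (map (\<lambda>b. [bit_cell b, bit_cell b]) x) @ [bit_cell False, bit_cell True] @
     map MInput [0..<m] @ replicate (T + 3) blank_cell @ [MCell Wall]"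

definition init_cells :: "hcell set" where
  "init_cells = {Wall, WallL, HC None 0, HC None 1, HC None 2}"

definition init_com :: "nat \<Rightarrow> (mdesc \<Rightarrow> sgate list) \<Rightarrow> com" where
  "init_com n seg = (let bk = block_com n seg in
     seqs [bk (MCell WallL),
       Rep 0 (Seq (IfIn 16 (seqs [bk (bit_cell True), bk (bit_cell True)]) (seqs [bk (bit_cell False), bk (bit_cell False)])) (Inc 16)),
       bk (bit_cell False), bk (bit_cell True), Rep 1 (seqs [bk (MInput 0), Inc 10]),
       Rep 3 (bk blank_cell), bk blank_cell, bk blank_cell, bk blank_cell, bk (MCell Wall)])"

text \<open>Registers 12 to 15 stay fixed during the initial part: their starting values are the
  addresses for block \<open>W + 1\<close>, the first step block.\<close>

definition member_com :: "nat \<Rightarrow> (mdesc \<Rightarrow> sgate list) \<Rightarrow> com" where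
  "member_com n seg = seqs [init_com n seg, Rep 5 (seqs [emits (seg MStep), advance n [11, 12, 13, 14, 15]]), emits (seg MLast)]"

lemma wf_member_com: "wf_com (member_com n seg)"
proof -
  have inc: "incs (block_com n seg d) \<subseteq> {11}" "wf_com (block_com n seg d)" for d
    using incs_advance[of n "[11]"] by (auto simp: block_com_def)
  have "r \<notin> incs (block_com n seg d)" if "r \<noteq> 11" for r d using inc that by blast
  then show ?thesis using incs_advance[of n "[11, 12, 13, 14, 15]"] inc(2)
    by (auto simp: member_com_def init_com_def Let_def)
qed

lemma sem_member_com:
  assumes seg: "member_segments \<delta> cs n init_cells seg" "\<And>j. seg (MInput j) = seg (MInput 0)" and B: "B = Suc (length cs)"
    and v: "v 0 = length x" "v 1 = m" "v 3 = T" "v 5 = N" "v 9 = 0" "v 10 = 0" "v 11 = 0" "v 12 = W * n + (n - B)"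
      "v 13 = n - B" "v 14 = n + (n - B)" "v 15 = 2 * n + (n - B)" "v 16 = 0"
    and W: "W = 2 * length x + m + 2 + T + 4"
  shows "sem x (member_com n seg) (v, w) = (v(10 := m, 16 := length x, 11 := (Suc W + N) * n, 12 := (W + N) * n + (n - B),
       13 := N * n + (n - B), 14 := (N + 1) * n + (n - B), 15 := (N + 2) * n + (n - B)),
     w @ enc_gates (blocks (member_block n B W seg) 0 (init_descs x m T @ replicate N MStep @ [MLast])))"
proof -
  let ?bk = "block_com n seg"
  define f where "f = member_block n B W seg"
  \<comment> \<open>The store after the blocks \<open>ds\<close>, when \<open>j\<close> choice bits
    and \<open>l\<close> bits of \<open>x\<close> have been treated.\<close>
  define Z where "Z ds j l = (v(10 := j, 16 := l, 11 := length ds * n), w @ enc_gates (blocks f 0 ds))" for ds j l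
  note segs = seg(1)[unfolded member_segments_def Let_def B[symmetric]]
  have cell: "sem x (?bk (MCell c)) (Z ds j l) = Z (ds @ [MCell c]) j l" if "c \<in> init_cells" for c ds j l
  proof -
    have "map (inst (v(10 := j, 16 := l, 11 := length ds * n))) (seg (MCell c)) =
        map (inst (member_vals n B W (length ds) (MCell c))) (seg (MCell c))"
      by (rule inst_segment[where F = "\<lambda>_. cell_bits cs False c" and cur = 11 and irs = "[]" and rs = "[]" and B = B])
        (use segs that in \<open>auto simp: member_vals_def\<close>)
    note e = sem_emits_eq[OF this]
    have "sem x (?bk (MCell c)) (Z ds j l) =
        sem x (advance n [11]) (v(10 := j, 16 := l, 11 := length ds * n),
          (w @ enc_gates (blocks f 0 ds)) @ enc_gates (f (length ds) (MCell c)))"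
      unfolding block_com_def Z_def sem.simps f_def member_block_def by (simp only: e append_assoc)
    then show ?thesis by (simp add: Z_def fun_eq_iff)
  qed
  have input: "sem x (?bk (MInput 0)) (Z ds j l) = Z (ds @ [MInput j]) j l" for ds j l
  proof -
    have "map (inst (v(10 := j, 16 := l, 11 := length ds * n))) (seg (MInput j)) =
        map (inst (member_vals n B W (length ds) (MInput j))) (seg (MInput j))"
      by (rule inst_segment[where F = "input_fun cs" and cur = 11
          and irs = "[(10, 5)]" and rs = "[]" and B = B])
        (use segs in \<open>auto simp: member_vals_def\<close>)
    note e = sem_emits_eq[OF this, unfolded seg(2)[of j]]
    have "sem x (?bk (MInput 0)) (Z ds j l) =
        sem x (advance n [11]) (v(10 := j, 16 := l, 11 := length ds * n),
          (w @ enc_gates (blocks f 0 ds)) @ enc_gates (f (length ds) (MInput j)))"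
      unfolding block_com_def Z_def sem.simps f_def member_block_def seg(2)[of j] by (simp only: e append_assoc)
    then show ?thesis by (simp add: Z_def fun_eq_iff)
  qed
  have incr: "sem x (Inc 16) (Z ds j l) = Z ds j (Suc l)" "sem x (Inc 10) (Z ds j l) = Z ds (Suc j) l" for ds j l
    by (simp_all add: Z_def fun_eq_iff)
  have regs: "fst (Z ds j l) 0 = length x" "fst (Z ds j l) 1 = m" "fst (Z ds j l) 3 = T" "fst (Z ds j l) 16 = l" for ds j l
    by (simp_all add: Z_def v v(2)[unfolded One_nat_def])
  have C: "WallL \<in> init_cells" "Wall \<in> init_cells" "HC None 0 \<in> init_cells" "HC None (sym_of_bit b) \<in> init_cells" for b
    by (auto simp: init_cells_def sym_of_bit_def)
  let ?xb = "Seq (IfIn 16 (seqs [?bk (bit_cell True), ?bk (bit_cell True)])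
      (seqs [?bk (bit_cell False), ?bk (bit_cell False)])) (Inc 16)"
  let ?dup = "\<lambda>b. [bit_cell b, bit_cell b]"
  have xloop: "sem x (Rep 0 ?xb) (Z ds 0 0) = Z (ds @ concat (map ?dup x)) 0 (length x)" for ds
  proof -
    have "sem x ?xb (Z (ds @ concat (map ?dup (take i x))) 0 i) = Z (ds @ concat (map ?dup (take (Suc i) x))) 0 (Suc i)"
      if "i < length x" for i
      using that by (cases "x ! i") (simp_all add: regs cell C incr take_Suc_conv_app_nth del: sem.simps(2))
    then show ?thesis
      using sem_Rep_iterate[where S = "\<lambda>i. Z (ds @ concat (map ?dup (take i x))) 0 i" and n = "length x" and r = 0
        and x = x and c = ?xb] regs by simp
  qed
  let ?yb = "seqs [?bk (MInput 0), Inc 10]"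
  have yloop: "sem x (Rep 1 ?yb) (Z ds 0 l) = Z (ds @ map MInput [0..<m]) m l" for ds l
    using sem_Rep_iterate[where S = "\<lambda>i. Z (ds @ map MInput [0..<i]) i l" and n = m and r = 1 and x = x and c = ?yb] regs
    by (simp add: input incr del: sem.simps(2))
  have bloop: "sem x (Rep 3 (?bk blank_cell)) (Z ds j l) = Z (ds @ replicate T blank_cell) j l" for ds j l
    using sem_Rep_iterate[where S = "\<lambda>i. Z (ds @ replicate i blank_cell) j l" and n = T and r = 3 and x = x
        and c = "?bk blank_cell"] regs
    by (simp add: cell C replicate_append_same)
  have rep3: "replicate (T + 3) a = replicate T a @ [a, a, a]" for a :: mdesc
    by (subst replicate_add) (simp add: numeral_3_eq_3)
  have "(v, w) = Z [] 0 0" using v by (auto simp: Z_def fun_eq_iff)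
  then have init: "sem x (init_com n seg) (v, w) = Z (init_descs x m T) m (length x)"
    unfolding init_com_def Let_def seqs.simps sem.simps(1,4)
    by (simp only: cell[OF C(1)] xloop[unfolded seqs.simps] cell[OF C(2)] cell[OF C(3)] cell[OF C(4)]
        yloop[unfolded seqs.simps] bloop append_Nil)
      (simp add: init_descs_def rep3)
  let ?ics = "init_descs x m T"
  let ?v' = "\<lambda>k. v(10 := m, 16 := length x, 11 := (Suc W + k) * n, 12 := (W + k) * n + (n - B),
       13 := k * n + (n - B), 14 := (k + 1) * n + (n - B), 15 := (k + 2) * n + (n - B))"
  define Y where "Y k = (?v' k, w @ enc_gates (blocks f 0 (?ics @ replicate k MStep)))" for k
  have len: "length ?ics = Suc W"
    by (simp add: init_descs_def length_concat comp_def W sum_list_triv)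
  have Y0: "Z ?ics m (length x) = Y 0"
    using v len by (auto simp: Z_def Y_def fun_eq_iff)
  have step: "sem x (seqs [emits (seg MStep), advance n [11, 12, 13, 14, 15]]) (Y k) = Y (Suc k)" for k
  proof -
    have "map (inst (?v' k)) (seg MStep) = map (inst (member_vals n B W (Suc W + k) MStep)) (seg MStep)"
      by (rule inst_segment[where F = "step_fun \<delta> cs" and cur = 11 and irs = "[]" and B = B
            and rs = "step_refs B"])
        (use segs in \<open>auto simp: member_vals_def\<close>)
    then have "map (inst (?v' k)) (seg MStep) = f (length (?ics @ replicate k MStep)) MStep"
      using len by (simp add: f_def member_block_def)
    note e = sem_emits_eq[OF this]
    have "sem x (seqs [emits (seg MStep), advance n [11, 12, 13, 14, 15]]) (Y k) =
        sem x (advance n [11, 12, 13, 14, 15]) (?v' k, (w @ enc_gates (blocks f 0 (?ics @ replicate k MStep))) @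
          enc_gates (f (length (?ics @ replicate k MStep)) MStep))"
      unfolding Y_def seqs.simps sem.simps by (simp only: e append_assoc)
    moreover have "?ics @ replicate (Suc k) MStep = (?ics @ replicate k MStep) @ [MStep]"
      by (simp add: replicate_append_same)
    ultimately show ?thesis
      unfolding Y_def by (simp add: fun_eq_iff algebra_simps)
  qed
  have "fst (Y 0) 5 = N" by (simp add: Y_def v)
  then have loop: "sem x (Rep 5 (seqs [emits (seg MStep), advance n [11, 12, 13, 14, 15]])) (Y 0) = Y N"
    using step by (intro sem_Rep_iterate)
  have "map (inst (?v' N)) (seg MLast) = map (inst (member_vals n B W (Suc W + N) MLast)) (seg MLast)"
    by (rule inst_segment[where F = "point_fun B" and cur = 11
          and irs = point_refs and B = B and rs = "[(12, 0)]"])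
      (use segs v in \<open>auto simp: member_vals_def\<close>)
  then have "map (inst (?v' N)) (seg MLast) = f (length (?ics @ replicate N MStep)) MLast"
    using len by (simp add: f_def member_block_def)
  note e = sem_emits_eq[OF this]
  have "sem x (emits (seg MLast)) (Y N) = (?v' N, w @ enc_gates (blocks f 0 (?ics @ replicate N MStep @ [MLast])))"
    unfolding Y_def by (simp only: e append_assoc) simp
  then show ?thesis unfolding member_com_def seqs.simps sem.simps(1,4) init Y0 loop[unfolded seqs.simps] f_def by simp
qed

section \<open>The reduction\<close>

context helix
begin

lemma hx_initial:
  assumes "W = Suc (length z + d)" "i \<le> W"
  shows "hx i = (WallL # map (\<lambda>b. HC None (sym_of_bit b)) z @ replicate d (HC None 0) @ [Wall]) ! i"
proof -
  consider "i = 0" | j where "i = Suc j" "j < length z + d" | "i = W" "0 < W"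
    using assms by (cases i) (auto simp: le_less)
  then show ?thesis
  proof cases
    case 1
    then show ?thesis using W by (simp add: hx_def initc_def)
  next
    case 2
    then have "i < W" using assms(1) by simp
    then have "hx i = HC None (tape_at [] (map sym_of_bit z) j)"
      using 2(1) by (simp add: hx_def initc_def)
    then show ?thesis using 2 by (auto simp: tape_at_def nth_append)
  next
    case 3
    then show ?thesis using assms hx_row[of 0 0] by (simp add: nth_append)
  qed
qed

end

lemma length_init_descs: "length (init_descs x m T) = 2 * length x + m + T + 7"
  by (simp add: init_descs_def length_concat comp_def sum_list_triv)

lemma length_pair_enc: "length (pair_enc x y) = 2 * length x + length y + 2"
  by (simp add: pair_enc_def length_concat comp_def sum_list_triv)

lemma init_descs_hx:
  assumes "helix Q S \<delta> (pair_enc x y) T W N" "length y = m" "W = 2 * length x + m + 2 + T + 4" "i \<le> W"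
  defines "h \<equiv> helix.hx Q S \<delta> (pair_enc x y) W i"
  shows "init_descs x m T ! i = MCell h \<and> h \<in> init_cells \<or>
    (\<exists>j<m. init_descs x m T ! i = MInput j \<and> h = HC None (sym_of_bit (y ! j)))"
proof -
  interpret helix Q S \<delta> "pair_enc x y" T W N by fact
  define cell where "cell d = (case d of MCell c \<Rightarrow> c | MInput j \<Rightarrow> HC None (sym_of_bit (y ! j)) | _ \<Rightarrow> Wall)" for d
  have "map cell (map MInput [0..<m]) = map (\<lambda>b. HC None (sym_of_bit b)) y"
    using assms(2) by (intro nth_equalityI) (auto simp: cell_def)
  moreover have "map cell (concat (map (\<lambda>b. [bit_cell b, bit_cell b]) x)) =
      map (\<lambda>b. HC None (sym_of_bit b)) (concat (map (\<lambda>b. [b, b]) x))"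
    by (induction x) (auto simp: cell_def)
  moreover have "cell (MCell c) = c" for c by (simp add: cell_def)
  ultimately have eq: "map cell (init_descs x m T) = WallL # map (\<lambda>b. HC None (sym_of_bit b)) (pair_enc x y) @
      replicate (T + 3) (HC None 0) @ [Wall]"
    unfolding init_descs_def pair_enc_def map_append by simp
  have i: "i < length (init_descs x m T)" using assms(3,4) by (simp add: length_init_descs)
  have "W = Suc (length (pair_enc x y) + (T + 3))" using assms(2,3) by (simp add: length_pair_enc)
  then have h: "h = cell (init_descs x m T ! i)"
    unfolding h_def using hx_initial[of "T + 3" i] assms(4) nth_map[OF i, of cell] unfolding eq by simp
  have "init_descs x m T ! i \<in> set (init_descs x m T)" using i by simp
  moreover have "d \<in> MCell ` init_cells \<union> MInput ` {..<m}" if "d \<in> set (init_descs x m T)" for d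
  proof -
    have "HC None (sym_of_bit b) \<in> init_cells" for b by (simp add: init_cells_def sym_of_bit_def)
    moreover have "{WallL, Wall, HC None 0} \<subseteq> init_cells" by (simp add: init_cells_def)
    ultimately show ?thesis using that by (auto simp: init_descs_def)
  qed
  ultimately have "init_descs x m T ! i \<in> MCell ` init_cells \<union> MInput ` {..<m}" by blast
  then show ?thesis using h by (auto simp: cell_def)
qed

text \<open>Each of the finitely many gadgets exists in all sufficiently large lengths; the sum of
  the thresholds yields lengths that suit all of them.\<close>

lemma member_segments_exist:
  assumes "finite C"
  shows "\<exists>n0. \<forall>n\<ge>n0. \<exists>seg. member_segments \<delta> cs n C seg \<and> (\<forall>j. seg (MInput j) = seg (MInput 0))"
proof -
  let ?B = "Suc (length cs)"
  let ?cell = "\<lambda>c. computes 11 [] [] ?B (\<lambda>_. cell_bits cs False c)"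
  let ?input = "computes 11 [(10, 5)] [] ?B (input_fun cs)"
  let ?step = "computes 11 [] (step_refs ?B) ?B (step_fun \<delta> cs)"
  have lenc: "length (cell_bits cs a c) = ?B" for a c by (simp add: cell_bits_def one_hot_def)
  have "\<exists>n0. \<forall>n\<ge>n0. \<exists>G. length G = n \<and> ?cell c G" for c
    by (rule block_for_function) (rule lenc)
  then obtain nc where nc: "\<And>c n. nc c \<le> n \<Longrightarrow> \<exists>G. length G = n \<and> ?cell c G"
    by metis
  obtain ni where ni: "\<And>n. ni \<le> n \<Longrightarrow> \<exists>G. length G = n \<and> ?input G"
    using block_for_function[of "input_fun cs", OF lenc] by blast
  have lens: "length (step_fun \<delta> cs bs) = ?B" for bs by (simp add: step_fun_def Let_def lenc)
  obtain ns where ns: "\<And>n. ns \<le> n \<Longrightarrow> \<exists>G. length G = n \<and> ?step G"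
    using block_for_function[of "step_fun \<delta> cs", OF lens] by blast
  let ?last = "point_fun ?B"
  let ?final = "computes 11 point_refs [(12, 0)] ?B ?last"
  have lenl: "length (?last bs) = ?B" for bs by simp
  obtain nl where nl: "\<And>n. nl \<le> n \<Longrightarrow> \<exists>G. length G = n \<and> ?final G"
    using block_for_function[of ?last, OF lenl] by blast
  show ?thesis
  proof (intro exI[of _ "sum nc C + ni + ns + nl"] allI impI)
    fix n assume n: "sum nc C + ni + ns + nl \<le> n"
    have "\<forall>c\<in>C. \<exists>G. length G = n \<and> ?cell c G"
    proof
      fix c assume "c \<in> C"
      then have "nc c \<le> sum nc C" using assms by (intro member_le_sum) auto
      then show "\<exists>G. length G = n \<and> ?cell c G" using n by (intro nc) simp
    qed
    then obtain GC where GC: "\<And>c. c \<in> C \<Longrightarrow> length (GC c) = n \<and> ?cell c (GC c)"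
      by metis
    obtain GI where GI: "length GI = n" "?input GI" using ni[of n] n by auto
    obtain GS where GS: "length GS = n" "?step GS"
      using ns[of n] n by auto
    obtain GL where GL: "length GL = n" "?final GL"
      using nl[of n] n by auto
    define seg where "seg d = (case d of MCell c \<Rightarrow> if c \<in> C then GC c else replicate n (SConst False)
      | MInput j \<Rightarrow> GI | MStep \<Rightarrow> GS | MLast \<Rightarrow> GL)" for d
    have "length (seg d) = n" for d using GC GI GS GL by (simp add: seg_def split: mdesc.split)
    moreover have "seg (MInput j) = GI" "seg MStep = GS" "seg MLast = GL" "c \<in> C \<Longrightarrow> seg (MCell c) = GC c" for j c
      by (simp_all add: seg_def)
    ultimately show "\<exists>seg. member_segments \<delta> cs n C seg \<and> (\<forall>j. seg (MInput j) = seg (MInput 0))"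
      using GC GI(2) GS(2) GL(2) unfolding member_segments_def Let_def by (intro exI[of _ seg]) simp
  qed
qed

lemma order_segments_exist:
  "\<exists>n0. \<forall>n\<ge>n0. \<exists>seg. order_segments n (seg OFirst) (seg (OBit 0)) (seg OLast) \<and> (\<forall>j. seg (OBit j) = seg (OBit 0)) \<and>
    (\<forall>d. length (seg d) = n)"
proof -
  have len: "length [True] = 1" "length (compare_fun bs) = 1" "length (le_fun bs) = 1" for bs by simp_all
  obtain n0 where n0: "\<And>n. n0 \<le> n \<Longrightarrow> \<exists>G. length G = n \<and> computes 17 [] [] 1 (\<lambda>_. [True]) G"
    using block_for_function[of "\<lambda>_. [True]", OF len(1)] by blast
  obtain n1 where n1: "\<And>n. n1 \<le> n \<Longrightarrow> \<exists>G. length G = n \<and> computes 17 [(19, 4), (20, 4)] [(18, 0)] 1 compare_fun G"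
    using block_for_function[of compare_fun, OF len(2)] by blast
  obtain n2 where n2: "\<And>n. n2 \<le> n \<Longrightarrow> \<exists>G. length G = n \<and>
      computes 17 order_refs [(18, 0)] 1 le_fun G"
    using block_for_function[of le_fun, OF len(3)] by blast
  show ?thesis
  proof (intro exI[of _ "n0 + n1 + n2"] allI impI)
    fix n assume "n0 + n1 + n2 \<le> n"
    then obtain H0 H1 H2 where H: "length H0 = n" "computes 17 [] [] 1 (\<lambda>_. [True]) H0"
      "length H1 = n" "computes 17 [(19, 4), (20, 4)] [(18, 0)] 1 compare_fun H1"
      "length H2 = n" "computes 17 order_refs [(18, 0)] 1 le_fun H2"
      using n0[of n] n1[of n] n2[of n] by auto
    show "\<exists>seg. order_segments n (seg OFirst) (seg (OBit 0)) (seg OLast) \<and> (\<forall>j. seg (OBit j) = seg (OBit 0)) \<and>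
        (\<forall>d. length (seg d) = n)"
      using H unfolding order_segments_def
      by (intro exI[of _ "\<lambda>d. case d of OFirst \<Rightarrow> H0 | OBit j \<Rightarrow> H1 | OLast \<Rightarrow> H2"]) (simp split: odesc.split)
  qed
qed

text \<open>The encoding of a circuit begins with its length, and output cannot be revised, so the
  lengths are computed beforehand in registers 7 and 8. The single \<open>True\<close> announces the
  membership circuit.\<close>

definition reduction_com ::
  "nat \<Rightarrow> nat \<Rightarrow> nat \<Rightarrow> nat \<Rightarrow> nat \<Rightarrow> nat \<Rightarrow> (odesc \<Rightarrow> sgate list) \<Rightarrow> (mdesc \<Rightarrow> sgate list) \<Rightarrow> com" where
  "reduction_com c1 k1 c2 k2 n B oseg mseg = seqs [arith_com c1 k1 c2 k2 n B, emit_idx (6, 0), emit_idx (8, 0),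
     order_com n oseg, Out True, emit_idx (7, 0), member_com n mseg]"

definition final_vals :: "nat \<Rightarrow> nat \<Rightarrow> nat \<Rightarrow> nat \<Rightarrow> nat \<Rightarrow> nat \<Rightarrow> nat" where
  "final_vals nx m T n B = (let W = 2 * nx + m + 2 + T + 4; N = (T + 3) * W in
     (start_vals nx m T n B)(17 := Suc (Suc m) * n, 18 := Suc m * n + (n - 1), 19 := Suc m, 20 := 5 + m + Suc m,
       10 := m, 16 := nx, 11 := (Suc W + N) * n, 12 := (W + N) * n + (n - B),
       13 := N * n + (n - B), 14 := (N + 1) * n + (n - B), 15 := (N + 2) * n + (n - B)))"

text \<open>As registers only grow, this estimate of the final contents is all that
  \<open>poly_time_com\<close> asks for.\<close>

lemma final_vals_bound:
  "final_vals nx m T n B r \<le> (let W = 2 * nx + m + 2 + T + 4; N = (T + 3) * W in (W + N + m + 10) * (n + 1) + 2 * m + nx)"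
proof -
  define W where "W = 2 * nx + m + 2 + T + 4"
  define N where "N = (T + 3) * W"
  have "T \<le> W" "2 * nx + m + 2 \<le> W" by (simp_all add: W_def)
  moreover have "n - B \<le> n" "n - 1 \<le> n" by simp_all
  ultimately show ?thesis
    unfolding final_vals_def start_vals_def Let_def W_def[symmetric] N_def[symmetric]
    by (auto simp: algebra_simps)
qed

definition sp_reduction :: "bool list \<Rightarrow> nat \<Rightarrow> nat \<Rightarrow> nat \<Rightarrow> nat \<Rightarrow> (odesc \<Rightarrow> sgate list) \<Rightarrow> (mdesc \<Rightarrow> sgate list) \<Rightarrow> sp_instance" where
  "sp_reduction x m T n B oseg mseg = (let W = 2 * length x + m + 2 + T + 4; N = (T + 3) * W in
     (5 + m, blocks (order_block n (5 + m) oseg) 0 (order_descs m),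
      Some (blocks (member_block n B W mseg) 0 (init_descs x m T @ replicate N MStep @ [MLast]))))"

lemma sem_reduction_com:
  assumes m: "m = c1 * length x ^ k1 + c1" and T: "T = c2 * (2 * length x + m + 2) ^ k2 + c2"
    and oseg: "order_segments n (oseg OFirst) (oseg (OBit 0)) (oseg OLast)" "\<And>j. oseg (OBit j) = oseg (OBit 0)"
      "\<And>d. length (oseg d) = n"
    and mseg: "member_segments \<delta> cs n init_cells mseg" "\<And>j. mseg (MInput j) = mseg (MInput 0)" and B: "B = Suc (length cs)"
  shows "sem x (reduction_com c1 k1 c2 k2 n B oseg mseg) (init_store x) =
    (final_vals (length x) m T n B, enc_inst (sp_reduction x m T n B oseg mseg))"
proof -
  define W where "W = 2 * length x + m + 2 + T + 4"
  define N where "N = (T + 3) * W"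
  let ?v0 = "start_vals (length x) m T n B"
  let ?v1 = "?v0(17 := Suc (Suc m) * n, 18 := Suc m * n + (n - 1), 19 := Suc m, 20 := 5 + m + Suc m)"
  let ?C = "blocks (order_block n (5 + m) oseg) 0 (order_descs m)"
  let ?M = "blocks (member_block n B W mseg) 0 (init_descs x m T @ replicate N MStep @ [MLast])"
  have mlen: "length (mseg d) = n" for d using mseg(1) by (simp add: member_segments_def Let_def)
  have "length ?C = n * length (order_descs m)"
    by (rule length_blocks) (simp add: order_block_def oseg(3))
  then have lC: "length ?C = (m + 3) * n" by (simp add: order_descs_def algebra_simps)
  have "length ?M = n * length (init_descs x m T @ replicate N MStep @ [MLast])"
    by (rule length_blocks) (simp add: member_block_def mlen)
  moreover have "length (init_descs x m T) = Suc W" by (simp add: length_init_descs W_def)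
  ultimately have lM: "length ?M = (W + N + 2) * n" by (simp add: algebra_simps)
  have idx: "idx ?v0 (6, 0) = 5 + m" "idx ?v0 (8, 0) = length ?C" "idx ?v1 (7, 0) = length ?M"
    unfolding lC lM idx_def start_vals_def Let_def fst_conv snd_conv W_def[symmetric] N_def[symmetric]
    by simp_all
  have ord: "sem x (order_com n oseg) (?v0, w) = (?v1, w @ enc_gates ?C)" for w
    using sem_order_com[OF oseg(1,2), where x = x and m = m and nx = "length x" and T = T and B = B and w = w] by auto
  have mem: "sem x (member_com n mseg) (?v1, w) = (final_vals (length x) m T n B, w @ enc_gates ?M)" for w
    by (subst sem_member_com[OF mseg B, where m = m and T = T and N = N and W = W],
        unfold start_vals_def final_vals_def Let_def W_def[symmetric] N_def[symmetric]) simp_all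
  show ?thesis
    unfolding reduction_com_def seqs.simps sem.simps sem_arith_com[OF m T] sem_emit_idx ord fst_conv snd_conv mem idx
    by (simp add: sp_reduction_def Let_def enc_inst_def enc_circ_def W_def N_def)
qed

lemma reduction_correct:
  assumes wf: "wf_tm (Q, S, \<delta>)"
    and run: "\<And>z. fst (tm_run (Q, S, \<delta>) (c2 * length z ^ k2 + c2) (init_config z)) = 1"
      "\<And>z. tm_output (tm_run (Q, S, \<delta>) (c2 * length z ^ k2 + c2) (init_config z)) = R z"
    and T: "T = c2 * (2 * length x + m + 2) ^ k2 + c2"
    and oseg: "order_segments n (oseg OFirst) (oseg (OBit 0)) (oseg OLast)" "\<And>j. oseg (OBit j) = oseg (OBit 0)"
    and cs: "set cs = hcells Q S" and mseg: "member_segments \<delta> cs n init_cells mseg"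
    and B: "B = Suc (length cs)" "B \<le> n"
  defines "I \<equiv> sp_reduction x m T n B oseg mseg"
  shows "promise I"
    "exists_game (inst_le I) (points I) \<longleftrightarrow> 2 ^ m < 2 * card {y. length y = m \<and> R (pair_enc x y) = [True]}"
proof -
  define W where "W = 2 * length x + m + 2 + T + 4"
  define N where "N = (T + 3) * W"
  have mem: "circ_out (blocks (member_block n B W mseg) 0 (init_descs x m T @ replicate N MStep @ [MLast])) p \<longleftrightarrow>
      is_point (take 4 p) (p ! 4) (R (pair_enc x (drop 5 p)) \<noteq> [True])" if p: "length p = 5 + m" for p
  proof -
    let ?z = "pair_enc x (drop 5 p)"
    \<comment> \<open>The length of \<open>pair_enc x y\<close> is the same for all choice strings,
      so one geometry of the helix fits all of them.\<close>
    have "c2 * length ?z ^ k2 + c2 = T" using p by (simp add: T length_pair_enc)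
    then have r: "fst (tm_run (Q, S, \<delta>) T (init_config ?z)) = 1" "tm_output (tm_run (Q, S, \<delta>) T (init_config ?z)) = R ?z"
      using run[of ?z] by simp_all
    have hel: "helix Q S \<delta> ?z T W N" using wf r(1) by unfold_locales (simp_all add: W_def N_def)
    have "circ_out (blocks (member_block n B W mseg) 0 (init_descs x m T @ replicate N MStep @ [MLast])) p =
        is_point (take 4 p) (p ! 4) (tm_output (tm_run (Q, S, \<delta>) T (init_config ?z)) \<noteq> [True])"
    proof (rule helix.member_circuit[OF hel mseg B cs _ _ p])
      show "length (init_descs x m T) = Suc W" by (simp add: length_init_descs W_def)
      fix i assume "i \<le> W"
      from init_descs_hx[OF hel _ W_def this] p
      show "init_descs x m T ! i = MCell (helix.hx Q S \<delta> ?z W i) \<and> helix.hx Q S \<delta> ?z W i \<in> init_cells \<or>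
          (\<exists>j<m. init_descs x m T ! i = MInput j \<and> helix.hx Q S \<delta> ?z W i = HC None (sym_of_bit (p ! (5 + j))))"
        by auto
    qed
    then show ?thesis unfolding r(2) .
  qed
  have P: "points I = {p. length p = 5 + m \<and> is_point (take 4 p) (p ! 4) (\<not> R (pair_enc x (drop 5 p)) = [True])}"
    using mem by (auto simp: points_def I_def sp_reduction_def Let_def W_def N_def)
  have le: "inst_le I p q \<longleftrightarrow> point_le (take 4 p) (take 4 q) (lsb_val (drop 4 p) \<le> lsb_val (drop 4 q))"
    if "p \<in> points I" "q \<in> points I" for p q
    using order_circuit[OF oseg, of p m q] that B unfolding P
    by (simp add: inst_le_def I_def sp_reduction_def Let_def)
  show "promise I" "exists_game (inst_le I) (points I) \<longleftrightarrow> 2 ^ m < 2 * card {y. length y = m \<and> R (pair_enc x y) = [True]}"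
    using counting_poset[OF le P] unfolding promise_def by blast+
qed

theorem mainTheorem15:
  shows "PP_hard_promise NFree_yes NFree_no"
  unfolding PP_hard_promise_def
proof (intro allI impI)
  fix L assume "in_PP L"
  then obtain R c1 k1 where R: "poly_time_computable R" and L: "\<And>x. x \<in> L \<longleftrightarrow>
      2 ^ (c1 * length x ^ k1 + c1) < 2 * card {y. length y = c1 * length x ^ k1 + c1 \<and> R (pair_enc x y) = [True]}"
    unfolding in_PP_def Let_def by blast
  from R obtain Mt c2 k2 where Mt: "wf_tm Mt"
    "\<And>z. fst (tm_run Mt (c2 * length z ^ k2 + c2) (init_config z)) = 1"
    "\<And>z. tm_output (tm_run Mt (c2 * length z ^ k2 + c2) (init_config z)) = R z"
    unfolding poly_time_computable_def Let_def by blast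
  obtain Q S \<delta> where QS: "Mt = (Q, S, \<delta>)" using prod_cases3 by blast
  obtain cs where cs: "set cs = hcells Q S" using finite_list[OF finite_hcells] by blast
  define B where "B = Suc (length cs)"
  have "finite init_cells" by (simp add: init_cells_def)
  then obtain nm where nm: "\<And>n. nm \<le> n \<Longrightarrow> \<exists>seg. member_segments \<delta> cs n init_cells seg \<and> (\<forall>j. seg (MInput j) = seg (MInput 0))"
    using member_segments_exist[of init_cells \<delta> cs] by blast
  obtain no where no: "\<And>n. no \<le> n \<Longrightarrow> \<exists>seg. order_segments n (seg OFirst) (seg (OBit 0)) (seg OLast) \<and>
      (\<forall>j. seg (OBit j) = seg (OBit 0)) \<and> (\<forall>d. length (seg d) = n)"
    using order_segments_exist by blast
  \<comment> \<open>The block length depends on the verifier only and is thus a constant of the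
    program; it exceeds both thresholds and leaves room for \<open>B\<close> results.\<close>
  define n where "n = nm + no + B"
  obtain mseg where mseg: "member_segments \<delta> cs n init_cells mseg" "\<And>j. mseg (MInput j) = mseg (MInput 0)"
    using nm[of n] by (auto simp: n_def)
  obtain oseg where oseg: "order_segments n (oseg OFirst) (oseg (OBit 0)) (oseg OLast)" "\<And>j. oseg (OBit j) = oseg (OBit 0)"
    "\<And>d. length (oseg d) = n" using no[of n] by (auto simp: n_def)
  define m where "m i = c1 * i ^ k1 + c1" for i
  define T where "T i = c2 * (2 * i + m i + 2) ^ k2 + c2" for i
  define I where "I x = sp_reduction x (m (length x)) (T (length x)) n B oseg mseg" for x
  let ?c = "reduction_com c1 k1 c2 k2 n B oseg mseg"
  have sem: "sem x ?c (init_store x) = (final_vals (length x) (m (length x)) (T (length x)) n B, enc_inst (I x))" for x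
    unfolding I_def by (rule sem_reduction_com[OF m_def T_def oseg mseg B_def])
  have poly: "poly_bounded m" "poly_bounded T"
    unfolding T_def m_def by (intro poly_bounded_add poly_bounded_mult poly_bounded_power poly_bounded_const poly_bounded_id)+
  have "poly_time_computable (\<lambda>x. snd (sem x ?c (init_store x)))"
  proof (rule poly_time_com)
    show "wf_com ?c" by (simp add: reduction_com_def wf_arith_com wf_order_com wf_member_com)
    show "fst (sem x ?c (init_store x)) r \<le> (\<lambda>i. let W = 2 * i + m i + 2 + T i + 4; N = (T i + 3) * W in
        (W + N + m i + 10) * (n + 1) + 2 * m i + i) (length x)" for x r
      unfolding sem fst_conv by (rule final_vals_bound)
    show "poly_bounded (\<lambda>i. let W = 2 * i + m i + 2 + T i + 4; N = (T i + 3) * W in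
        (W + N + m i + 10) * (n + 1) + 2 * m i + i)"
      unfolding Let_def by (intro poly_bounded_add poly_bounded_mult poly_bounded_const poly_bounded_id poly)
  qed
  then have "poly_time_computable (\<lambda>x. enc_inst (I x))" by (simp add: sem)
  moreover have "promise (I x)" "exists_game (inst_le (I x)) (points (I x)) \<longleftrightarrow> x \<in> L" for x
    using reduction_correct[OF Mt[unfolded QS] T_def oseg(1,2) cs mseg(1) B_def, of x] L[of x]
    unfolding I_def m_def[symmetric] by (simp_all add: n_def)
  ultimately show "\<exists>f. poly_time_computable f \<and> (\<forall>x. (x \<in> L \<longrightarrow> f x \<in> NFree_yes) \<and> (x \<notin> L \<longrightarrow> f x \<in> NFree_no))"
    unfolding NFree_yes_def NFree_no_def by (intro exI[of _ "\<lambda>x. enc_inst (I x)"]) blast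
qed

end
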